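(* Let $l,k\ge 1$ be integers, $n=l+k$, $E=\mathbb{C}^n$ and $X=\operatorname{Gr}(l,E)$. Let $\lambda=(\lambda_1\ge\dots\ge\lambda_l\ge 0)$ be a partition contained in an $l\times k$ rectangle (i.e. $\lambda_1\le k$) and let $p$ be an integer with $0\le p\le k$. Then in the small quantum cohomology ring $QH^*X$, $$\sigma_p\cdot\sigma_\lambda=\sum_\mu \sigma_\mu+q\sum_\nu\sigma_\nu ,$$ where the first sum is over all partitions $\mu=(\mu_1\ge\dots\ge\mu_l\ge 0)$ such that $|\mu|=|\lambda|+p$ and $k\ge\mu_1\ge\lambda_1\ge\mu_2\ge\lambda_2\ge\dots\ge\mu_l\ge\lambda_l$, and the second sum is over all partitions $\nu=(\nu_1\ge\dots\ge\nu_l\ge 0)$ such that $|\nu|=|\lambda|+p-n$ and $\lambda_1-1\ge\nu_1\ge\lambda_2-1\ge\nu_2\ge\dots\ge\lambda_l-1\ge\nu_l\ge 0$.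
   Context: $\operatorname{Gr}(l,E)$ is the Grassmannian of $l$-dimensional subspaces of $E=\mathbb{C}^n$. For a partition $\lambda$ write $|\lambda|=\sum\lambda_i$. For a complete flag $F_1\subset F_2\subset\dots\subset F_n=E$ ($\dim F_i=i$) and a partition $\lambda=(\lambda_1\ge\dots\ge\lambda_l\ge0)$ with $\lambda_1\le k$, the Schubert variety is $\Omega_\lambda(F_\bullet)=\{V\in X\mid \dim(V\cap F_{k+i-\lambda_i})\ge i\ \ \forall\,1\le i\le l\}$; it has codimension $|\lambda|$, and $\Omega_\lambda\in H^*X=H^*(X;\mathbb{Z})$ denotes its class. The classes $\Omega_\lambda$, for $\lambda$ contained in the $l\times k$ rectangle, form a $\mathbb{Z}$-basis of $H^*X$. An integer $p$ with $0\le p\le k$ is identified with the one-row partition $(p)$. The degree of a regular map $f:\mathbb{P}^1\to\mathbb{P}^N$ is the number of points in the inverse image of a general hyperplane; the degree of a map $\mathbb{P}^1\to X$ is that of its composition with the Plücker embedding $X\subset\mathbb{P}(\bigwedge^l E)$. For partitions $\lambda,\mu,\nu$ in the $l\times k$ rectangle and $d\ge0$ with $|\lambda|+|\mu|+|\nu|=lk+dn$, the Gromov-Witten invariant $\langle\Omega_\lambda,\Omega_\mu,\Omega_\nu\rangle_d$ is the number of rational curves $f:\mathbb{P}^1\to X$ of degree $d$ which meet all of $\Omega_\lambda(F_\bullet),\Omega_\mu(G_\bullet),\Omega_\nu(H_\bullet)$ for general flags $F_\bullet,G_\bullet,H_\bullet$, up to automorphisms of $\mathbb{P}^1$. If $|\lambda|+|\mu|+|\nu|\ne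 lk+dn$ the invariant is $0$. The (small) quantum cohomology ring $QH^*X$ is $H^*X\otimes_{\mathbb{Z}}\mathbb{Z}[q]$ as a $\mathbb{Z}[q]$-module, with Schubert classes $\sigma_\lambda=\Omega_\lambda\otimes1$ and $\mathbb{Z}[q]$-bilinear product $\sigma_\lambda\cdot\sigma_\mu=\sum_{\nu,\,d\ge0}\langle\Omega_\lambda,\Omega_\mu,\Omega_{\nu^\vee}\rangle_d\,q^d\,\sigma_\nu$, where $\nu^\vee=(k-\nu_l,\dots,k-\nu_1)$. It is a known fact, assumed here, that this defines an associative (commutative) ring. *)

theory Defs
  imports
    "HOL-Analysis.Analysis"
    "HOL-Combinatorics.Permutations"
    "HOL-Computational_Algebra.Polynomial"
    "HOL-Library.FuncSet"
    "HOL-Library.Poly_Mapping"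
begin

section \<open>Partitions\<close>

text \<open>A partition with at most \<open>l\<close> parts is a weakly decreasing list of length exactly \<open>l\<close>,
  padded with zeros. Mathematical indices are 1-based, hence \<open>part\<close>.\<close>

definition is_partition :: "nat \<Rightarrow> nat list \<Rightarrow> bool" where
  "is_partition l lam \<longleftrightarrow> length lam = l \<and> sorted_wrt (\<ge>) lam"

definition part :: "nat list \<Rightarrow> nat \<Rightarrow> nat" where
  "part lam i = lam ! (i - 1)"

definition rect_partitions :: "nat \<Rightarrow> nat \<Rightarrow> nat list set" where
  "rect_partitions l k = {lam. is_partition l lam \<and> (\<forall>x\<in>set lam. x \<le> k)}"

definition row_partition :: "nat \<Rightarrow> nat \<Rightarrow> nat list" where
  "row_partition l p = p # replicate (l - 1) 0"

definition dual_partition :: "nat \<Rightarrow> nat list \<Rightarrow> nat list" where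
  "dual_partition k nu = map (\<lambda>x. k - x) (rev nu)"


section \<open>General points\<close>

text \<open>\<open>poly_fun C\<close> is the complex algebra of functions generated by a set \<open>C\<close> of coordinate
  functions. When \<open>C\<close> consists of finitely many independent linear coordinates, \<open>general C P\<close>
  says that \<open>P\<close> holds on some nonempty Zariski open subset of the affine space with these
  coordinates (it is enough to consider principal open sets).\<close>

inductive poly_fun :: "('x \<Rightarrow> complex) set \<Rightarrow> ('x \<Rightarrow> complex) \<Rightarrow> bool" for C where
  const: "poly_fun C (\<lambda>x. a)"
| coord: "c \<in> C \<Longrightarrow> poly_fun C c"
| add: "poly_fun C g \<Longrightarrow> poly_fun C h \<Longrightarrow> poly_fun C (\<lambda>x. g x + h x)"
| mult: "poly_fun C g \<Longrightarrow> poly_fun C h \<Longrightarrow> poly_fun C (\<lambda>x. g x * h x)"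

definition general :: "('x \<Rightarrow> complex) set \<Rightarrow> ('x \<Rightarrow> bool) \<Rightarrow> bool" where
  "general C P \<longleftrightarrow> (\<exists>g. poly_fun C g \<and> (\<exists>x. g x \<noteq> 0) \<and> (\<forall>x. g x \<noteq> 0 \<longrightarrow> P x))"


section \<open>Projective spaces and regular maps from the projective line\<close>

text \<open>The projective space with homogeneous coordinates indexed by the finite set \<open>I\<close>.
  A point is the set of all its vectors of homogeneous coordinates, which are functions
  vanishing outside \<open>I\<close>.\<close>

definition hcoords :: "'i set \<Rightarrow> ('i \<Rightarrow> complex) set" where
  "hcoords I = {x. (\<forall>i. i \<notin> I \<longrightarrow> x i = 0) \<and> (\<exists>i\<in>I. x i \<noteq> 0)}"

definition ppoint :: "('i \<Rightarrow> complex) \<Rightarrow> ('i \<Rightarrow> complex) set" where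
  "ppoint x = {(\<lambda>i. c * x i) | c. c \<noteq> 0}"

definition proj_space :: "'i set \<Rightarrow> ('i \<Rightarrow> complex) set set" where
  "proj_space I = ppoint ` hcoords I"

type_synonym ppt1 = "(nat \<Rightarrow> complex) set"

abbreviation P1 :: "ppt1 set" where
  "P1 \<equiv> proj_space {0, 1}"

definition binary_form :: "nat \<Rightarrow> ((nat \<Rightarrow> complex) \<Rightarrow> complex) \<Rightarrow> bool" where
  "binary_form e h \<longleftrightarrow> (\<exists>a :: nat \<Rightarrow> complex. h = (\<lambda>x. \<Sum>j\<le>e. a j * x 0 ^ j * x 1 ^ (e - j)))"

text \<open>Regularity is local: near every point the map is given by forms of a common degree that
  do not all vanish at that point. Multiplying these forms by one that vanishes off the given
  neighbourhood, one may take as neighbourhood the set where they are not all zero.\<close>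

definition regular_P1 :: "'i set \<Rightarrow> (ppt1 \<Rightarrow> ('i \<Rightarrow> complex) set) \<Rightarrow> bool" where
  "regular_P1 I f \<longleftrightarrow>
     (\<forall>z\<in>P1. f z \<in> proj_space I) \<and>
     (\<forall>x\<in>hcoords {0, 1}. \<exists>e h.
        (\<forall>i\<in>I. binary_form e (h i)) \<and> (\<exists>i\<in>I. h i x \<noteq> 0) \<and>
        (\<forall>y\<in>hcoords {0, 1}. (\<exists>i\<in>I. h i y \<noteq> 0) \<longrightarrow>
            f (ppoint y) = ppoint (\<lambda>i. if i \<in> I then h i y else 0)))"

definition aut_P1 :: "(ppt1 \<Rightarrow> ppt1) \<Rightarrow> bool" where
  "aut_P1 \<phi> \<longleftrightarrow> regular_P1 {0, 1} \<phi> \<and>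
     (\<exists>\<psi>. regular_P1 {0, 1} \<psi> \<and> (\<forall>z\<in>P1. \<psi> (\<phi> z) = z \<and> \<phi> (\<psi> z) = z))"

definition hyperplane :: "'i set \<Rightarrow> ('i \<Rightarrow> complex) \<Rightarrow> ('i \<Rightarrow> complex) set set" where
  "hyperplane I c = {L \<in> proj_space I. \<forall>x\<in>L. (\<Sum>i\<in>I. c i * x i) = 0}"

text \<open>Finiteness must be required separately, since \<open>card\<close> is 0 on infinite sets.\<close>

definition has_degree :: "'i set \<Rightarrow> (ppt1 \<Rightarrow> ('i \<Rightarrow> complex) set) \<Rightarrow> nat \<Rightarrow> bool" where
  "has_degree I f d \<longleftrightarrow>
     general {(\<lambda>c. c i) | i. i \<in> I}
       (\<lambda>c. (\<exists>i\<in>I. c i \<noteq> 0) \<longrightarrow>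
          finite {z \<in> P1. f z \<in> hyperplane I c} \<and>
          card {z \<in> P1. f z \<in> hyperplane I c} = d)"


section \<open>The Grassmannian and its Schubert varieties\<close>

text \<open>The ambient space is \<open>complex^'n\<close> with its complex structure (\<open>vec.subspace\<close>,
  \<open>vec.dim\<close>, \<open>vec.span\<close> refer to complex scalars). The linear order on the index type is only
  used to order the rows of the minors.\<close>

definition Gr :: "nat \<Rightarrow> (complex^'n) set set" where
  "Gr l = {V. vec.subspace V \<and> vec.dim V = l}"

text \<open>Coordinates on the \<open>l\<close>-th exterior power are indexed by the \<open>l\<close>-element sets of basis
  vectors; \<open>wedge_coords l v\<close> is the vector \<open>v 0 \<and> \<dots> \<and> v (l-1)\<close>, whose coordinates are the
  maximal minors. A different choice of \<open>v\<close> in \<open>plucker\<close> rescales it by a nonzero number.\<close>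

definition plucker_index :: "nat \<Rightarrow> 'n::finite set set" where
  "plucker_index l = {S. card S = l}"

definition wedge_coords ::
    "nat \<Rightarrow> (nat \<Rightarrow> complex^'n::{finite,linorder}) \<Rightarrow> 'n set \<Rightarrow> complex" where
  "wedge_coords l v S =
     (if card S = l
      then \<Sum>\<pi> | \<pi> permutes {..<l}. of_int (sign \<pi>) * (\<Prod>a<l. v a $ (sorted_list_of_set S ! \<pi> a))
      else 0)"

definition plucker ::
    "nat \<Rightarrow> (complex^'n::{finite,linorder}) set \<Rightarrow> ('n set \<Rightarrow> complex) set" where
  "plucker l V = ppoint (wedge_coords l (SOME v. vec.span (v ` {..<l}) = V))"

text \<open>Only the members \<open>F 0, \<dots>, F n\<close> of a flag matter.\<close>

definition complete_flag :: "(nat \<Rightarrow> (complex^'n) set) \<Rightarrow> bool" where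
  "complete_flag F \<longleftrightarrow>
     (\<forall>i\<le>CARD('n). vec.subspace (F i) \<and> vec.dim (F i) = i) \<and>
     (\<forall>i<CARD('n). F i \<subseteq> F (Suc i))"

definition schubert_variety ::
    "nat \<Rightarrow> nat \<Rightarrow> nat list \<Rightarrow> (nat \<Rightarrow> (complex^'n) set) \<Rightarrow> (complex^'n) set set" where
  "schubert_variety l k lam F =
     {V \<in> Gr l. \<forall>i\<in>{1..l}. vec.dim (V \<inter> F (k + i - part lam i)) \<ge> i}"

text \<open>The flag variety is the quotient of the variety of ordered bases of the ambient space by
  the group of triangular matrices, and carries the quotient Zariski topology. A property thus
  holds for general triples of flags iff it holds for the triples of flags spanned by general
  triples of ordered bases. A triple that is adapted to complete flags consists of bases.\<close>

definition adapted_basis :: "(nat \<Rightarrow> complex^'n) \<Rightarrow> (nat \<Rightarrow> (complex^'n) set) \<Rightarrow> bool" where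
  "adapted_basis u F \<longleftrightarrow> (\<forall>i\<le>CARD('n). F i = vec.span (u ` {..<i}))"

definition basis_triple_coords ::
    "((nat \<Rightarrow> complex^'n) \<times> (nat \<Rightarrow> complex^'n) \<times> (nat \<Rightarrow> complex^'n) \<Rightarrow> complex) set" where
  "basis_triple_coords =
     {(\<lambda>(u, v, w). u i $ j) | i j. i < CARD('n)} \<union>
     {(\<lambda>(u, v, w). v i $ j) | i j. i < CARD('n)} \<union>
     {(\<lambda>(u, v, w). w i $ j) | i j. i < CARD('n)}"

definition general_flags ::
    "((nat \<Rightarrow> (complex^'n) set) \<Rightarrow> (nat \<Rightarrow> (complex^'n) set) \<Rightarrow> (nat \<Rightarrow> (complex^'n) set) \<Rightarrow> bool)
      \<Rightarrow> bool" where
  "general_flags P \<longleftrightarrow>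
     general basis_triple_coords
       (\<lambda>(u, v, w). \<forall>F G H.
          complete_flag F \<and> complete_flag G \<and> complete_flag H \<and>
          adapted_basis u F \<and> adapted_basis v G \<and> adapted_basis w H \<longrightarrow> P F G H)"


section \<open>Gromov-Witten invariants\<close>

definition rational_curve ::
    "nat \<Rightarrow> nat \<Rightarrow> (ppt1 \<Rightarrow> (complex^'n::{finite,linorder}) set) \<Rightarrow> bool" where
  "rational_curve l d f \<longleftrightarrow>
     f \<in> P1 \<rightarrow>\<^sub>E Gr l \<and>
     regular_P1 (plucker_index l) (\<lambda>z. plucker l (f z)) \<and>
     has_degree (plucker_index l) (\<lambda>z. plucker l (f z)) d"

definition reparam :: "((ppt1 \<Rightarrow> (complex^'n) set) \<times> (ppt1 \<Rightarrow> (complex^'n) set)) set" where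
  "reparam = {(f, g). \<exists>\<phi>. aut_P1 \<phi> \<and> g = compose P1 f \<phi>}"

definition curves_meeting ::
    "nat \<Rightarrow> nat \<Rightarrow> (complex^'n::{finite,linorder}) set set \<Rightarrow> (complex^'n::{finite,linorder}) set set \<Rightarrow>
      (complex^'n::{finite,linorder}) set set \<Rightarrow> (ppt1 \<Rightarrow> (complex^'n::{finite,linorder}) set) set set" where
  "curves_meeting l d A B C =
     {f. rational_curve l d f \<and> f ` P1 \<inter> A \<noteq> {} \<and> f ` P1 \<inter> B \<noteq> {} \<and> f ` P1 \<inter> C \<noteq> {}} // reparam"

definition GW ::
    "'n::{finite,linorder} itself \<Rightarrow> nat \<Rightarrow> nat \<Rightarrow> nat list \<Rightarrow> nat list \<Rightarrow> nat list \<Rightarrow> nat \<Rightarrow> nat" where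
  "GW _ l k lam mu nu d =
     (if sum_list lam + sum_list mu + sum_list nu = l * k + d * CARD('n)
      then THE N. general_flags (\<lambda>F G (H :: nat \<Rightarrow> (complex^'n::{finite,linorder}) set).
             finite (curves_meeting l d (schubert_variety l k lam F) (schubert_variety l k mu G)
                       (schubert_variety l k nu H)) \<and>
             card (curves_meeting l d (schubert_variety l k lam F) (schubert_variety l k mu G)
                       (schubert_variety l k nu H)) = N)
      else 0)"


section \<open>Small quantum cohomology\<close>

text \<open>Since the Schubert classes form a basis of the cohomology, the quantum cohomology is the
  free module over \<open>int poly\<close> (polynomials in \<open>q\<close>) on the partitions in the rectangle. Its
  elements are the finitely supported functions whose \<open>keys\<close> lie in \<open>rect_partitions l k\<close>.\<close>

type_synonym qh = "nat list \<Rightarrow>\<^sub>0 int poly"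

definition qscale :: "int poly \<Rightarrow> qh \<Rightarrow> qh" where
  "qscale c x = Poly_Mapping.map (\<lambda>a. c * a) x"

definition q :: "int poly" where
  "q = monom 1 1"

definition sigma :: "nat list \<Rightarrow> qh" where
  "sigma lam = Poly_Mapping.single lam 1"

text \<open>At most one \<open>d\<close> contributes to each sum over all \<open>d\<close>.\<close>

definition schubert_product ::
    "'n::{finite,linorder} itself \<Rightarrow> nat \<Rightarrow> nat \<Rightarrow> nat list \<Rightarrow> nat list \<Rightarrow> qh" where
  "schubert_product E l k lam mu =
     (\<Sum>nu\<in>rect_partitions l k. Sum_any (\<lambda>d :: nat.
        qscale (of_nat (GW E l k lam mu (dual_partition k nu) d) * q ^ d) (sigma nu)))"

definition qmult ::
    "'n::{finite,linorder} itself \<Rightarrow> nat \<Rightarrow> nat \<Rightarrow> qh \<Rightarrow> qh \<Rightarrow> qh" where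
  "qmult E l k x y =
     (\<Sum>lam\<in>Poly_Mapping.keys x. \<Sum>mu\<in>Poly_Mapping.keys y.
        qscale (Poly_Mapping.lookup x lam * Poly_Mapping.lookup y mu)
          (schubert_product E l k lam mu))"

end

theory Submission
  imports Defs
    "Jordan_Normal_Form.Determinant"
    "HOL-Computational_Algebra.Fundamental_Theorem_Algebra"
begin

text \<open>Write \<open>n = l + k\<close>. A curve of degree \<open>d\<close> is the row space of an \<open>l \<times> n\<close> matrix whose rows are
  binary forms of degrees \<open>d 0, \<dots>, d (l - 1)\<close>, independent at every point, with
  \<open>d = d 0 + \<dots> + d (l - 1)\<close>. Hence all its points are contained in one subspace \<open>S\<close> of dimension
  \<open>l + d\<close>; and for \<open>d = 1\<close> they form a pencil \<open>K + \<langle>x 0 a + x 1 b\<rangle>\<close>.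

  Let \<open>e\<close> be the basis adapted to the opposite flags \<open>G\<close> and \<open>H\<close>. If the curve meets the Schubert
  varieties of \<open>lam\<close> and of the dual of \<open>nu\<close>, then the incidence conditions inherited by \<open>S\<close> force \<open>S\<close>
  to meet the span of \<open>e c\<close>, \<open>c \<in> J i\<close>, for \<open>l + d\<close> intervals \<open>J i\<close>, and to lie in the span of
  \<open>e c\<close>, \<open>c \<in> \<Union>i. J i\<close>. If it meets the special Schubert variety of \<open>p\<close> too, then \<open>S\<close> meets the
  member of dimension \<open>k + 1 - p\<close> of the flag \<open>F\<close>, which is general with respect to \<open>e\<close>, so that the
  union has at least \<open>l + p\<close> elements. As the total length of the intervals is \<open>l + p + d - d\<^sup>2\<close>, this
  leaves \<open>d \<le> 1\<close> and disjoint intervals, which are the interlacing conditions of the formula.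
  Conversely, for disjoint intervals the member of \<open>F\<close> meets the span in a line, whose generator has
  components \<open>u i\<close> along the \<open>J i\<close>, and these span the only possible \<open>S\<close>. For \<open>d = 1\<close> the pencil is
  recovered from its points \<open>\<langle>u 1, \<dots>, u l\<rangle>\<close> and \<open>\<langle>u 2, \<dots>, u (l + 1)\<rangle>\<close>.\<close>

text \<open>Regularity only supplies forms near each point, and products of such forms acquire
  common zeros. Global rows come from a minimality argument: among all rows of forms that span the
  curve at almost all points, those of least total degree are independent everywhere, since a
  dependence at a point would allow a degree to be lowered. That the row degrees add up to the
  degree of the curve is a Bertini argument for a pencil of hyperplanes. All genericity is
  concentrated in \<open>transversal_flags\<close>, which amounts to the nonvanishing of finitely
  many determinants in the entries of three bases. Every count is made for an arbitrary triple of
  this kind, and the number of curves is then 0 or 1, so that the dimension of a space of curves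
  never enters. The number in \<open>GW\<close> is well defined because two general conditions
  always hold together somewhere. The total length of the intervals comes from the size condition
  \<open>|nu| + d n = |lam| + p\<close>. The same condition alone rules out the degrees above
  \<open>k\<close>, for which a subspace of dimension \<open>l + d\<close> would not fit into the
  ambient space.\<close>

no_notation vec_index (infixl "$" 100)

section \<open>Linear independence of families\<close>

text \<open>Independence of a family, not of its image: equal vectors at different indices are
  dependent, just as a repeated row makes a \<open>minor\<close> vanish.\<close>

definition indep_on :: "'i set \<Rightarrow> ('i \<Rightarrow> 'a::field^'n::finite) \<Rightarrow> bool" where
  "indep_on I v \<longleftrightarrow> (\<forall>c. (\<Sum>i\<in>I. c i *s v i) = 0 \<longrightarrow> (\<forall>i\<in>I. c i = 0))"

lemma indep_onD: "indep_on I v \<Longrightarrow> (\<Sum>i\<in>I. c i *s v i) = 0 \<Longrightarrow> i \<in> I \<Longrightarrow> c i = 0"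
  unfolding indep_on_def by blast

lemma indep_on_cong: "(\<And>i. i \<in> I \<Longrightarrow> v i = w i) \<Longrightarrow> indep_on I v \<longleftrightarrow> indep_on I w"
  unfolding indep_on_def by (simp cong: sum.cong)

lemma span_image_eq:
  fixes v :: "'i \<Rightarrow> 'a::field^'n::finite"
  assumes "finite I"
  shows "vec.span (v ` I) = range (\<lambda>c. \<Sum>i\<in>I. c i *s v i)"
proof
  have "vec.subspace (range (\<lambda>c. \<Sum>i\<in>I. c i *s v i))"
    unfolding vec.subspace_def
  proof (intro conjI ballI allI)
    show "0 \<in> range (\<lambda>c. \<Sum>i\<in>I. c i *s v i)"
      by (rule image_eqI[of _ _ "\<lambda>_. 0"]) auto
  next
    fix x y assume "x \<in> range (\<lambda>c. \<Sum>i\<in>I. c i *s v i)" "y \<in> range (\<lambda>c. \<Sum>i\<in>I. c i *s v i)"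
    then obtain c d where "x = (\<Sum>i\<in>I. c i *s v i)" "y = (\<Sum>i\<in>I. d i *s v i)" by auto
    then show "x + y \<in> range (\<lambda>c. \<Sum>i\<in>I. c i *s v i)"
      by (intro image_eqI[of _ _ "\<lambda>i. c i + d i"]) (auto simp: sum.distrib vec.scale_left_distrib)
  next
    fix a x assume "x \<in> range (\<lambda>c. \<Sum>i\<in>I. c i *s v i)"
    then obtain c where "x = (\<Sum>i\<in>I. c i *s v i)" by auto
    then show "a *s x \<in> range (\<lambda>c. \<Sum>i\<in>I. c i *s v i)"
      by (intro image_eqI[of _ _ "\<lambda>i. a * c i"]) (auto simp: vec.scale_sum_right)
  qed
  moreover have "v ` I \<subseteq> range (\<lambda>c. \<Sum>i\<in>I. c i *s v i)"
  proof safe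
    fix i assume i: "i \<in> I"
    have "(\<Sum>j\<in>I. (if j = i then 1 else 0) *s v j) = (\<Sum>j\<in>I. if j = i then v j else 0)"
      by (intro sum.cong) auto
    also have "\<dots> = v i" using i assms by simp
    finally show "v i \<in> range (\<lambda>c. \<Sum>i\<in>I. c i *s v i)"
      by (intro image_eqI[of _ _ "\<lambda>j. if j = i then 1 else 0"]) auto
  qed
  ultimately show "vec.span (v ` I) \<subseteq> range (\<lambda>c. \<Sum>i\<in>I. c i *s v i)"
    by (rule vec.span_minimal[rotated])
  show "range (\<lambda>c. \<Sum>i\<in>I. c i *s v i) \<subseteq> vec.span (v ` I)"
    by (auto intro!: vec.span_sum vec.span_scale intro: vec.span_base)
qed

lemma in_span_imageE:
  fixes v :: "'i \<Rightarrow> 'a::field^'n::finite"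
  assumes "x \<in> vec.span (v ` I)" "finite I"
  obtains c where "x = (\<Sum>i\<in>I. c i *s v i)"
  using assms by (auto simp: span_image_eq)

lemma sum_in_span_image: "J \<subseteq> I \<Longrightarrow> (\<Sum>i\<in>J. c i *s v i) \<in> vec.span (v ` I)"
  by (intro vec.span_sum vec.span_scale vec.span_base) auto

lemma indep_on_iff_independent:
  fixes v :: "'i \<Rightarrow> 'a::field^'n::finite"
  assumes "finite I"
  shows "indep_on I v \<longleftrightarrow> inj_on v I \<and> vec.independent (v ` I)"
proof
  assume ind: "indep_on I v"
  have inj: "inj_on v I"
  proof (rule inj_onI, rule ccontr)
    fix i j assume ij: "i \<in> I" "j \<in> I" "v i = v j" "i \<noteq> j"
    let ?c = "\<lambda>m. if m = i then 1 else if m = j then -1 else 0 :: 'a"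
    have "(\<Sum>m\<in>I. ?c m *s v m) = (\<Sum>m\<in>I. (if m = i then v m else 0) + (if m = j then - v m else 0))"
      using ij by (intro sum.cong) auto
    also have "\<dots> = 0" using ij assms by (simp add: sum.distrib)
    finally have "?c i = 0" using indep_onD[OF ind, of ?c i] ij(1) by simp
    then show False by simp
  qed
  moreover have "vec.independent (v ` I)"
    unfolding vec.independent_explicit
  proof (intro conjI allI impI ballI)
    show "finite (v ` I)" using assms by simp
    fix c x assume "(\<Sum>x\<in>v ` I. c x *s x) = 0" "x \<in> v ` I"
    then have "(\<Sum>i\<in>I. c (v i) *s v i) = 0" by (simp add: sum.reindex[OF inj])
    from indep_onD[OF ind this] \<open>x \<in> v ` I\<close> show "c x = 0" by auto
  qed
  ultimately show "inj_on v I \<and> vec.independent (v ` I)" ..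
next
  assume a: "inj_on v I \<and> vec.independent (v ` I)"
  show "indep_on I v" unfolding indep_on_def
  proof (intro allI impI ballI)
    fix c i assume c: "(\<Sum>i\<in>I. c i *s v i) = 0" "i \<in> I"
    have "(\<Sum>x\<in>v ` I. c (the_inv_into I v x) *s x) = (\<Sum>i\<in>I. c (the_inv_into I v (v i)) *s v i)"
      using a by (subst sum.reindex) (auto simp: o_def)
    also have "\<dots> = (\<Sum>i\<in>I. c i *s v i)"
      using a by (intro sum.cong) (auto simp: the_inv_into_f_f)
    finally have "\<forall>x\<in>v ` I. c (the_inv_into I v x) = 0"
      using a c unfolding vec.independent_explicit by auto
    then show "c i = 0" using a c by (auto simp: the_inv_into_f_f)
  qed
qed

lemma dim_span_indep_on:
  fixes v :: "'i \<Rightarrow> 'a::field^'n::finite"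
  assumes "finite I" "indep_on I v"
  shows "vec.dim (vec.span (v ` I)) = card I"
  using assms unfolding indep_on_iff_independent[OF assms(1)]
  by (metis vec.dim_span_eq_card_independent card_image)

lemma dim_span_image_le:
  fixes v :: "'i \<Rightarrow> 'a::field^'n::finite"
  assumes "finite I"
  shows "vec.dim (vec.span (v ` I)) \<le> card I"
  using assms by (metis card_image_le finite_imageI order_trans vec.dim_le_card vec.dim_span vec.span_superset)

lemma indep_on_if_dim:
  fixes v :: "'i \<Rightarrow> 'a::field^'n::finite"
  assumes "finite I" "vec.dim (vec.span (v ` I)) = card I"
  shows "indep_on I v"
proof -
  have "card (v ` I) \<le> card I" using assms card_image_le by blast
  moreover have "card I \<le> card (v ` I)"
    using assms by (metis finite_imageI vec.dim_le_card vec.dim_span vec.span_superset)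
  ultimately have e: "card (v ` I) = card I" by simp
  then have "inj_on v I" using assms(1) by (rule eq_card_imp_inj_on[rotated])
  moreover have "vec.independent (v ` I)"
    using assms e by (metis finite_imageI vec.card_le_dim_spanning vec.dim_span vec.span_superset order_refl vec.subspace_span)
  ultimately show ?thesis using assms by (simp add: indep_on_iff_independent)
qed

lemma indep_on_subset:
  fixes v :: "'i \<Rightarrow> 'a::field^'n::finite"
  assumes "finite I" "indep_on I v" "J \<subseteq> I"
  shows "indep_on J v"
  using assms by (meson finite_subset image_mono indep_on_iff_independent inj_on_subset vec.independent_mono)

lemma indep_on_coeff_eq:
  assumes "indep_on I v" "(\<Sum>i\<in>I. c i *s v i) = (\<Sum>i\<in>I. d i *s v i)" "i \<in> I"
  shows "c i = d i"
proof -
  have "(\<Sum>i\<in>I. (c i - d i) *s v i) = 0"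
    using assms(2) by (simp add: vec.scale_left_diff_distrib sum_subtractf)
  from indep_onD[OF assms(1) this assms(3)] show ?thesis by simp
qed

lemma sum_if_mem:
  fixes v :: "'i \<Rightarrow> 'a::field^'n::finite"
  assumes "finite I" "J \<subseteq> I"
  shows "(\<Sum>i\<in>I. (if i \<in> J then c i else 0) *s v i) = (\<Sum>i\<in>J. c i *s v i)"
proof -
  have "(\<Sum>i\<in>I. (if i \<in> J then c i else 0) *s v i) = (\<Sum>i\<in>I. if i \<in> J then c i *s v i else 0)"
    by (intro sum.cong) (auto simp: vec.scale_zero_left)
  also have "\<dots> = (\<Sum>i\<in>I \<inter> J. c i *s v i)" using assms(1) by (simp add: sum.inter_restrict)
  finally show ?thesis using assms(2) by (simp add: Int_absorb1)
qed

lemma span_image_coeff: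
  fixes v :: "'i \<Rightarrow> 'a::field^'n::finite"
  assumes "finite I" "indep_on I v" "J \<subseteq> I"
  shows "(\<Sum>i\<in>I. c i *s v i) \<in> vec.span (v ` J) \<longleftrightarrow> (\<forall>i\<in>I - J. c i = 0)"
proof
  assume "(\<Sum>i\<in>I. c i *s v i) \<in> vec.span (v ` J)"
  moreover have fJ: "finite J" using assms finite_subset by blast
  ultimately obtain d where "(\<Sum>i\<in>I. c i *s v i) = (\<Sum>i\<in>J. d i *s v i)"
    by (rule in_span_imageE)
  then have "(\<Sum>i\<in>I. c i *s v i) = (\<Sum>i\<in>I. (if i \<in> J then d i else 0) *s v i)"
    using assms by (simp add: sum_if_mem)
  from indep_on_coeff_eq[OF assms(2) this] show "\<forall>i\<in>I - J. c i = 0" by auto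
next
  assume "\<forall>i\<in>I - J. c i = 0"
  then have "(\<Sum>i\<in>I. c i *s v i) = (\<Sum>i\<in>J. c i *s v i)"
    using assms by (intro sum.mono_neutral_right) (auto simp: vec.scale_zero_left)
  then show "(\<Sum>i\<in>I. c i *s v i) \<in> vec.span (v ` J)" by (simp add: sum_in_span_image)
qed

text \<open>Membership in the span of a subfamily is the vanishing of the other coefficients, so the
  conditions for \<open>J\<close> and \<open>K\<close> simply accumulate.\<close>

lemma span_image_Int:
  fixes v :: "'i \<Rightarrow> 'a::field^'n::finite"
  assumes "finite I" "indep_on I v" "J \<subseteq> I" "K \<subseteq> I"
  shows "vec.span (v ` J) \<inter> vec.span (v ` K) = vec.span (v ` (J \<inter> K))"
proof safe
  fix x assume x: "x \<in> vec.span (v ` J)" "x \<in> vec.span (v ` K)"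
  have "x \<in> vec.span (v ` I)" using x(1) assms(3) vec.span_mono[of "v ` J" "v ` I"] by blast
  then obtain c where c: "x = (\<Sum>i\<in>I. c i *s v i)" using assms(1) by (rule in_span_imageE)
  show "x \<in> vec.span (v ` (J \<inter> K))"
    using x unfolding c span_image_coeff[OF assms(1,2,3)] span_image_coeff[OF assms(1,2,4)]
      span_image_coeff[OF assms(1,2) le_infI1[OF assms(3)]] by blast
qed (meson vec.span_mono image_mono Int_lower1 Int_lower2 subsetD)+

lemma span_indep_on_full:
  fixes v :: "nat \<Rightarrow> 'a::field^'n::finite"
  assumes "indep_on {..<CARD('n)} v"
  shows "vec.span (v ` {..<CARD('n)}) = UNIV"
proof -
  have "vec.dim (vec.span (v ` {..<CARD('n)})) = CARD('n)"
    using dim_span_indep_on[OF _ assms] by simp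
  then show ?thesis by (metis vec.dim_eq_full vec.dim_UNIV vec.dimension_def vec.span_span vec_dim_card)
qed

text \<open>The dimension formula relative to \<open>U\<close>: it is applied inside the whole space
  as well as inside a single subspace.\<close>

lemma dim_Int_ge:
  fixes V W :: "('a::field^'n::finite) set"
  assumes "vec.subspace V" "vec.subspace W" "V \<subseteq> U" "W \<subseteq> U" "vec.subspace U"
  shows "vec.dim V + vec.dim W \<le> vec.dim (V \<inter> W) + vec.dim U"
proof -
  have "vec.dim {x + y |x y. x \<in> V \<and> y \<in> W} \<le> vec.dim U"
    by (rule vec.dim_subset) (use assms vec.subspace_add in blast)
  then show ?thesis using vec.dim_sums_Int[OF assms(1,2)] by linarith
qed

lemma dim_pos_obtains:
  fixes V :: "('a::field^'n::finite) set"
  assumes "vec.dim V \<ge> 1"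
  obtains x where "x \<in> V" "x \<noteq> 0"
proof -
  have "\<not> V \<subseteq> {0}" using assms by (metis not_one_le_zero vec.dim_eq_0)
  then show ?thesis using that by blast
qed

lemma dim_ge_1:
  fixes V :: "('a::field^'n::finite) set"
  assumes "x \<in> V" "x \<noteq> 0"
  shows "vec.dim V \<ge> 1"
proof -
  have "\<not> V \<subseteq> {0}" using assms by auto
  then have "vec.dim V \<noteq> 0" by (simp add: vec.dim_eq_0)
  then show ?thesis by linarith
qed

section \<open>Minors\<close>

text \<open>The columns are given by a function and not by a set, because replacing one column by
  another, as in \<open>minor_row\<close>, keeps neither their order nor their distinctness.\<close>

definition minor :: "nat \<Rightarrow> (nat \<Rightarrow> 'a::field^'n::finite) \<Rightarrow> (nat \<Rightarrow> 'n) \<Rightarrow> 'a" where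
  "minor m v s = Determinant.det (mat m m (\<lambda>(a, b). v a $ s b))"

lemma wedge_coords_minor:
  "wedge_coords m v S = (if card S = m then minor m v (\<lambda>b. sorted_list_of_set S ! b) else 0)"
proof -
  have "(\<Prod>a<m. v a $ (sorted_list_of_set S ! p a)) =
        (\<Prod>a<m. mat m m (\<lambda>(a, b). v a $ (sorted_list_of_set S ! b)) $$ (a, p a))"
    if "p permutes {..<m}" for p
    using that by (intro prod.cong) (auto simp: permutes_in_image[of p "{..<m}", unfolded lessThan_iff])
  then show ?thesis
    by (auto simp: wedge_coords_def minor_def Determinant.det_def atLeast0LessThan intro!: sum.cong)
qed

lemma minor_eq_sum:
  "minor m v s = (\<Sum>p | p permutes {..<m}. of_int (sign p) * (\<Prod>a<m. v a $ s (p a)))"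
proof -
  have "(\<Prod>a<m. v a $ s (p a)) = (\<Prod>a<m. mat m m (\<lambda>(a, b). v a $ s b) $$ (a, p a))"
    if "p permutes {..<m}" for p
    using that by (intro prod.cong) (auto simp: permutes_in_image[of p "{..<m}", unfolded lessThan_iff])
  then show ?thesis
    by (auto simp: minor_def Determinant.det_def atLeast0LessThan intro!: sum.cong)
qed

lemma minor_lincomb:
  assumes "\<And>a. a < m \<Longrightarrow> w a = (\<Sum>b<m. M a b *s v b)"
  shows "minor m w s = Determinant.det (mat m m (\<lambda>(a, b). M a b)) * minor m v s"
proof -
  have "mat m m (\<lambda>(a, b). w a $ s b) = mat m m (\<lambda>(a, b). M a b) * mat m m (\<lambda>(a, b). v a $ s b)"
    using assms by (intro eq_matI) (auto simp: scalar_prod_def atLeast0LessThan)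
  then show ?thesis unfolding minor_def by (simp add: det_mult[of _ m])
qed

lemma wedge_coords_lincomb:
  assumes "\<And>a. a < m \<Longrightarrow> w a = (\<Sum>b<m. M a b *s v b)"
  shows "wedge_coords m w S = Determinant.det (mat m m (\<lambda>(a, b). M a b)) * wedge_coords m v S"
  unfolding wedge_coords_minor using minor_lincomb[OF assms] by simp

lemma minor_eq_0_iff:
  "minor m v s = 0 \<longleftrightarrow> (\<exists>c. (\<exists>a<m. c a \<noteq> 0) \<and> (\<forall>b<m. (\<Sum>a<m. c a * v a $ s b) = 0))"
proof -
  \<comment> \<open>The transpose turns a relation between the rows into a kernel vector.\<close>
  let ?A = "mat m m (\<lambda>(b, a). v a $ s b)"
  have "mat m m (\<lambda>(a, b). v a $ s b) = transpose_mat ?A" by (intro eq_matI) auto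
  then have "minor m v s = Determinant.det ?A"
    unfolding minor_def using det_transpose[of ?A m] by simp
  then have e: "minor m v s = 0 \<longleftrightarrow> (\<exists>c. c \<in> carrier_vec m \<and> c \<noteq> 0\<^sub>v m \<and> ?A *\<^sub>v c = 0\<^sub>v m)"
    using det_0_iff_vec_prod_zero_field[of ?A m] by simp
  show ?thesis unfolding e
  proof safe
    fix c assume c: "c \<in> carrier_vec m" "c \<noteq> 0\<^sub>v m" "?A *\<^sub>v c = 0\<^sub>v m"
    have "\<exists>a<m. vec_index c a \<noteq> 0"
      using c(1,2) by (metis carrier_vecD eq_vecI index_zero_vec)
    moreover have "(\<Sum>a<m. vec_index c a * v a $ s b) = 0" if "b < m" for b
    proof -
      have "(\<Sum>a<m. vec_index c a * v a $ s b) = vec_index (?A *\<^sub>v c) b"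
        using that c(1) by (auto simp: scalar_prod_def atLeast0LessThan mult.commute intro!: sum.cong)
      then show ?thesis using c(3) that by simp
    qed
    ultimately show "\<exists>c. (\<exists>a<m. c a \<noteq> 0) \<and> (\<forall>b<m. (\<Sum>a<m. c a * v a $ s b) = 0)" by blast
  next
    fix c a assume c: "a < m" "c a \<noteq> 0" "\<forall>b<m. (\<Sum>a<m. c a * v a $ s b) = 0"
    let ?c = "Matrix.vec m c"
    have "?c \<noteq> 0\<^sub>v m" using c(1,2) by (metis index_vec index_zero_vec(1))
    moreover have "?A *\<^sub>v ?c = 0\<^sub>v m"
    proof (intro eq_vecI)
      fix b assume "b < dim_vec (0\<^sub>v m)"
      then have "b < m" by simp
      then have "vec_index (?A *\<^sub>v ?c) b = (\<Sum>a<m. c a * v a $ s b)"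
        by (auto simp: scalar_prod_def atLeast0LessThan mult.commute intro!: sum.cong)
      then show "vec_index (?A *\<^sub>v ?c) b = vec_index (0\<^sub>v m) b" using c(3) \<open>b < m\<close> by simp
    qed simp
    ultimately show "\<exists>c. c \<in> carrier_vec m \<and> c \<noteq> 0\<^sub>v m \<and> ?A *\<^sub>v c = 0\<^sub>v m"
      by (intro exI[of _ ?c]) auto
  qed
qed

lemma minor_nonzero_imp_indep: "minor m v s \<noteq> 0 \<Longrightarrow> indep_on {..<m} v"
  unfolding indep_on_def
proof (intro allI impI ballI)
  fix c a assume m: "minor m v s \<noteq> 0" and c: "(\<Sum>i<m. c i *s v i) = 0" and a: "a \<in> {..<m}"
  have "(\<Sum>a<m. c a * v a $ s b) = 0" for b
    using arg_cong[OF c, of "\<lambda>x. x $ s b"] by simp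
  then show "c a = 0" using m a unfolding minor_eq_0_iff by blast
qed

lemma wedge_coords_nonzero_imp_indep: "wedge_coords m v S \<noteq> 0 \<Longrightarrow> indep_on {..<m} v"
  by (auto simp: wedge_coords_minor split: if_splits intro: minor_nonzero_imp_indep)

lemma sum_axis: "(\<Sum>j\<in>UNIV. x $ j *s axis j 1) = (x :: 'a::field^'n::finite)"
proof -
  have "(\<Sum>j\<in>UNIV. x $ j * axis j 1 $ i) = x $ i" for i
  proof -
    have "(\<Sum>j\<in>UNIV. x $ j * axis j 1 $ i) = (\<Sum>j\<in>UNIV. if j = i then x $ j else 0)"
      by (intro sum.cong) (auto simp: axis_def)
    then show ?thesis by simp
  qed
  then show ?thesis unfolding Finite_Cartesian_Product.vec_eq_iff sum_component vector_smult_component by blast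
qed

lemma inj_axis_1: "inj (\<lambda>j. axis j (1::'a::field) :: 'a^'n)"
  by (auto simp: inj_def axis_eq_axis)

(* The complement of the index set is found by completing the family to a basis
   with standard basis vectors. *)
lemma indep_imp_wedge_coords_nonzero:
  fixes v :: "nat \<Rightarrow> complex^'n::{finite,linorder}"
  assumes ind: "indep_on {..<m} v"
  obtains S :: "'n set" where "card S = m" "wedge_coords m v S \<noteq> 0"
proof -
  let ?V = "v ` {..<m}" and ?ax = "\<lambda>j. axis j (1::complex) :: complex^'n::{finite,linorder}"
  have iV: "vec.independent ?V" and injv: "inj_on v {..<m}"
    using ind by (auto simp: indep_on_iff_independent)
  obtain B where B: "?V \<subseteq> B" "B \<subseteq> ?V \<union> range ?ax" "vec.independent B" "?V \<union> range ?ax \<subseteq> vec.span B"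
    using vec.maximal_independent_subset_extend[of ?V "?V \<union> range ?ax"] iV by auto
  have fB: "finite B" using B(3) vec.finiteI_independent by blast
  have "x \<in> vec.span B" for x :: "complex^'n::{finite,linorder}"
  proof -
    have "(\<Sum>j\<in>UNIV. x $ j *s ?ax j) \<in> vec.span B"
      using B(4) by (intro vec.span_sum vec.span_scale) auto
    then show ?thesis by (simp only: sum_axis)
  qed
  then have "vec.span B = UNIV" by auto
  then have cB: "card B = CARD('n)"
    using B(3) by (metis vec.dim_span_eq_card_independent vec.dim_UNIV vec.dimension_def vec_dim_card)
  define J where "J = {j. ?ax j \<in> B - ?V}"
  have "?ax ` J = B - ?V" using B(2) by (auto simp: J_def)
  then have "card J = card (B - ?V)"
    by (metis card_image inj_axis_1 inj_on_subset subset_UNIV)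
  also have "\<dots> = CARD('n) - m"
    using B(1) fB cB injv by (simp add: card_Diff_subset finite_subset card_image)
  finally have cJ: "card J = CARD('n) - m" .
  have "m \<le> CARD('n)"
    using card_mono[OF fB B(1)] cB injv by (simp add: card_image)
  then have cS: "card (- J) = m" using cJ by (simp add: Compl_eq_Diff_UNIV card_Diff_subset)
  moreover have "wedge_coords m v (- J) \<noteq> 0"
  proof
    assume "wedge_coords m v (- J) = 0"
    then obtain c where c: "\<exists>a<m. c a \<noteq> 0"
      "\<forall>b<m. (\<Sum>a<m. c a * v a $ (sorted_list_of_set (- J) ! b)) = 0"
      using cS by (auto simp: wedge_coords_minor minor_eq_0_iff)
    let ?x = "\<Sum>a<m. c a *s v a"
    have x0: "?x $ j = 0" if "j \<in> - J" for j
    proof -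
      have "j \<in> set (sorted_list_of_set (- J))" using that by simp
      then obtain b where "b < m" "sorted_list_of_set (- J) ! b = j"
        unfolding in_set_conv_nth using cS by auto
      then show ?thesis using c(2)[rule_format, of b] by simp
    qed
    \<comment> \<open>\<open>?x\<close> lies in the span of the family and also in the span of the
      added standard vectors. These are disjoint parts of the basis \<open>B\<close>, so
      \<open>?x\<close> is 0.\<close>
    have "?x = (\<Sum>j\<in>UNIV. ?x $ j *s ?ax j)" by (simp only: sum_axis)
    also have "\<dots> = (\<Sum>j\<in>J. ?x $ j *s ?ax j)"
      using x0 by (intro sum.mono_neutral_right) (auto simp: vec.scale_zero_left)
    also have "\<dots> \<in> vec.span (B - ?V)"
      by (intro vec.span_sum vec.span_scale vec.span_base) (auto simp: J_def)
    finally have "?x \<in> vec.span (id ` (B - ?V))" by simp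
    moreover have "?x \<in> vec.span (id ` ?V)" by (simp add: sum_in_span_image)
    moreover have "indep_on B id" using B(3) fB by (simp add: indep_on_iff_independent)
    ultimately have "?x \<in> vec.span (id ` (?V \<inter> (B - ?V)))"
      using span_image_Int[OF fB, of id ?V "B - ?V"] B(1) by blast
    then have "?x = 0" by (simp add: Diff_disjoint)
    with c(1) indep_onD[OF ind, of c] show False by auto
  qed
  ultimately show ?thesis by (rule that)
qed

text \<open>The factor is the sign of the permutation that sorts \<open>t\<close>, or 0 if
  \<open>t\<close> is not injective. It does not depend on \<open>v\<close>, so forms for the
  Pluecker coordinates yield forms for all minors.\<close>

lemma minor_reorder:
  obtains \<epsilon> where "\<And>v :: nat \<Rightarrow> complex^'n::{finite,linorder}. minor m v t = \<epsilon> * wedge_coords m v (t ` {..<m})"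
proof (cases "inj_on t {..<m}")
  case True
  let ?S = "t ` {..<m}"
  define s where "s b = sorted_list_of_set ?S ! b" for b
  have cS: "card ?S = m" using True by (simp add: card_image)
  have bs: "bij_betw s {..<m} ?S"
    unfolding s_def using cS bij_betw_nth[of "sorted_list_of_set ?S" "{..<m}" ?S] by simp
  define \<pi> where "\<pi> b = (if b < m then the_inv_into {..<m} s (t b) else b)" for b
  have "bij_betw (\<lambda>b. the_inv_into {..<m} s (t b)) {..<m} {..<m}"
    using bij_betw_trans[OF inj_on_imp_bij_betw[OF True] bij_betw_the_inv_into[OF bs]]
    by (simp add: o_def)
  then have "bij_betw \<pi> {..<m} {..<m}"
    by (rule bij_betw_cong[THEN iffD1, rotated]) (simp add: \<pi>_def)
  then have pi: "\<pi> permutes {0..<m}"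
    by (intro bij_imp_permutes) (auto simp: \<pi>_def atLeast0LessThan)
  have spi: "s (\<pi> b) = t b" if "b < m" for b
    using that bs by (auto simp: \<pi>_def bij_betw_def f_the_inv_into_f)
  have "minor m v t = signof \<pi> * wedge_coords m v ?S" for v :: "nat \<Rightarrow> complex^'n::{finite,linorder}"
  proof -
    let ?A = "mat m m (\<lambda>(b, a). v a $ s b)"
    have "minor m v t = Determinant.det (transpose_mat (mat m m (\<lambda>(i,j). ?A $$ (\<pi> i, j))))"
      unfolding minor_def
    proof (intro arg_cong[of _ _ Determinant.det] eq_matI)
      fix i j
      assume "i < dim_row (transpose_mat (mat m m (\<lambda>(i,j). ?A $$ (\<pi> i, j))))"
        "j < dim_col (transpose_mat (mat m m (\<lambda>(i,j). ?A $$ (\<pi> i, j))))"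
      then have ij: "i < m" "j < m" by auto
      then have "\<pi> j < m" using pi permutes_in_image[of \<pi> "{0..<m}" j] by auto
      then show "mat m m (\<lambda>(a, b). v a $ t b) $$ (i, j) =
         transpose_mat (mat m m (\<lambda>(i,j). ?A $$ (\<pi> i, j))) $$ (i, j)"
        using ij spi by simp
    qed auto
    also have "\<dots> = Determinant.det (mat m m (\<lambda>(i,j). ?A $$ (\<pi> i, j)))"
      by (rule det_transpose[of _ m]) simp
    also have "\<dots> = signof \<pi> * Determinant.det ?A"
      by (rule det_permute_rows[OF _ pi]) simp
    also have "Determinant.det ?A = Determinant.det (transpose_mat ?A)"
      by (rule det_transpose[symmetric, of _ m]) simp
    also have "transpose_mat ?A = mat m m (\<lambda>(a, b). v a $ s b)" by (intro eq_matI) auto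
    finally show ?thesis by (simp add: wedge_coords_minor cS s_def minor_def)
  qed
  then show ?thesis by (rule that)
next
  case False
  then obtain b b' where b: "b < m" "b' < m" "b \<noteq> b'" "t b = t b'" by (auto simp: inj_on_def)
  have "minor m v t = 0 * wedge_coords m v (t ` {..<m})" for v :: "nat \<Rightarrow> complex^'n::{finite,linorder}"
  proof -
    have "col (mat m m (\<lambda>(a, b). v a $ t b)) b = col (mat m m (\<lambda>(a, b). v a $ t b)) b'"
      using b by (intro eq_vecI) auto
    then show ?thesis unfolding minor_def
      using b by (subst det_identical_columns[of _ m b b']) auto
  qed
  then show ?thesis by (rule that)
qed

text \<open>By Cramer's rule these are the rows of the reduced matrix, in which the columns
  \<open>s\<close> form the identity, multiplied by the minor to clear denominators.\<close>

definition minor_row :: "nat \<Rightarrow> (nat \<Rightarrow> 'a::field^'n::finite) \<Rightarrow> (nat \<Rightarrow> 'n) \<Rightarrow> nat \<Rightarrow> 'a^'n" where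
  "minor_row m v s b = (\<chi> j. minor m v (s(b := j)))"

lemma minor_row_nth:
  assumes "b < m" "b' < m"
  shows "minor_row m v s b $ s b' = (if b = b' then minor m v s else 0)"
proof (cases "b = b'")
  case False
  let ?A = "mat m m (\<lambda>(a, i). v a $ (s(b := s b')) i)"
  have "col ?A b = col ?A b'" using assms False by (intro eq_vecI) auto
  then have "minor m v (s(b := s b')) = 0"
    unfolding minor_def using assms False by (subst det_identical_columns[of _ m b b']) auto
  then show ?thesis using False by (simp add: minor_row_def)
qed (simp add: minor_row_def)

text \<open>Laplace expansion along column \<open>b\<close>: its cofactors do not involve the
  replaced column, so they are coefficients common to all entries of the row.\<close>

lemma minor_row_in_span:
  assumes b: "b < m"
  shows "minor_row m v s b \<in> vec.span (v ` {..<m})"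
proof -
  define A where "A t = mat m m (\<lambda>(a, i). v a $ t i)" for t :: "nat \<Rightarrow> 'b"
  have "mat_delete (A (s(b := j))) a b = mat_delete (A s) a b" for a j
    unfolding mat_delete_def A_def using b by (intro eq_matI) auto
  then have cof: "cofactor (A (s(b := j))) a b = cofactor (A s) a b" for a j
    by (simp add: cofactor_def)
  have "minor m v (s(b := j)) = (\<Sum>a<m. v a $ j * cofactor (A s) a b)" for j
  proof -
    have "minor m v (s(b := j)) = (\<Sum>a<m. A (s(b := j)) $$ (a, b) * cofactor (A (s(b := j))) a b)"
      unfolding minor_def A_def[symmetric] by (rule laplace_expansion_column) (use b in \<open>auto simp: A_def\<close>)
    also have "\<dots> = (\<Sum>a<m. v a $ j * cofactor (A s) a b)"
      using b by (intro sum.cong) (auto simp: cof, simp add: A_def)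
    finally show ?thesis .
  qed
  then have "minor_row m v s b = (\<Sum>a<m. cofactor (A s) a b *s v a)"
    unfolding minor_row_def Finite_Cartesian_Product.vec_eq_iff sum_component vector_smult_component vec_lambda_beta
    by (simp add: mult.commute)
  then show ?thesis by (simp add: sum_in_span_image)
qed

lemma sum_minor_row_nth:
  assumes "b' < m"
  shows "(\<Sum>b<m. c b *s minor_row m v s b) $ s b' = c b' * minor m v s"
proof -
  have "(\<Sum>b<m. c b * minor_row m v s b $ s b') = (\<Sum>b<m. if b = b' then c b * minor m v s else 0)"
    using assms by (intro sum.cong) (auto simp: minor_row_nth)
  then show ?thesis using assms by simp
qed

lemma indep_minor_row:
  assumes "minor m v s \<noteq> 0"
  shows "indep_on {..<m} (minor_row m v s)"
  unfolding indep_on_def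
proof (intro allI impI ballI)
  fix c b assume "(\<Sum>b<m. c b *s minor_row m v s b) = 0" "b \<in> {..<m}"
  then show "c b = 0" using sum_minor_row_nth[of b m c v s] assms by simp
qed

lemma span_minor_row:
  assumes "minor m v s \<noteq> 0"
  shows "vec.span (minor_row m v s ` {..<m}) = vec.span (v ` {..<m})"
proof (rule vec.subspace_dim_equal)
  show "vec.span (minor_row m v s ` {..<m}) \<subseteq> vec.span (v ` {..<m})"
    by (rule vec.span_minimal) (auto intro: minor_row_in_span)
  show "vec.dim (vec.span (v ` {..<m})) \<le> vec.dim (vec.span (minor_row m v s ` {..<m}))"
    using dim_span_indep_on[OF _ indep_minor_row[OF assms]] dim_span_image_le[of "{..<m}" v] by simp
qed auto

text \<open>In the columns \<open>s\<close> the rows form a multiple of the identity matrix, so a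
  vector of the span is determined by its entries there. This writes membership as an identity
  without denominators.\<close>

lemma minor_scale_eq:
  assumes "minor m v s \<noteq> 0" "x \<in> vec.span (v ` {..<m})"
  shows "minor m v s *s x = (\<Sum>b<m. x $ s b *s minor_row m v s b)"
proof -
  obtain c where c: "x = (\<Sum>b<m. c b *s minor_row m v s b)"
    using assms(2) unfolding span_minor_row[OF assms(1), symmetric] by (rule in_span_imageE) auto
  have "x $ s b = c b * minor m v s" if "b < m" for b
    unfolding c by (rule sum_minor_row_nth[OF that])
  then have "(\<Sum>b<m. x $ s b *s minor_row m v s b) = (\<Sum>b<m. minor m v s *s (c b *s minor_row m v s b))"
    by (intro sum.cong) (auto simp: mult.commute)
  then show ?thesis by (simp add: c vec.scale_sum_right)
qed

text \<open>Cramer's rule for rows: the minor is linear in row \<open>a\<close>, and it vanishes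
  when that row equals another one.\<close>

lemma minor_replace_row:
  assumes a: "a < m" and y: "y = (\<Sum>b<m. \<alpha> b *s x b)"
  shows "minor m (x(a := y)) s = \<alpha> a * minor m x s"
proof -
  define A where "A z = mat m m (\<lambda>(i, b). (x(a := z)) i $ s b)" for z
  have "mat_delete (A z) a b = mat_delete (A 0) a b" for b z
    unfolding mat_delete_def A_def using a by (intro eq_matI) auto
  then have cof: "cofactor (A z) a b = cofactor (A 0) a b" for b z
    unfolding cofactor_def by metis
  have lin: "minor m (x(a := z)) s = (\<Sum>b<m. z $ s b * cofactor (A 0) a b)" for z
  proof -
    have "minor m (x(a := z)) s = (\<Sum>b<m. A z $$ (a, b) * cofactor (A z) a b)"
      unfolding minor_def A_def[symmetric] by (rule laplace_expansion_row) (use a in \<open>auto simp: A_def\<close>)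
    also have "\<dots> = (\<Sum>b<m. z $ s b * cofactor (A 0) a b)"
      using a by (intro sum.cong refl) (simp only: cof[where z = z], simp add: A_def)
    finally show ?thesis .
  qed
  have same: "minor m (x(a := x b)) s = (if b = a then minor m x s else 0)" if "b < m" for b
  proof (cases "b = a")
    case False
    have "row (A (x b)) a = row (A (x b)) b"
      using that a False by (intro eq_vecI) (auto simp: A_def)
    then have "minor m (x(a := x b)) s = 0"
      unfolding minor_def A_def[symmetric] using that a False
      by (subst det_identical_rows[of _ m a b]) (auto simp: A_def)
    then show ?thesis using False by simp
  qed simp
  have "minor m (x(a := y)) s = (\<Sum>b<m. \<Sum>i<m. \<alpha> i * (x i $ s b * cofactor (A 0) a b))"
    unfolding lin y by (simp add: sum_distrib_right mult.assoc)
  also have "\<dots> = (\<Sum>i<m. \<Sum>b<m. \<alpha> i * (x i $ s b * cofactor (A 0) a b))" by (rule sum.swap)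
  also have "\<dots> = (\<Sum>i<m. \<alpha> i * minor m (x(a := x i)) s)" by (simp add: lin sum_distrib_left)
  also have "\<dots> = (\<Sum>i<m. if i = a then \<alpha> i * minor m x s else 0)"
    by (intro sum.cong) (auto simp: same)
  also have "\<dots> = \<alpha> a * minor m x s" using a by simp
  finally show ?thesis .
qed

section \<open>Binary forms\<close>

text \<open>The homogenization of \<open>p\<close> to degree \<open>e\<close>. It reduces statements
  on forms to polynomials on the chart where \<open>x 1\<close> is not 0 and to the coefficient of
  degree \<open>e\<close> at infinity.\<close>

definition form :: "nat \<Rightarrow> complex poly \<Rightarrow> (nat \<Rightarrow> complex) \<Rightarrow> complex" where
  "form e p x = (\<Sum>j\<le>e. coeff p j * x 0 ^ j * x 1 ^ (e - j))"

lemma form_affine: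
  assumes "degree p \<le> e" "x 1 \<noteq> 0"
  shows "form e p x = x 1 ^ e * poly p (x 0 / x 1)"
proof -
  have "poly p (x 0 / x 1) = (\<Sum>j\<le>e. coeff p j * (x 0 / x 1) ^ j)"
    unfolding poly_altdef using assms(1)
    by (intro sum.mono_neutral_left) (auto intro: coeff_eq_0)
  also have "x 1 ^ e * \<dots> = form e p x"
    unfolding form_def sum_distrib_left
  proof (intro sum.cong refl)
    fix j assume "j \<in> {..e}"
    then have "x 1 ^ e = x 1 ^ j * x 1 ^ (e - j)" by (simp flip: power_add)
    then show "x 1 ^ e * (coeff p j * (x 0 / x 1) ^ j) = coeff p j * x 0 ^ j * x 1 ^ (e - j)"
      using assms(2) by (simp add: power_divide)
  qed
  finally show ?thesis ..
qed

lemma form_infinity: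
  assumes "x 1 = 0"
  shows "form e p x = coeff p e * x 0 ^ e"
proof -
  have "form e p x = (\<Sum>j\<le>e. if j = e then coeff p e * x 0 ^ e else 0)"
    unfolding form_def using assms by (intro sum.cong) (auto simp: zero_power)
  then show ?thesis by simp
qed

lemma binary_form_iff: "binary_form e h \<longleftrightarrow> (\<exists>p. degree p \<le> e \<and> h = form e p)"
proof
  assume "binary_form e h"
  then obtain a where a: "h = (\<lambda>x. \<Sum>j\<le>e. a j * x 0 ^ j * x 1 ^ (e - j))"
    by (auto simp: binary_form_def)
  let ?p = "\<Sum>j\<le>e. monom (a j) j"
  have "degree ?p \<le> e"
    by (rule degree_sum_le) (auto intro: order.trans[OF degree_monom_le])
  moreover have "coeff ?p j = a j" if "j \<le> e" for j
    using that by (simp add: coeff_sum)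
  then have "h = form e ?p" by (simp add: a form_def fun_eq_iff)
  ultimately show "\<exists>p. degree p \<le> e \<and> h = form e p" by blast
qed (auto simp: binary_form_def form_def fun_eq_iff)

lemma binary_form_const: "binary_form 0 (\<lambda>x. c)"
  unfolding binary_form_def by (intro exI[of _ "\<lambda>_. c"]) simp

lemma binary_form_0: "binary_form e (\<lambda>x. 0)"
  unfolding binary_form_def by (intro exI[of _ "\<lambda>_. 0"]) simp

lemma binary_form_coord: "i \<in> {0, 1} \<Longrightarrow> binary_form 1 (\<lambda>x. x i)"
  unfolding binary_form_def by (intro exI[of _ "\<lambda>j. if j = 1 - i then 1 else 0"]) (auto simp: fun_eq_iff)

lemma binary_form_add:
  assumes "binary_form e g" "binary_form e h"
  shows "binary_form e (\<lambda>x. g x + h x)"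
proof -
  obtain a b where "g = (\<lambda>x. \<Sum>j\<le>e. a j * x 0 ^ j * x 1 ^ (e - j))"
    "h = (\<lambda>x. \<Sum>j\<le>e. b j * x 0 ^ j * x 1 ^ (e - j))"
    using assms by (auto simp: binary_form_def)
  then show ?thesis unfolding binary_form_def
    by (intro exI[of _ "\<lambda>j. a j + b j"]) (auto simp: fun_eq_iff sum.distrib algebra_simps)
qed

text \<open>Both sides are compared on the chart, where they are scaled polynomial values, and at
  \<open>x 1 = 0\<close>, where only the coefficient of top degree survives.\<close>

lemma binary_form_mult:
  assumes "binary_form d g" "binary_form e h"
  shows "binary_form (d + e) (\<lambda>x. g x * h x)"
proof -
  obtain p r where p: "degree p \<le> d" "g = form d p" and r: "degree r \<le> e" "h = form e r"
    using assms by (auto simp: binary_form_iff)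
  have deg: "degree (p * r) \<le> d + e" using p(1) r(1) degree_mult_le[of p r] by linarith
  have "coeff (p * r) (d + e) = (\<Sum>i\<le>d + e. if i = d then coeff p d * coeff r e else 0)"
    unfolding coeff_mult
  proof (intro sum.cong refl)
    fix i assume "i \<in> {..d + e}"
    show "coeff p i * coeff r (d + e - i) = (if i = d then coeff p d * coeff r e else 0)"
    proof (cases i d rule: linorder_cases)
      case less
      then have "coeff r (d + e - i) = 0" using r(1) by (intro coeff_eq_0) linarith
      then show ?thesis using less by simp
    next
      case greater
      then have "coeff p i = 0" using p(1) by (intro coeff_eq_0) linarith
      then show ?thesis using greater by simp
    qed simp
  qed
  then have c: "coeff (p * r) (d + e) = coeff p d * coeff r e" by simp
  have "g x * h x = form (d + e) (p * r) x" for x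
  proof (cases "x 1 = 0")
    case True
    then show ?thesis by (simp add: p r form_infinity c power_add)
  next
    case False
    then show ?thesis by (simp add: p r form_affine deg power_add)
  qed
  then show ?thesis using deg unfolding binary_form_iff by (intro exI[of _ "p * r"]) (auto simp: fun_eq_iff)
qed

lemma binary_form_scale: "binary_form e h \<Longrightarrow> binary_form e (\<lambda>x. c * h x)"
  using binary_form_mult[OF binary_form_const, of e h c] by simp

lemma binary_form_sum: "(\<And>i. i \<in> I \<Longrightarrow> binary_form e (h i)) \<Longrightarrow> binary_form e (\<lambda>x. \<Sum>i\<in>I. h i x)"
  by (induction I rule: infinite_finite_induct) (auto intro: binary_form_0 binary_form_add)

lemma binary_form_prod:
  "finite I \<Longrightarrow> (\<And>i. i \<in> I \<Longrightarrow> binary_form (d i) (h i)) \<Longrightarrow> binary_form (\<Sum>i\<in>I. d i) (\<lambda>x. \<Prod>i\<in>I. h i x)"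
  by (induction I rule: finite_induct) (auto intro: binary_form_const binary_form_mult)

lemma binary_form_power: "binary_form e h \<Longrightarrow> binary_form (m * e) (\<lambda>x. h x ^ m)"
  by (induction m) (auto intro: binary_form_const binary_form_mult)

lemma binary_form_compose:
  assumes h: "binary_form e h" and g: "binary_form d (\<lambda>x. g x 0)" "binary_form d (\<lambda>x. g x 1)"
  shows "binary_form (e * d) (\<lambda>x. h (g x))"
proof -
  obtain a where a: "h = (\<lambda>x. \<Sum>j\<le>e. a j * x 0 ^ j * x 1 ^ (e - j))"
    using h by (auto simp: binary_form_def)
  have "binary_form (e * d) (\<lambda>x. a j * (g x 0 ^ j * g x 1 ^ (e - j)))" if "j \<le> e" for j
  proof (rule binary_form_scale)
    have "binary_form (j * d + (e - j) * d) (\<lambda>x. g x 0 ^ j * g x 1 ^ (e - j))"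
      by (intro binary_form_mult binary_form_power g)
    then show "binary_form (e * d) (\<lambda>x. g x 0 ^ j * g x 1 ^ (e - j))"
      using that by (simp flip: add_mult_distrib)
  qed
  then show ?thesis unfolding a by (auto intro!: binary_form_sum simp: mult.assoc)
qed

lemma binary_form_homogeneous:
  assumes "binary_form e h"
  shows "h (\<lambda>i. c * x i) = c ^ e * h x"
proof -
  obtain a where a: "h = (\<lambda>x. \<Sum>j\<le>e. a j * x 0 ^ j * x 1 ^ (e - j))"
    using assms by (auto simp: binary_form_def)
  have "a j * (c * x 0) ^ j * (c * x 1) ^ (e - j) = c ^ e * (a j * x 0 ^ j * x 1 ^ (e - j))" if "j \<le> e" for j
  proof -
    have "c ^ e = c ^ j * c ^ (e - j)" using that by (simp flip: power_add)
    then show ?thesis by (simp add: power_mult_distrib)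
  qed
  then show ?thesis unfolding a sum_distrib_left by (intro sum.cong) auto
qed

text \<open>The linear form vanishes exactly at the point \<open>y\<close>. If \<open>y\<close> is
  infinity, the top coefficient vanishes and \<open>x 1\<close> can be split off; otherwise the
  factor theorem applies to the dehomogenized polynomial.\<close>

lemma binary_form_factor:
  assumes h: "binary_form (Suc e) h" and y: "y \<in> hcoords {0, 1}" and "h y = 0"
  obtains h' where "binary_form e h'" "\<And>x. h x = (y 1 * x 0 - y 0 * x 1) * h' x"
proof -
  obtain p where p: "degree p \<le> Suc e" "h = form (Suc e) p"
    using h by (auto simp: binary_form_iff)
  show ?thesis
  proof (cases "y 1 = 0")
    case True
    then have y0: "y 0 \<noteq> 0" using y by (auto simp: hcoords_def)
    then have c: "coeff p (Suc e) = 0" using \<open>h y = 0\<close> True by (simp add: p form_infinity)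
    have "h x = (y 1 * x 0 - y 0 * x 1) * (- inverse (y 0) * form e p x)" for x
    proof -
      have "form (Suc e) p x = (\<Sum>j\<le>e. coeff p j * x 0 ^ j * x 1 ^ (Suc e - j))"
        unfolding form_def using c by simp
      also have "\<dots> = x 1 * form e p x"
        unfolding form_def sum_distrib_left by (intro sum.cong) (auto simp: Suc_diff_le)
      finally show ?thesis using True y0 by (simp add: p)
    qed
    moreover have "binary_form e (form e p)" by (auto simp: binary_form_def form_def fun_eq_iff)
    ultimately show ?thesis by (intro that[of "\<lambda>x. - inverse (y 0) * form e p x"] binary_form_scale)
  next
    case False
    then have "poly p (y 0 / y 1) = 0" using \<open>h y = 0\<close> p by (simp add: form_affine)
    then obtain r where r: "p = [:- (y 0 / y 1), 1:] * r" by (auto simp: poly_eq_0_iff_dvd)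
    have dr: "degree r \<le> e"
    proof (cases "r = 0")
      case False
      then have "degree p = Suc (degree r)" unfolding r by (subst degree_mult_eq) auto
      then show ?thesis using p(1) by simp
    qed simp
    have top: "coeff p (Suc e) = coeff r e"
      using dr unfolding r by (simp add: coeff_eq_0)
    have "h x = (y 1 * x 0 - y 0 * x 1) * (inverse (y 1) * form e r x)" for x
    proof (cases "x 1 = 0")
      case True
      then show ?thesis using False by (simp add: p form_infinity top)
    next
      case x1: False
      have "h x = x 1 ^ Suc e * poly p (x 0 / x 1)" using p x1 by (simp add: form_affine)
      also have "\<dots> = (x 1 * (x 0 / x 1 - y 0 / y 1)) * (x 1 ^ e * poly r (x 0 / x 1))"
        unfolding r by (simp add: algebra_simps)
      also have "x 1 * (x 0 / x 1 - y 0 / y 1) = (y 1 * x 0 - y 0 * x 1) * inverse (y 1)"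
        using x1 False by (simp add: field_simps)
      also have "x 1 ^ e * poly r (x 0 / x 1) = form e r x" using x1 dr by (simp add: form_affine)
      finally show ?thesis by simp
    qed
    moreover have "binary_form e (form e r)" by (auto simp: binary_form_def form_def fun_eq_iff)
    ultimately show ?thesis by (intro that[of "\<lambda>x. inverse (y 1) * form e r x"] binary_form_scale)
  qed
qed

section \<open>The projective line\<close>

definition affine_pt :: "complex \<Rightarrow> nat \<Rightarrow> complex" where
  "affine_pt z = (\<lambda>i. if i = 0 then z else if i = 1 then 1 else 0)"

definition infinity_pt :: "nat \<Rightarrow> complex" where
  "infinity_pt = (\<lambda>i. if i = 0 then 1 else 0)"

lemma affine_pt_simps [simp]: "affine_pt z 0 = z" "affine_pt z 1 = 1" "affine_pt z (Suc 0) = 1"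
  "infinity_pt 0 = 1" "infinity_pt 1 = 0" "infinity_pt (Suc 0) = 0"
  by (auto simp: affine_pt_def infinity_pt_def)

lemma affine_pt_hcoords [simp]: "affine_pt z \<in> hcoords {0, 1}"
  and infinity_pt_hcoords [simp]: "infinity_pt \<in> hcoords {0, 1}"
  by (auto simp: affine_pt_def infinity_pt_def hcoords_def)

lemma hcoords_Suc_0 [simp]: "affine_pt z \<in> hcoords {0, Suc 0}" "infinity_pt \<in> hcoords {0, Suc 0}"
  using affine_pt_hcoords infinity_pt_hcoords by simp_all

lemma ppoint_self: "x \<in> ppoint x"
  unfolding ppoint_def by (auto intro!: exI[of _ 1])

lemma ppoint_scale: "c \<noteq> 0 \<Longrightarrow> ppoint (\<lambda>i. c * x i) = ppoint x"
proof (safe)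
  fix y assume c: "c \<noteq> 0"
  { assume "y \<in> ppoint (\<lambda>i. c * x i)"
    then obtain b where b: "b \<noteq> 0" "y = (\<lambda>i. b * (c * x i))" by (auto simp: ppoint_def)
    then show "y \<in> ppoint x" using c by (auto simp: ppoint_def mult.assoc[symmetric] intro!: exI[of _ "b * c"]) }
  { assume "y \<in> ppoint x"
    then obtain b where b: "b \<noteq> 0" "y = (\<lambda>i. b * x i)" by (auto simp: ppoint_def)
    then show "y \<in> ppoint (\<lambda>i. c * x i)" using c by (auto simp: ppoint_def intro!: exI[of _ "b / c"]) }
qed

lemma ppoint_eq_iff: "ppoint x = ppoint y \<longleftrightarrow> (\<exists>c. c \<noteq> 0 \<and> x = (\<lambda>i. c * y i))"
proof
  assume "ppoint x = ppoint y"
  then have "x \<in> ppoint y" using ppoint_self by blast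
  then show "\<exists>c. c \<noteq> 0 \<and> x = (\<lambda>i. c * y i)" by (auto simp: ppoint_def)
qed (auto simp: ppoint_scale)

lemma P1_cases:
  assumes "x \<in> hcoords {0, 1 :: nat}"
  obtains "x 1 = 0" "x 0 \<noteq> 0" "ppoint x = ppoint infinity_pt" |
    "x 1 \<noteq> 0" "ppoint x = ppoint (affine_pt (x 0 / x 1))"
proof (cases "x 1 = 0")
  case True
  then have "x 0 \<noteq> 0" "x = (\<lambda>i. x 0 * infinity_pt i)"
    using assms by (auto simp: hcoords_def infinity_pt_def fun_eq_iff)
  then show ?thesis using True that(1) ppoint_scale[of "x 0" infinity_pt] by auto
next
  case False
  then have "x = (\<lambda>i. x 1 * affine_pt (x 0 / x 1) i)"
    using assms by (auto simp: hcoords_def affine_pt_def fun_eq_iff)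
  then show ?thesis using False that(2) ppoint_scale[of "x 1" "affine_pt (x 0 / x 1)"] by auto
qed

lemma affine_pt_inj: "ppoint (affine_pt z) = ppoint (affine_pt w) \<longleftrightarrow> z = w"
proof
  assume "ppoint (affine_pt z) = ppoint (affine_pt w)"
  then obtain c where c: "affine_pt z = (\<lambda>i. c * affine_pt w i)" by (auto simp: ppoint_eq_iff)
  show "z = w" using fun_cong[OF c, of 0] fun_cong[OF c, of 1] by simp
qed simp

text \<open>The exceptions are counted as points of the projective line, since each point has
  infinitely many coordinate vectors.\<close>

definition almost_all_pts :: "((nat \<Rightarrow> complex) \<Rightarrow> bool) \<Rightarrow> bool" where
  "almost_all_pts Q \<longleftrightarrow> finite {ppoint x | x. x \<in> hcoords {0, 1} \<and> \<not> Q x}"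

lemma almost_all_pts_mono:
  assumes "almost_all_pts Q" "\<And>x. x \<in> hcoords {0, 1} \<Longrightarrow> Q x \<Longrightarrow> R x"
  shows "almost_all_pts R"
  using assms(1) unfolding almost_all_pts_def by (rule finite_subset[rotated]) (use assms(2) in blast)

lemma almost_all_pts_conj:
  assumes "almost_all_pts Q" "almost_all_pts R"
  shows "almost_all_pts (\<lambda>x. Q x \<and> R x)"
proof -
  have "{ppoint x | x. x \<in> hcoords {0, 1} \<and> \<not> (Q x \<and> R x)} =
    {ppoint x | x. x \<in> hcoords {0, 1} \<and> \<not> Q x} \<union> {ppoint x | x. x \<in> hcoords {0, 1} \<and> \<not> R x}" by blast
  then show ?thesis using assms by (simp add: almost_all_pts_def)
qed

lemma almost_all_pts_infinite_affine:
  assumes "almost_all_pts Q"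
  shows "finite {z. \<not> Q (affine_pt z)}"
proof -
  have "(\<lambda>z. ppoint (affine_pt z)) ` {z. \<not> Q (affine_pt z)} \<subseteq> {ppoint x | x. x \<in> hcoords {0, 1} \<and> \<not> Q x}"
    by auto
  then have "finite ((\<lambda>z. ppoint (affine_pt z)) ` {z. \<not> Q (affine_pt z)})"
    using assms finite_subset unfolding almost_all_pts_def by blast
  then show ?thesis by (rule finite_imageD) (auto simp: inj_on_def affine_pt_inj)
qed

lemma almost_all_pts_ex:
  assumes "almost_all_pts Q"
  obtains z where "Q (affine_pt z)"
proof -
  have "{z. \<not> Q (affine_pt z)} \<noteq> UNIV"
    using almost_all_pts_infinite_affine[OF assms] infinite_UNIV_char_0[where 'a = complex] by metis
  then show ?thesis using that by auto
qed

text \<open>Apart from infinity, the zeros are roots of the nonzero dehomogenized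
  polynomial.\<close>

lemma almost_all_pts_form:
  assumes h: "binary_form e h" and y: "h y \<noteq> 0"
  shows "almost_all_pts (\<lambda>x. h x \<noteq> 0)"
proof -
  obtain p where p: "degree p \<le> e" "h = form e p"
    using h by (auto simp: binary_form_iff)
  have "p \<noteq> 0" using y by (auto simp: p form_def)
  have "{ppoint x | x. x \<in> hcoords {0, 1} \<and> \<not> h x \<noteq> 0} \<subseteq>
     insert (ppoint infinity_pt) ((\<lambda>z. ppoint (affine_pt z)) ` {z. poly p z = 0})"
  proof
    fix z assume "z \<in> {ppoint x | x. x \<in> hcoords {0, 1} \<and> \<not> h x \<noteq> 0}"
    then obtain x where x: "x \<in> hcoords {0, 1}" "h x = 0" "z = ppoint x" by blast
    from x(1) show "z \<in> insert (ppoint infinity_pt) ((\<lambda>z. ppoint (affine_pt z)) ` {z. poly p z = 0})"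
    proof (cases rule: P1_cases)
      case 2
      then have "poly p (x 0 / x 1) = 0" using x(2) p by (simp add: form_affine)
      then show ?thesis using 2 x(3) by auto
    qed (use x in auto)
  qed
  moreover have "finite {z. poly p z = 0}" using \<open>p \<noteq> 0\<close> by (rule poly_roots_finite)
  ultimately show ?thesis unfolding almost_all_pts_def by (meson finite_imageI finite_insert finite_subset)
qed

text \<open>The identity principle, which extends an equation between forms from almost all points
  to the exceptional ones.\<close>

lemma almost_all_pts_form_zero:
  assumes "binary_form e h" "almost_all_pts (\<lambda>x. h x = 0)"
  shows "h y = 0"
proof (rule ccontr)
  assume "h y \<noteq> 0"
  from almost_all_pts_conj[OF almost_all_pts_form[OF assms(1) this] assms(2)]
  show False by (rule almost_all_pts_ex) auto
qed

section \<open>Pluecker coordinates\<close>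

lemma Gr_basis:
  assumes "V \<in> Gr l"
  obtains v :: "nat \<Rightarrow> complex^'n" where "indep_on {..<l} v" "vec.span (v ` {..<l}) = V"
proof -
  have V: "vec.subspace V" "vec.dim V = l" using assms by (auto simp: Gr_def)
  obtain B where B: "B \<subseteq> V" "vec.independent B" "V \<subseteq> vec.span B" "card B = vec.dim V"
    using vec.basis_exists by blast
  have fB: "finite B" using B(2) vec.finiteI_independent by blast
  then obtain v where v: "bij_betw v {..<l} B"
    using B(4) V(2) ex_bij_betw_nat_finite[of B] by (auto simp: atLeast0LessThan)
  then have im: "v ` {..<l} = B" by (simp add: bij_betw_def)
  have "vec.span B = V" using B V(1) by (metis vec.span_eq_iff vec.span_mono subset_antisym)
  then show ?thesis using that[of v] im B(2) v by (auto simp: indep_on_iff_independent bij_betw_def)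
qed

lemma Gr_span: "indep_on {..<l} v \<Longrightarrow> vec.span (v ` {..<l}) \<in> Gr l"
  using dim_span_indep_on[of "{..<l}" v] by (simp add: Gr_def)

lemma Gr_indep:
  assumes "vec.span (v ` {..<l}) \<in> Gr l"
  shows "indep_on {..<l} v"
  using assms by (intro indep_on_if_dim) (auto simp: Gr_def)

lemma wedge_coords_change_basis:
  fixes v w :: "nat \<Rightarrow> complex^'n::{finite,linorder}"
  assumes "indep_on {..<l} w" "vec.span (w ` {..<l}) \<subseteq> vec.span (v ` {..<l})"
  obtains c where "c \<noteq> 0" "\<And>S. wedge_coords l w S = c * wedge_coords l v S"
proof -
  have "\<exists>c. w a = (\<Sum>b<l. c b *s v b)" if "a < l" for a
  proof -
    have "w a \<in> vec.span (v ` {..<l})" using assms(2) that vec.span_base[of "w a" "w ` {..<l}"] by auto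
    then show ?thesis by (rule in_span_imageE) auto
  qed
  then obtain M where M: "w a = (\<Sum>b<l. M a b *s v b)" if "a < l" for a by metis
  have e: "wedge_coords l w S = Determinant.det (mat l l (\<lambda>(a, b). M a b)) * wedge_coords l v S" for S
    by (rule wedge_coords_lincomb) (rule M)
  \<comment> \<open>\<open>w\<close> has a nonzero coordinate, so the determinant of the change of
    basis cannot vanish.\<close>
  obtain S where "wedge_coords l w S \<noteq> 0"
    using indep_imp_wedge_coords_nonzero[OF assms(1)] by blast
  then show ?thesis using that[of "Determinant.det (mat l l (\<lambda>(a, b). M a b))"] e by auto
qed

text \<open>The basis chosen by \<open>SOME\<close> in \<open>plucker\<close> differs from
  \<open>v\<close> by an invertible matrix, whose determinant only rescales the coordinates.\<close>

lemma plucker_span: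
  fixes v :: "nat \<Rightarrow> complex^'n::{finite,linorder}"
  assumes "indep_on {..<l} v"
  shows "plucker l (vec.span (v ` {..<l})) = ppoint (wedge_coords l v)"
proof -
  define w where "w = (SOME w :: nat \<Rightarrow> complex^'n::{finite,linorder}. vec.span (w ` {..<l}) = vec.span (v ` {..<l}))"
  have w: "vec.span (w ` {..<l}) = vec.span (v ` {..<l})"
    unfolding w_def by (rule someI[of _ v]) simp
  have "indep_on {..<l} w" using Gr_indep Gr_span[OF assms] w by metis
  then obtain c where "c \<noteq> 0" "\<And>S. wedge_coords l w S = c * wedge_coords l v S"
    using wedge_coords_change_basis[of l w v] w by auto
  then have "wedge_coords l w = (\<lambda>S. c * wedge_coords l v S)" "c \<noteq> 0" by auto
  then show ?thesis unfolding plucker_def w_def[symmetric] by (simp add: ppoint_scale)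
qed

lemma wedge_coords_outside: "S \<notin> plucker_index l \<Longrightarrow> wedge_coords l v S = 0"
  by (auto simp: wedge_coords_def plucker_index_def)

lemma wedge_coords_hcoords:
  fixes v :: "nat \<Rightarrow> complex^'n::{finite,linorder}"
  assumes "indep_on {..<l} v"
  shows "wedge_coords l v \<in> hcoords (plucker_index l)"
proof -
  obtain S where "card S = l" "wedge_coords l v S \<noteq> 0"
    using indep_imp_wedge_coords_nonzero[OF assms] by blast
  then show ?thesis by (auto simp: hcoords_def wedge_coords_outside plucker_index_def intro!: exI[of _ S])
qed

section \<open>Rows of binary forms spanning a curve\<close>

text \<open>Every row has a degree of its own, because it is the sum of these degrees that is to
  become the degree of the curve.\<close>

definition row_forms :: "nat \<Rightarrow> (nat \<Rightarrow> nat) \<Rightarrow> (nat \<Rightarrow> (nat \<Rightarrow> complex) \<Rightarrow> complex^'n) \<Rightarrow> bool" where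
  "row_forms l d B \<longleftrightarrow> (\<forall>i<l. \<forall>j. binary_form (d i) (\<lambda>x. B i x $ j))"

lemma minor_form:
  assumes "row_forms l d B"
  shows "binary_form (\<Sum>i<l. d i) (\<lambda>x. minor l (\<lambda>i. B i x) s)"
  unfolding minor_eq_sum
  using assms by (intro binary_form_sum binary_form_scale binary_form_prod) (auto simp: row_forms_def)

lemma wedge_coords_form:
  assumes "row_forms l d B"
  shows "binary_form (\<Sum>i<l. d i) (\<lambda>x. wedge_coords l (\<lambda>i. B i x) S)"
  unfolding wedge_coords_minor using minor_form[OF assms] by (cases "card S = l") (simp_all add: binary_form_0)

(* The rows are the contractions of the Pluecker vector, so that they have entries among the
   Pluecker coordinates up to sign. *)
lemma curve_rows_local:
  fixes f :: "ppt1 \<Rightarrow> (complex^'n::{finite,linorder}) set"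
  assumes f: "\<And>z. z \<in> P1 \<Longrightarrow> f z \<in> Gr l"
    and reg: "regular_P1 (plucker_index l) (\<lambda>z. plucker l (f z))"
    and x0: "x0 \<in> hcoords {0, 1}"
  obtains e h s B where "binary_form e h" "h x0 \<noteq> 0" "row_forms l (\<lambda>_. e) B"
    "\<And>x. x \<in> hcoords {0, 1} \<Longrightarrow> h x \<noteq> 0 \<Longrightarrow> f (ppoint x) = vec.span ((\<lambda>i. B i x) ` {..<l})"
    "\<And>x y. x \<in> hcoords {0, 1} \<Longrightarrow> h x \<noteq> 0 \<Longrightarrow> y \<in> f (ppoint x) \<Longrightarrow>
        h x *s y = (\<Sum>b<l. y $ s b *s B b x)"
proof -
  obtain e hh S0 where hh: "\<And>S. S \<in> plucker_index l \<Longrightarrow> binary_form e (hh S)"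
    and S0: "S0 \<in> plucker_index l" "hh S0 x0 \<noteq> 0"
    and near: "\<And>y. y \<in> hcoords {0, 1} \<Longrightarrow> (\<exists>S\<in>plucker_index l. hh S y \<noteq> 0) \<Longrightarrow>
      plucker l (f (ppoint y)) = ppoint (\<lambda>S. if S \<in> plucker_index l then hh S y else 0)"
  proof -
    from reg x0 obtain e hh where "\<forall>S\<in>plucker_index l. binary_form e (hh S)"
      "\<exists>S\<in>plucker_index l. hh S x0 \<noteq> 0"
      "\<forall>y\<in>hcoords {0, 1}. (\<exists>S\<in>plucker_index l. hh S y \<noteq> 0) \<longrightarrow>
        plucker l (f (ppoint y)) = ppoint (\<lambda>S. if S \<in> plucker_index l then hh S y else 0)"
      unfolding regular_P1_def by blast
    then show ?thesis using that[of e hh] by blast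
  qed
  have cS0: "card S0 = l" using S0 by (simp add: plucker_index_def)
  define s where "s b = sorted_list_of_set S0 ! b" for b
  define H where "H x S = (if S \<in> plucker_index l then hh S x else 0)" for x and S :: "'n set"
  have "\<exists>\<epsilon>. \<forall>v :: nat \<Rightarrow> complex^'n::{finite,linorder}. minor l v t = \<epsilon> * wedge_coords l v (t ` {..<l})" for t
    using minor_reorder[of l t] by metis
  then obtain \<epsilon> where eps: "minor l v t = \<epsilon> t * wedge_coords l v (t ` {..<l})"
    for v :: "nat \<Rightarrow> complex^'n::{finite,linorder}" and t by metis
  define B where "B b x = (\<chi> j. \<epsilon> (s(b := j)) * H x ((s(b := j)) ` {..<l}))" for b x
  have Hform: "binary_form e (\<lambda>x. H x S)" for S
    unfolding H_def using hh by (cases "S \<in> plucker_index l") (simp_all add: binary_form_0)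
  have rows: "row_forms l (\<lambda>_. e) B"
    unfolding row_forms_def B_def by (auto intro!: binary_form_scale Hform)
  have key: "f (ppoint x) = vec.span ((\<lambda>i. B i x) ` {..<l}) \<and>
      (\<forall>y\<in>f (ppoint x). H x S0 *s y = (\<Sum>b<l. y $ s b *s B b x))"
    if x: "x \<in> hcoords {0, 1}" "H x S0 \<noteq> 0" for x
  proof -
    have "f (ppoint x) \<in> Gr l" by (rule f) (use x in \<open>simp add: proj_space_def\<close>)
    then obtain v where v: "indep_on {..<l} v" "vec.span (v ` {..<l}) = f (ppoint x)"
      by (rule Gr_basis)
    have "plucker l (f (ppoint x)) = ppoint (H x)"
      unfolding H_def using x S0 by (intro near) (auto simp: H_def)
    then have "ppoint (wedge_coords l v) = ppoint (H x)"
      using plucker_span[OF v(1)] v(2) by simp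
    \<comment> \<open>\<open>c\<close> depends on the point and need not be a form, but it scales
      the minor and the contracted rows alike and therefore cancels.\<close>
    then obtain c where c: "c \<noteq> 0" "wedge_coords l v = (\<lambda>S. c * H x S)"
      by (auto simp: ppoint_eq_iff)
    have mS0: "minor l v s = c * H x S0"
      using fun_cong[OF c(2), of S0] cS0 by (simp add: wedge_coords_minor s_def[abs_def])
    have row: "minor_row l v s b = c *s B b x" for b
      unfolding minor_row_def B_def Finite_Cartesian_Product.vec_eq_iff eps c(2) by simp
    have nz: "minor l v s \<noteq> 0" using mS0 c(1) x(2) by simp
    have "vec.span ((\<lambda>i. B i x) ` {..<l}) = vec.span (minor_row l v s ` {..<l})"
    proof
      have "B b x = inverse c *s minor_row l v s b" for b
        using c(1) by (simp add: row)
      then show "vec.span ((\<lambda>i. B i x) ` {..<l}) \<subseteq> vec.span (minor_row l v s ` {..<l})"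
        by (intro vec.span_minimal) (auto simp: vec.span_base vec.span_scale simp del: vec.scale_scale)
      show "vec.span (minor_row l v s ` {..<l}) \<subseteq> vec.span ((\<lambda>i. B i x) ` {..<l})"
        by (intro vec.span_minimal) (auto simp: row vec.span_base vec.span_scale)
    qed
    then have sp: "f (ppoint x) = vec.span ((\<lambda>i. B i x) ` {..<l})"
      using span_minor_row[OF nz] v(2) by simp
    have "H x S0 *s y = (\<Sum>b<l. y $ s b *s B b x)" if "y \<in> f (ppoint x)" for y
    proof -
      have "c *s (H x S0 *s y) = (\<Sum>b<l. y $ s b *s (c *s B b x))"
        using minor_scale_eq[OF nz, of y] that v(2) by (simp add: mS0 row)
      also have "\<dots> = c *s (\<Sum>b<l. y $ s b *s B b x)"
        by (simp add: vec.scale_sum_right mult.commute)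
      finally show ?thesis using c(1) by (simp only: vec.scale_cancel_left) simp
    qed
    with sp show ?thesis by blast
  qed
  show ?thesis
  proof (rule that[of e "\<lambda>x. H x S0" B s])
    show "H x0 S0 \<noteq> 0" using S0 by (simp add: H_def)
  qed (use Hform rows key in auto)
qed

text \<open>An exchange: as the coefficient of \<open>v a\<close> is not 0, \<open>v a\<close> can
  be recovered from \<open>y\<close> and the other vectors.\<close>

lemma span_replace:
  fixes v :: "nat \<Rightarrow> 'a::field^'n::finite"
  assumes a: "a < m" "\<alpha> a \<noteq> 0" and y: "c *s y = (\<Sum>i<m. \<alpha> i *s v i)" and c: "c \<noteq> 0"
  shows "vec.span ((v(a := y)) ` {..<m}) = vec.span (v ` {..<m})"
proof
  have "y = inverse c *s (\<Sum>i<m. \<alpha> i *s v i)"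
    using c by (simp flip: y)
  then have "y \<in> vec.span (v ` {..<m})"
    by (simp add: vec.span_scale sum_in_span_image)
  then show "vec.span ((v(a := y)) ` {..<m}) \<subseteq> vec.span (v ` {..<m})"
    by (intro vec.span_minimal) (auto intro: vec.span_base)
  let ?W = "vec.span ((v(a := y)) ` {..<m})"
  have yW: "y \<in> ?W" using a by (intro vec.span_base) auto
  have oW: "v i \<in> ?W" if "i < m" "i \<noteq> a" for i
    using that by (intro vec.span_base) (auto intro!: image_eqI[of _ _ i])
  have "(\<Sum>i<m. \<alpha> i *s v i) = \<alpha> a *s v a + (\<Sum>i\<in>{..<m} - {a}. \<alpha> i *s v i)"
    using a by (simp add: sum.remove)
  then have "\<alpha> a *s v a = c *s y - (\<Sum>i\<in>{..<m} - {a}. \<alpha> i *s v i)"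
    using y by simp
  also have "\<dots> \<in> ?W"
    using yW oW by (intro vec.span_diff vec.span_scale vec.span_sum) auto
  finally have "inverse (\<alpha> a) *s (\<alpha> a *s v a) \<in> ?W" by (rule vec.span_scale)
  then have "v a \<in> ?W" using a by simp
  then have "v i \<in> ?W" if "i < m" for i using oW that by blast
  then show "vec.span (v ` {..<m}) \<subseteq> ?W"
    by (intro vec.span_minimal) auto
qed

text \<open>Independence at every point, and not only at a general one, makes the pulled back
  tautological bundle the direct sum of line bundles of degrees \<open>- d i\<close>. This is why
  the row degrees add up to the degree of the curve.\<close>

definition curve_by_rows ::
    "nat \<Rightarrow> (nat \<Rightarrow> nat) \<Rightarrow> (nat \<Rightarrow> (nat \<Rightarrow> complex) \<Rightarrow> complex^'n) \<Rightarrow> (ppt1 \<Rightarrow> (complex^'n) set) \<Rightarrow> bool" where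
  "curve_by_rows l d B f \<longleftrightarrow> row_forms l d B \<and>
     (\<forall>x\<in>hcoords {0, 1}. indep_on {..<l} (\<lambda>i. B i x) \<and> f (ppoint x) = vec.span ((\<lambda>i. B i x) ` {..<l}))"

lemma hcoords_in_P1: "x \<in> hcoords {0, 1} \<Longrightarrow> ppoint x \<in> P1"
  by (simp add: proj_space_def)

lemma P1_E:
  assumes "z \<in> P1"
  obtains x where "x \<in> hcoords {0, 1}" "z = ppoint x"
  using assms by (auto simp: proj_space_def)

(* If the rows are dependent at a point then a combination of them, with coefficients that are
   forms, vanishes there, and dividing it by the linear form of the point lowers a degree. *)
lemma reduce_rows:
  fixes B :: "nat \<Rightarrow> (nat \<Rightarrow> complex) \<Rightarrow> complex^'n"
  assumes rows: "row_forms l d B"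
    and ind: "almost_all_pts (\<lambda>x. indep_on {..<l} (\<lambda>i. B i x))"
    and x0: "x0 \<in> hcoords {0, 1}" and dep: "\<not> indep_on {..<l} (\<lambda>i. B i x0)"
  obtains d' B' where "row_forms l d' B'" "(\<Sum>i<l. d' i) < (\<Sum>i<l. d i)"
    "almost_all_pts (\<lambda>x. vec.span ((\<lambda>i. B' i x) ` {..<l}) = vec.span ((\<lambda>i. B i x) ` {..<l}))"
proof -
  obtain c i1 where c: "(\<Sum>i<l. c i *s B i x0) = 0" "i1 < l" "c i1 \<noteq> 0"
    using dep by (auto simp: indep_on_def)
  define C where "C = {i. i < l \<and> c i \<noteq> 0}"
  have C: "finite C" "C \<noteq> {}" using c by (auto simp: C_def)
  \<comment> \<open>Among the rows that occur in the relation, one of largest degree is replaced: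
    the others can be raised to its degree by powers of a coordinate.\<close>
  have "Max (d ` C) \<in> d ` C" using C by (intro Max_in) auto
  then obtain a where a: "a \<in> C" "d a = Max (d ` C)" by auto
  have max: "d i \<le> d a" if "i < l" "c i \<noteq> 0" for i
    unfolding a(2) using that C by (intro Max_ge) (auto simp: C_def)
  have al: "a < l" "c a \<noteq> 0" using a by (auto simp: C_def)
  obtain m where m: "m \<in> {0, 1}" "x0 m \<noteq> 0" using x0 by (auto simp: hcoords_def)
  \<comment> \<open>The power of \<open>x m\<close> lifts row \<open>i\<close> to degree
    \<open>d a\<close>; dividing by \<open>x0 m\<close> makes the coefficient equal to
    \<open>c i\<close> at \<open>x0\<close>.\<close>
  define \<alpha> where "\<alpha> x i = c i * (x m / x0 m) ^ (d a - d i)" for x :: "nat \<Rightarrow> complex" and i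
  define P where "P x = (\<Sum>i<l. \<alpha> x i *s B i x)" for x
  have aform: "binary_form (d a) (\<lambda>x. P x $ j)" for j
  proof -
    have "binary_form (d a) (\<lambda>x. \<alpha> x i * B i x $ j)" if "i < l" for i
    proof (cases "c i = 0")
      case True
      then show ?thesis by (simp add: \<alpha>_def binary_form_0)
    next
      case False
      have "binary_form ((d a - d i) * 1) (\<lambda>x. x m ^ (d a - d i))"
        using m by (intro binary_form_power binary_form_coord)
      then have "binary_form ((d a - d i) * 1) (\<lambda>x. c i / x0 m ^ (d a - d i) * x m ^ (d a - d i))"
        by (rule binary_form_scale)
      then have "binary_form (d a - d i) (\<lambda>x. \<alpha> x i)" by (simp add: \<alpha>_def power_divide)
      from binary_form_mult[OF this, of "d i" "\<lambda>x. B i x $ j"] rows that max[OF that False]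
      show ?thesis by (simp add: row_forms_def)
    qed
    then show ?thesis unfolding P_def by (auto intro!: binary_form_sum)
  qed
  have P0: "P x0 = 0" using c(1) m by (simp add: P_def \<alpha>_def)
  have mm: "almost_all_pts (\<lambda>x. x m \<noteq> 0)"
    using almost_all_pts_form[OF binary_form_coord[OF m(1)]] m(2) by blast
  have \<alpha>a: "\<alpha> x a = c a" for x by (simp add: \<alpha>_def)
  show ?thesis
  proof (cases "d a")
    case 0
    \<comment> \<open>In degree 0 the combination is constant, so it would vanish everywhere,
      against the independence at almost all points.\<close>
    have "P x = 0" for x
    proof -
      have "P x $ j = P x0 $ j" for j
        using aform[of j] by (auto simp: 0 binary_form_def fun_eq_iff)
      then show ?thesis using P0 by (simp add: Finite_Cartesian_Product.vec_eq_iff)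
    qed
    from ind obtain z where "indep_on {..<l} (\<lambda>i. B i (affine_pt z))"
      by (rule almost_all_pts_ex)
    from indep_onD[OF this, of "\<alpha> (affine_pt z)" a] \<open>\<And>x. P x = 0\<close> al \<alpha>a
    have False by (auto simp: P_def)
    then show ?thesis ..
  next
    case (Suc e)
    have "\<exists>h'. binary_form e h' \<and> (\<forall>x. P x $ j = (x0 1 * x 0 - x0 0 * x 1) * h' x)" for j
      using binary_form_factor[OF aform[of j, unfolded Suc] x0] P0 by (metis zero_index)
    then obtain h' where h': "\<And>j. binary_form e (h' j)"
      "\<And>j x. P x $ j = (x0 1 * x 0 - x0 0 * x 1) * h' j x" by metis
    define B' where "B' = B(a := (\<lambda>x. \<chi> j. h' j x))"
    define d' where "d' = d(a := e)"
    have "row_forms l d' B'" using rows h'(1) by (auto simp: row_forms_def B'_def d'_def)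
    moreover have "(\<Sum>i<l. d' i) < (\<Sum>i<l. d i)"
      by (rule sum_strict_mono_ex1) (use al Suc in \<open>auto simp: d'_def intro!: bexI[of _ a]\<close>)
    moreover have "almost_all_pts (\<lambda>x. vec.span ((\<lambda>i. B' i x) ` {..<l}) = vec.span ((\<lambda>i. B i x) ` {..<l}))"
    proof -
      have "binary_form 1 (\<lambda>x. x0 1 * x 0 + (- x0 0) * x 1)"
        by (intro binary_form_add binary_form_scale binary_form_coord) auto
      then have lf: "binary_form 1 (\<lambda>x. x0 1 * x 0 - x0 0 * x 1)" by simp
      have "\<exists>y :: nat \<Rightarrow> complex. x0 1 * y 0 - x0 0 * y 1 \<noteq> 0"
      proof (cases "x0 1 = 0")
        case True
        then have "x0 0 \<noteq> 0" using x0 by (auto simp: hcoords_def)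
        then show ?thesis using True by (intro exI[of _ "affine_pt 0"]) simp
      next
        case False
        then show ?thesis by (intro exI[of _ infinity_pt]) simp
      qed
      then have "almost_all_pts (\<lambda>x. x0 1 * x 0 - x0 0 * x 1 \<noteq> 0)"
        using almost_all_pts_form[OF lf] by blast
      then show ?thesis
      proof (rule almost_all_pts_mono)
        fix x :: "nat \<Rightarrow> complex" assume L: "x0 1 * x 0 - x0 0 * x 1 \<noteq> 0"
        have e: "(x0 1 * x 0 - x0 0 * x 1) *s (\<chi> j. h' j x) = (\<Sum>i<l. \<alpha> x i *s B i x)"
          unfolding P_def[symmetric] by (simp add: Finite_Cartesian_Product.vec_eq_iff h'(2) left_diff_distrib)
        have B'x: "(\<lambda>i. B' i x) = (\<lambda>i. B i x)(a := (\<chi> j. h' j x))" by (auto simp: B'_def)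
        have nz: "\<alpha> x a \<noteq> 0" using al(2) \<alpha>a by simp
        show "vec.span ((\<lambda>i. B' i x) ` {..<l}) = vec.span ((\<lambda>i. B i x) ` {..<l})"
          unfolding B'x by (rule span_replace[OF al(1) nz e L])
      qed
    qed
    ultimately show ?thesis by (rule that)
  qed
qed

text \<open>Rows of least total degree among those spanning the curve at almost all points are
  independent everywhere by \<open>reduce_rows\<close>. They then span it everywhere, because
  containment in the curve is an equation between forms and the dimensions agree.\<close>

lemma curve_rows_exist:
  fixes f :: "ppt1 \<Rightarrow> (complex^'n::{finite,linorder}) set"
  assumes f: "\<And>z. z \<in> P1 \<Longrightarrow> f z \<in> Gr l"
    and reg: "regular_P1 (plucker_index l) (\<lambda>z. plucker l (f z))"
  obtains d B where "curve_by_rows l d B f"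
proof -
  define Q where "Q N \<longleftrightarrow> (\<exists>d B. row_forms l d B \<and> (\<Sum>i<l. d i) = N \<and>
    almost_all_pts (\<lambda>x. f (ppoint x) = vec.span ((\<lambda>i. B i x) ` {..<l})))" for N
  have "\<exists>N. Q N"
  proof -
    obtain e h s B where h: "binary_form e h" "h infinity_pt \<noteq> 0" "row_forms l (\<lambda>_. e) B"
      "\<And>x. x \<in> hcoords {0, 1} \<Longrightarrow> h x \<noteq> 0 \<Longrightarrow> f (ppoint x) = vec.span ((\<lambda>i. B i x) ` {..<l})"
      by (rule curve_rows_local[OF f reg infinity_pt_hcoords]) auto
    have "almost_all_pts (\<lambda>x. f (ppoint x) = vec.span ((\<lambda>i. B i x) ` {..<l}))"
      using almost_all_pts_form[OF h(1,2)] by (rule almost_all_pts_mono) (rule h(4))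
    then show ?thesis unfolding Q_def using h(3) by blast
  qed
  then have "Q (LEAST N. Q N)" by (rule LeastI_ex)
  then obtain d B where rows: "row_forms l d B" and N: "(\<Sum>i<l. d i) = (LEAST N. Q N)"
    and alm: "almost_all_pts (\<lambda>x. f (ppoint x) = vec.span ((\<lambda>i. B i x) ` {..<l}))"
    unfolding Q_def by blast
  have ind0: "almost_all_pts (\<lambda>x. indep_on {..<l} (\<lambda>i. B i x))"
    using alm by (rule almost_all_pts_mono) (metis Gr_indep f hcoords_in_P1)
  have ind: "indep_on {..<l} (\<lambda>i. B i x)" if x: "x \<in> hcoords {0, 1}" for x
  proof (rule ccontr)
    assume "\<not> ?thesis"
    then obtain d' B' where B': "row_forms l d' B'" "(\<Sum>i<l. d' i) < (\<Sum>i<l. d i)"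
      "almost_all_pts (\<lambda>x. vec.span ((\<lambda>i. B' i x) ` {..<l}) = vec.span ((\<lambda>i. B i x) ` {..<l}))"
      using reduce_rows[OF rows ind0 x] by blast
    have "almost_all_pts (\<lambda>x. f (ppoint x) = vec.span ((\<lambda>i. B' i x) ` {..<l}))"
      using almost_all_pts_conj[OF alm B'(3)] by (rule almost_all_pts_mono) auto
    then have "Q (\<Sum>i<l. d' i)" unfolding Q_def using B'(1) by blast
    then show False using B'(2) N not_less_Least by metis
  qed
  have "f (ppoint x) = vec.span ((\<lambda>i. B i x) ` {..<l})" if x: "x \<in> hcoords {0, 1}" for x
  proof -
    obtain e h s R where h: "binary_form e h" "h x \<noteq> 0" "row_forms l (\<lambda>_. e) R"
      and R1: "\<And>x. x \<in> hcoords {0, 1} \<Longrightarrow> h x \<noteq> 0 \<Longrightarrow> f (ppoint x) = vec.span ((\<lambda>i. R i x) ` {..<l})"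
      and R2: "\<And>x y. x \<in> hcoords {0, 1} \<Longrightarrow> h x \<noteq> 0 \<Longrightarrow> y \<in> f (ppoint x) \<Longrightarrow>
        h x *s y = (\<Sum>b<l. y $ s b *s R b x)"
      by (rule curve_rows_local[OF f reg x]) blast+
    have "B a x \<in> f (ppoint x)" if a: "a < l" for a
    proof -
      \<comment> \<open>The containment of \<open>B a x\<close> in \<open>f (ppoint x)\<close>,
        written with the local rows \<open>R\<close>. It holds at almost all points, hence at
        \<open>x\<close> itself.\<close>
      have "h x * B a x $ j + (\<Sum>b<l. (-1) * (B a x $ s b * R b x $ j)) = 0" for j
      proof (rule almost_all_pts_form_zero[where y = x])
        show "binary_form (d a + e) (\<lambda>x. h x * B a x $ j + (\<Sum>b<l. (-1) * (B a x $ s b * R b x $ j)))"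
        proof (intro binary_form_add binary_form_sum binary_form_scale)
          show "binary_form (d a + e) (\<lambda>x. h x * B a x $ j)"
            using binary_form_mult[OF h(1), of "d a" "\<lambda>x. B a x $ j"] rows a
            by (simp add: row_forms_def add.commute)
          show "binary_form (d a + e) (\<lambda>x. B a x $ s b * R b x $ j)" if "b \<in> {..<l}" for b
            using rows a h(3) that by (intro binary_form_mult) (auto simp: row_forms_def)
        qed
        show "almost_all_pts (\<lambda>x. h x * B a x $ j + (\<Sum>b<l. (-1) * (B a x $ s b * R b x $ j)) = 0)"
          using almost_all_pts_conj[OF alm almost_all_pts_form[OF h(1,2)]]
        proof (rule almost_all_pts_mono)
          fix y assume y: "y \<in> hcoords {0, 1}"
            "f (ppoint y) = vec.span ((\<lambda>i. B i y) ` {..<l}) \<and> h y \<noteq> 0"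
          then have "B a y \<in> f (ppoint y)" using a by (auto intro: vec.span_base)
          from R2[OF y(1) _ this] y(2)
          have "h y *s B a y = (\<Sum>b<l. B a y $ s b *s R b y)" by blast
          from arg_cong[OF this, of "\<lambda>v. v $ j"]
          show "h y * B a y $ j + (\<Sum>b<l. (-1) * (B a y $ s b * R b y $ j)) = 0"
            by (simp add: sum_negf)
        qed
      qed
      then have "h x * B a x $ j = (\<Sum>b<l. B a x $ s b * R b x $ j)" for j
        by (simp add: sum_negf)
      then have "h x *s B a x = (\<Sum>b<l. B a x $ s b *s R b x)"
        by (simp add: Finite_Cartesian_Product.vec_eq_iff)
      then have "h x *s B a x \<in> f (ppoint x)"
        by (simp add: R1[OF x h(2)] sum_in_span_image)
      then have "inverse (h x) *s (h x *s B a x) \<in> f (ppoint x)"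
        unfolding R1[OF x h(2)] by (rule vec.span_scale)
      then show ?thesis using h(2) by simp
    qed
    then have sub: "vec.span ((\<lambda>i. B i x) ` {..<l}) \<subseteq> f (ppoint x)"
      using f[OF hcoords_in_P1[OF x]] by (intro vec.span_minimal) (auto simp: Gr_def)
    have "vec.dim (f (ppoint x)) \<le> vec.dim (vec.span ((\<lambda>i. B i x) ` {..<l}))"
      using f[OF hcoords_in_P1[OF x]] dim_span_indep_on[OF _ ind[OF x]] by (simp add: Gr_def)
    then show ?thesis
      using vec.subspace_dim_equal[OF _ _ sub] f[OF hcoords_in_P1[OF x]] by (simp add: Gr_def)
  qed
  then have "curve_by_rows l d B f" using rows ind by (simp add: curve_by_rows_def)
  then show ?thesis by (rule that)
qed

section \<open>The degree of a curve\<close>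

lemma poly_fun_path:
  assumes "poly_fun C g" "\<And>c. c \<in> C \<Longrightarrow> \<exists>p. \<forall>t. c (\<gamma> t) = poly p t"
  shows "\<exists>p. \<forall>t. g (\<gamma> t) = poly p t"
  using assms(1)
proof induction
  case (const a)
  show ?case by (intro exI[of _ "[:a:]"]) simp
next
  case (add g h)
  then show ?case by (metis poly_add)
next
  case (mult g h)
  then show ?case by (metis poly_mult)
qed (use assms(2) in blast)

text \<open>The way to move inside a nonempty open set: along a path through one of its points all
  but finitely many parameters are allowed.\<close>

lemma poly_path_finite_zeros:
  assumes "poly_fun C g" "\<And>c. c \<in> C \<Longrightarrow> \<exists>p. \<forall>t. c (\<gamma> t) = poly p t" "g (\<gamma> t0) \<noteq> 0"
  shows "finite {t. g (\<gamma> t) = 0}"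
proof -
  obtain p where p: "\<And>t. g (\<gamma> t) = poly p t" using poly_fun_path[of C g \<gamma>, OF assms(1,2)] by blast
  then have "p \<noteq> 0" using assms(3) by auto
  then show ?thesis unfolding p by (rule poly_roots_finite)
qed

lemma avoid_finite:
  assumes "finite A"
  obtains t :: complex where "t \<notin> A"
  using assms ex_new_if_finite[OF infinite_UNIV_char_0] by blast

lemma complex_card_roots:
  assumes "rsquarefree (p :: complex poly)"
  shows "card {z. poly p z = 0} = degree p"
proof -
  have p0: "p \<noteq> 0" using assms by (simp add: rsquarefree_def)
  have "degree (\<Prod>z | poly p z = 0. [:- z, 1:]) = (\<Sum>z | poly p z = 0. degree [:- z, 1:])"
    by (rule degree_prod_eq_sum_degree) simp
  moreover have "degree (Polynomial.smult (lead_coeff p) (\<Prod>z | poly p z = 0. [:- z, 1:])) = degree p"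
    using complex_poly_decompose_rsquarefree[OF assms] by simp
  ultimately show ?thesis using p0 by simp
qed

(* A multiple root of a member of the pencil is a root of the Wronskian. *)
lemma pencil_finite_bad:
  fixes p r :: "complex poly"
  assumes nc: "\<And>z. poly p z = 0 \<Longrightarrow> poly r z \<noteq> 0" and deg: "degree p \<noteq> 0"
  shows "finite {t. \<not> rsquarefree (p + Polynomial.smult t r)}"
proof -
  define w where "w = pderiv p * r - p * pderiv r"
  have p0: "p \<noteq> 0" using deg by auto
  have dp0: "pderiv p \<noteq> 0" using deg by (simp add: pderiv_eq_0_iff)
  have "\<not> constant (poly p)" using deg by (simp add: constant_degree)
  then obtain z where z: "poly p z = 0" using fundamental_theorem_of_algebra by blast
  have rz: "poly r z \<noteq> 0" using nc[OF z] .
  have oz: "order z p = Suc (order z (pderiv p))"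
    using z p0 by (intro order_pderiv dp0) (simp add: order_root)
  \<comment> \<open>At a root of \<open>p\<close>, where \<open>r\<close> does not vanish, the two
    products in \<open>w\<close> have different orders, since differentiation lowers the order of
    \<open>p\<close> by one.\<close>
  have "w \<noteq> 0"
  proof
    assume "w = 0"
    then have e: "pderiv p * r = p * pderiv r" by (simp add: w_def)
    have nz: "pderiv p * r \<noteq> 0" using dp0 rz by auto
    then have nz': "p * pderiv r \<noteq> 0" using e by simp
    have "order z p + order z (pderiv r) = order z (pderiv p) + order z r"
      using order_mult[OF nz] order_mult[OF nz'] e by simp
    then show False using oz rz order_0I[of r z] by simp
  qed
  have "{t. \<not> rsquarefree (p + Polynomial.smult t r)} \<subseteq> (\<lambda>z. - poly p z / poly r z) ` {z. poly w z = 0}"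
  proof
    fix t assume "t \<in> {t. \<not> rsquarefree (p + Polynomial.smult t r)}"
    then obtain z where "poly (p + Polynomial.smult t r) z = 0" "poly (pderiv (p + Polynomial.smult t r)) z = 0"
      by (auto simp: rsquarefree_roots)
    then have z: "poly p z = - (t * poly r z)" "poly (pderiv p) z = - (t * poly (pderiv r) z)"
      by (auto simp: pderiv_add pderiv_smult eq_neg_iff_add_eq_0)
    then have "poly w z = 0" by (simp add: w_def)
    moreover have "poly r z \<noteq> 0" using nc[of z] z(1) by auto
    then have "t = - poly p z / poly r z" using z(1) by simp
    ultimately show "t \<in> (\<lambda>z. - poly p z / poly r z) ` {z. poly w z = 0}" by blast
  qed
  moreover have "finite {z. poly w z = 0}" using \<open>w \<noteq> 0\<close> by (rule poly_roots_finite)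
  ultimately show ?thesis using finite_subset by blast
qed

section \<open>Hyperplane sections of a curve\<close>

lemma ppoint_hyperplane:
  assumes "w \<in> hcoords I"
  shows "ppoint w \<in> hyperplane I c \<longleftrightarrow> (\<Sum>i\<in>I. c i * w i) = 0"
proof
  assume "ppoint w \<in> hyperplane I c"
  then show "(\<Sum>i\<in>I. c i * w i) = 0" using ppoint_self[of w] by (auto simp: hyperplane_def)
next
  assume *: "(\<Sum>i\<in>I. c i * w i) = 0"
  have "(\<Sum>i\<in>I. c i * x i) = 0" if "x \<in> ppoint w" for x
  proof -
    from that obtain b where "x = (\<lambda>i. b * w i)" unfolding ppoint_def by blast
    then have "(\<Sum>i\<in>I. c i * x i) = b * (\<Sum>i\<in>I. c i * w i)"
      by (simp add: sum_distrib_left algebra_simps)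
    then show ?thesis using * by simp
  qed
  then show "ppoint w \<in> hyperplane I c" using assms by (auto simp: hyperplane_def proj_space_def)
qed

lemma finite_linear_zeros: "a \<noteq> 0 \<or> b \<noteq> 0 \<Longrightarrow> finite {t :: complex. a + t * b = 0}"
  using poly_roots_finite[of "[:a, b:]"] by auto

text \<open>Induction on the points: one coefficient, at an index where the new point is not 0, is
  changed by \<open>t\<close>. Each point excludes only finitely many \<open>t\<close>.\<close>

lemma avoid_hyperplanes:
  fixes W :: "'i \<Rightarrow> 'z \<Rightarrow> complex"
  assumes "finite Z" "finite I" "\<And>z. z \<in> Z \<Longrightarrow> \<exists>i\<in>I. W i z \<noteq> 0"
  shows "\<exists>c. \<forall>z\<in>Z. (\<Sum>i\<in>I. c i * W i z) \<noteq> 0"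
  using assms(1,3)
proof (induction Z)
  case (insert z Z)
  then obtain c where c: "\<forall>z\<in>Z. (\<Sum>i\<in>I. c i * W i z) \<noteq> 0" by blast
  obtain i where i: "i \<in> I" "W i z \<noteq> 0" using insert.prems by blast
  define c' where "c' t j = (if j = i then c j + t else c j)" for t j
  have e: "(\<Sum>j\<in>I. c' t j * W j y) = (\<Sum>j\<in>I. c j * W j y) + t * W i y" for t y
  proof -
    have "(\<Sum>j\<in>I. c' t j * W j y) = (\<Sum>j\<in>I. c j * W j y + (if j = i then t * W j y else 0))"
      by (intro sum.cong) (auto simp: c'_def algebra_simps)
    then show ?thesis using i assms(2) by (simp add: sum.distrib)
  qed
  have "finite (\<Union>y\<in>insert z Z. {t. (\<Sum>j\<in>I. c j * W j y) + t * W i y = 0})"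
    using insert.hyps(1) c i(2) by (auto intro!: finite_linear_zeros)
  then obtain t where "t \<notin> (\<Union>y\<in>insert z Z. {t. (\<Sum>j\<in>I. c j * W j y) + t * W i y = 0})"
    by (rule avoid_finite)
  then have "\<forall>y\<in>insert z Z. (\<Sum>j\<in>I. c' t j * W j y) \<noteq> 0" by (auto simp: e)
  then show ?case by blast
qed simp

text \<open>The nonzero coefficient of degree \<open>e\<close> keeps infinity from being a zero, so
  all \<open>e\<close> zeros are roots of \<open>p\<close> in the affine chart.\<close>

lemma zeros_of_form:
  assumes "degree p \<le> e" "coeff p e \<noteq> 0" "rsquarefree p"
  shows "finite {ppoint x | x. x \<in> hcoords {0, 1} \<and> form e p x = 0} \<and>
    card {ppoint x | x. x \<in> hcoords {0, 1} \<and> form e p x = 0} = e"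
proof -
  have deg: "degree p = e" using assms by (simp add: le_antisym le_degree)
  have eq: "{ppoint x | x. x \<in> hcoords {0, 1} \<and> form e p x = 0} =
      (\<lambda>z. ppoint (affine_pt z)) ` {z. poly p z = 0}" (is "?A = ?B")
  proof
    show "?A \<subseteq> ?B"
    proof
      fix y assume "y \<in> ?A"
      then obtain x where x: "x \<in> hcoords {0, 1}" "form e p x = 0" "y = ppoint x" by blast
      from x(1) show "y \<in> ?B"
      proof (cases rule: P1_cases)
        case 1
        then show ?thesis using x(2) assms(2) by (simp add: form_infinity)
      next
        case 2
        then have "poly p (x 0 / x 1) = 0" using x(2) assms(1) by (simp add: form_affine)
        then show ?thesis using 2(2) x(3) by auto
      qed
    qed
    show "?B \<subseteq> ?A"
    proof safe
      fix z assume "poly p z = 0"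
      then have "form e p (affine_pt z) = 0" using assms(1) by (simp add: form_affine)
      then show "\<exists>x. ppoint (affine_pt z) = ppoint x \<and> x \<in> hcoords {0, 1} \<and> form e p x = 0"
        using affine_pt_hcoords by blast
    qed
  qed
  have "finite {z. poly p z = 0}" using assms(2) by (intro poly_roots_finite) auto
  moreover have "inj_on (\<lambda>z. ppoint (affine_pt z)) {z. poly p z = 0}"
    by (auto simp: inj_on_def affine_pt_inj)
  ultimately show ?thesis
    unfolding eq using complex_card_roots[OF assms(3)] deg by (simp add: card_image)
qed

text \<open>The equation of the hyperplane \<open>c\<close>, pulled back to the projective line
  along the curve.\<close>

definition section_form ::
    "nat \<Rightarrow> (nat \<Rightarrow> (nat \<Rightarrow> complex) \<Rightarrow> complex^'n::{finite,linorder}) \<Rightarrow> ('n set \<Rightarrow> complex) \<Rightarrow> (nat \<Rightarrow> complex) \<Rightarrow> complex" where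
  "section_form l B c x = (\<Sum>S\<in>plucker_index l. c S * wedge_coords l (\<lambda>i. B i x) S)"

lemma finite_plucker_index [simp]: "finite (plucker_index l :: 'n::finite set set)"
  by (rule finite_subset[of _ UNIV]) auto

lemma section_form_form:
  "row_forms l d B \<Longrightarrow> binary_form (\<Sum>i<l. d i) (section_form l B c)"
  unfolding section_form_def by (intro binary_form_sum binary_form_scale wedge_coords_form)

lemma section_form_add: "section_form l B (\<lambda>S. c S + t * c' S) x = section_form l B c x + t * section_form l B c' x"
  by (simp add: section_form_def sum.distrib sum_distrib_left algebra_simps)

lemma plucker_curve:
  assumes "curve_by_rows l d B f" "x \<in> hcoords {0, 1}"
  shows "plucker l (f (ppoint x)) = ppoint (wedge_coords l (\<lambda>i. B i x))"
    "wedge_coords l (\<lambda>i. B i x) \<in> hcoords (plucker_index l)"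
proof -
  have ind: "indep_on {..<l} (\<lambda>i. B i x)" and sp: "f (ppoint x) = vec.span ((\<lambda>i. B i x) ` {..<l})"
    using assms by (auto simp: curve_by_rows_def)
  show "plucker l (f (ppoint x)) = ppoint (wedge_coords l (\<lambda>i. B i x))"
    unfolding sp by (rule plucker_span[OF ind])
  show "wedge_coords l (\<lambda>i. B i x) \<in> hcoords (plucker_index l)"
    by (rule wedge_coords_hcoords[OF ind])
qed

lemma hyperplane_section:
  assumes "curve_by_rows l d B f"
  shows "{z \<in> P1. plucker l (f z) \<in> hyperplane (plucker_index l) c} =
    {ppoint x | x. x \<in> hcoords {0, 1} \<and> section_form l B c x = 0}"
proof -
  have "plucker l (f (ppoint x)) \<in> hyperplane (plucker_index l) c \<longleftrightarrow> section_form l B c x = 0"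
    if "x \<in> hcoords {0, 1}" for x
    using plucker_curve[OF assms that] ppoint_hyperplane by (simp add: section_form_def)
  then show ?thesis by (auto simp: proj_space_def)
qed

lemma poly_fun_sum: "(\<And>i. i \<in> I \<Longrightarrow> poly_fun C (g i)) \<Longrightarrow> poly_fun C (\<lambda>x. \<Sum>i\<in>I. g i x)"
  by (induction I rule: infinite_finite_induct) (auto intro: poly_fun.intros)

lemma poly_fun_prod: "(\<And>i. i \<in> I \<Longrightarrow> poly_fun C (g i)) \<Longrightarrow> poly_fun C (\<lambda>x. \<Prod>i\<in>I. g i x)"
  by (induction I rule: infinite_finite_induct) (auto intro: poly_fun.intros)

lemma section_form_nonzero_ex:
  fixes B :: "nat \<Rightarrow> (nat \<Rightarrow> complex) \<Rightarrow> complex^'n::{finite,linorder}"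
  assumes "curve_by_rows l d B f" "x \<in> hcoords {0, 1}"
  obtains S where "S \<in> plucker_index l" "wedge_coords l (\<lambda>i. B i x) S \<noteq> 0"
  using plucker_curve(2)[OF assms] by (auto simp: hcoords_def)

lemma section_form_axis:
  assumes "S \<in> plucker_index l"
  shows "section_form l B (\<lambda>T. if T = S then 1 else 0) x = wedge_coords l (\<lambda>i. B i x) S"
proof -
  have "section_form l B (\<lambda>T. if T = S then 1 else 0) x =
    (\<Sum>T\<in>plucker_index l. if T = S then wedge_coords l (\<lambda>i. B i x) T else 0)"
    unfolding section_form_def by (intro sum.cong) auto
  then show ?thesis using assms by simp
qed

lemma section_form_0:
  assumes "\<forall>S\<in>plucker_index l. c S = 0"
  shows "section_form l B c x = 0"
  using assms by (simp add: section_form_def)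

text \<open>A form of degree at most 1 that does not vanish at infinity has no multiple root, so the
  hyperplanes missing the point at infinity form a suitable open set. The curves to be constructed
  have degree at most 1; those of higher degree are only excluded.\<close>

lemma has_degree_low:
  fixes f :: "ppt1 \<Rightarrow> (complex^'n::{finite,linorder}) set"
  assumes cr: "curve_by_rows l d B f" and low: "(\<Sum>i<l. d i) \<le> 1"
  shows "has_degree (plucker_index l) (\<lambda>z. plucker l (f z)) (\<Sum>i<l. d i)"
proof -
  let ?C = "{(\<lambda>c. c i) | i. i \<in> plucker_index l} :: (('n set \<Rightarrow> complex) \<Rightarrow> complex) set"
  let ?e = "\<Sum>i<l. d i"
  let ?g = "\<lambda>c. section_form l B c infinity_pt"
  have rows: "row_forms l d B" using cr by (simp add: curve_by_rows_def)
  have "poly_fun ?C ?g"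
    unfolding section_form_def
    by (intro poly_fun_sum poly_fun.mult poly_fun.const poly_fun.coord) auto
  moreover have "\<exists>c. ?g c \<noteq> 0"
    using section_form_nonzero_ex[OF cr infinity_pt_hcoords] section_form_axis by metis
  moreover have "finite {z \<in> P1. plucker l (f z) \<in> hyperplane (plucker_index l) c} \<and>
      card {z \<in> P1. plucker l (f z) \<in> hyperplane (plucker_index l) c} = ?e"
    if c: "?g c \<noteq> 0" for c
  proof -
    obtain p where p: "degree p \<le> ?e" "section_form l B c = form ?e p"
      using section_form_form[OF rows, of c] by (auto simp: binary_form_iff)
    have top: "coeff p ?e \<noteq> 0" using c by (simp add: p(2) form_infinity)
    have "degree p \<le> 1" using p(1) low by linarith
    have "rsquarefree p"
      unfolding rsquarefree_roots
    proof safe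
      fix z assume z: "poly p z = 0" "poly (pderiv p) z = 0"
      have "degree (pderiv p) = 0" using \<open>degree p \<le> 1\<close> by (simp add: degree_pderiv)
      then obtain a where "pderiv p = [:a:]" by (rule degree_eq_zeroE)
      then have "pderiv p = 0" using z(2) by simp
      then have "degree p = 0" by (simp add: pderiv_eq_0_iff)
      then obtain b where "p = [:b:]" by (rule degree_eq_zeroE)
      then have "p = 0" using z(1) by simp
      then show False using top by simp
    qed
    from zeros_of_form[OF p(1) top this] show ?thesis
      unfolding hyperplane_section[OF cr] p(2) .
  qed
  ultimately show ?thesis unfolding has_degree_def general_def by blast
qed

text \<open>One hyperplane in the open set of the definition with exactly \<open>E\<close>
  intersection points is enough. If \<open>c0\<close> misses the point at infinity and
  \<open>c1\<close> avoids the zeros of \<open>c0\<close>, a general member of their pencil has only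
  simple zeros, all of them in the affine chart.\<close>

lemma has_degree_rows:
  fixes f :: "ppt1 \<Rightarrow> (complex^'n::{finite,linorder}) set"
  assumes cr: "curve_by_rows l d B f"
    and deg: "has_degree (plucker_index l) (\<lambda>z. plucker l (f z)) D"
  shows "(\<Sum>i<l. d i) = D"
proof -
  let ?C = "{(\<lambda>c. c i) | i. i \<in> plucker_index l} :: (('n set \<Rightarrow> complex) \<Rightarrow> complex) set"
  let ?Z = "\<lambda>c. {ppoint x | x. x \<in> hcoords {0, 1} \<and> section_form l B c x = 0}"
  define E where "E = (\<Sum>i<l. d i)"
  have rows: "row_forms l d B" using cr by (simp add: curve_by_rows_def)
  obtain g cg where g: "poly_fun ?C g" "g cg \<noteq> 0"
    and gD: "\<And>c. g c \<noteq> 0 \<Longrightarrow> \<exists>i\<in>plucker_index l. c i \<noteq> 0 \<Longrightarrow> card (?Z c) = D"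
    using deg unfolding has_degree_def general_def hyperplane_section[OF cr] by blast
  have line: "\<exists>p. \<forall>t. x (\<lambda>S. c S + t * c' S) = poly p t" if "x \<in> ?C" for x c c'
  proof -
    from that obtain i where "x = (\<lambda>c. c i)" by blast
    then show ?thesis by (intro exI[of _ "[:c i, c' i:]"]) simp
  qed
  have fin: "finite {t. g (\<lambda>S. c S + t * c' S) = 0}" if "g c \<noteq> 0" for c c'
    by (rule poly_path_finite_zeros[OF g(1), where ?t0.0 = 0]) (use line that in auto)
  obtain S1 where S1: "S1 \<in> plucker_index l" "wedge_coords l (\<lambda>i. B i infinity_pt) S1 \<noteq> 0"
    using section_form_nonzero_ex[OF cr infinity_pt_hcoords] .
  let ?ax = "\<lambda>T. if T = S1 then 1 else 0 :: complex"
  \<comment> \<open>Moving \<open>cg\<close> in the direction of a coordinate that is nonzero at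
    infinity yields \<open>c0\<close>, still in the open set.\<close>
  have "finite ({t. g (\<lambda>S. cg S + t * ?ax S) = 0} \<union>
     {t. section_form l B cg infinity_pt + t * section_form l B ?ax infinity_pt = 0})"
    using S1 by (intro finite_UnI fin g(2) finite_linear_zeros) (auto simp: section_form_axis)
  then obtain t0 where "t0 \<notin> {t. g (\<lambda>S. cg S + t * ?ax S) = 0} \<union>
     {t. section_form l B cg infinity_pt + t * section_form l B ?ax infinity_pt = 0}"
    by (rule avoid_finite)
  then obtain c0 where c0: "g c0 \<noteq> 0" "section_form l B c0 infinity_pt \<noteq> 0"
    by (auto simp flip: section_form_add)
  obtain p0 where p0: "degree p0 \<le> E" "section_form l B c0 = form E p0"
    using section_form_form[OF rows, of c0] by (auto simp: binary_form_iff E_def)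
  have top0: "coeff p0 E \<noteq> 0" using c0(2) by (simp add: p0(2) form_infinity)
  then have deg0: "degree p0 = E" "p0 \<noteq> 0" using p0(1) by (auto intro: le_antisym le_degree)
  show ?thesis
  proof (cases "E = 0")
    case True
    \<comment> \<open>A nonzero constant has no roots; the pencil argument below starts from a root
      of \<open>p0\<close>.\<close>
    have "rsquarefree p0" unfolding rsquarefree_roots
    proof safe
      fix z assume "poly p0 z = 0"
      then show False using deg0 True by (auto elim: degree_eq_zeroE)
    qed
    with zeros_of_form[OF p0(1) top0] have "card (?Z c0) = E" by (simp add: p0(2))
    moreover have "\<exists>i\<in>plucker_index l. c0 i \<noteq> 0" using c0(2) section_form_0 by blast
    ultimately show ?thesis using gD[OF c0(1)] by (simp add: E_def)
  next
    case False
    have "\<exists>c. \<forall>z\<in>{z. poly p0 z = 0}. (\<Sum>S\<in>plucker_index l. c S * wedge_coords l (\<lambda>i. B i (affine_pt z)) S) \<noteq> 0"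
    proof (rule avoid_hyperplanes)
      show "finite {z. poly p0 z = 0}" using deg0 by (intro poly_roots_finite)
      show "\<exists>S\<in>plucker_index l. wedge_coords l (\<lambda>i. B i (affine_pt z)) S \<noteq> 0" for z
        using section_form_nonzero_ex[OF cr affine_pt_hcoords, of z] by blast
    qed simp
    then obtain c1 where c1: "\<And>z. poly p0 z = 0 \<Longrightarrow> section_form l B c1 (affine_pt z) \<noteq> 0"
      by (auto simp: section_form_def)
    obtain p1 where p1: "degree p1 \<le> E" "section_form l B c1 = form E p1"
      using section_form_form[OF rows, of c1] by (auto simp: binary_form_iff E_def)
    have nc: "poly p1 z \<noteq> 0" if "poly p0 z = 0" for z
      using c1[OF that] p1 by (simp add: form_affine)
    have "degree p0 \<noteq> 0" using False deg0 by simp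
    then have "finite ({t. \<not> rsquarefree (p0 + Polynomial.smult t p1)} \<union>
        {t. g (\<lambda>S. c0 S + t * c1 S) = 0} \<union> {t. coeff p0 E + t * coeff p1 E = 0})"
      using pencil_finite_bad[OF nc] top0 c0(1) by (intro finite_UnI fin finite_linear_zeros) auto
    then obtain t where "t \<notin> {t. \<not> rsquarefree (p0 + Polynomial.smult t p1)} \<union>
        {t. g (\<lambda>S. c0 S + t * c1 S) = 0} \<union> {t. coeff p0 E + t * coeff p1 E = 0}"
      by (rule avoid_finite)
    then have t: "rsquarefree (p0 + Polynomial.smult t p1)" "g (\<lambda>S. c0 S + t * c1 S) \<noteq> 0"
      "coeff (p0 + Polynomial.smult t p1) E \<noteq> 0" by auto
    let ?c = "\<lambda>S. c0 S + t * c1 S"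
    have dP: "degree (p0 + Polynomial.smult t p1) \<le> E"
      using p0(1) p1(1) by (intro degree_add_le) (auto intro: order.trans[OF degree_smult_le])
    have "section_form l B ?c = form E (p0 + Polynomial.smult t p1)"
      by (simp add: fun_eq_iff section_form_add p0(2) p1(2) form_def sum.distrib
          sum_distrib_left algebra_simps)
    then have cZ: "card (?Z ?c) = E" and "section_form l B ?c infinity_pt \<noteq> 0"
      using zeros_of_form[OF dP t(3,1)] t(3) by (simp_all add: form_infinity)
    then have "\<exists>i\<in>plucker_index l. ?c i \<noteq> 0" using section_form_0[of l ?c] by blast
    then show ?thesis using gD[OF t(2)] cZ by (simp add: E_def)
  qed
qed

lemma regular_curve_by_rows:
  fixes f :: "ppt1 \<Rightarrow> (complex^'n::{finite,linorder}) set"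
  assumes cr: "curve_by_rows l d B f"
  shows "regular_P1 (plucker_index l) (\<lambda>z. plucker l (f z))"
  unfolding regular_P1_def
proof (intro conjI ballI)
  fix z assume "z \<in> P1"
  then obtain x where "x \<in> hcoords {0, 1}" "z = ppoint x" by (rule P1_E)
  then show "plucker l (f z) \<in> proj_space (plucker_index l)"
    using plucker_curve[OF cr, of x] by (simp add: proj_space_def)
next
  fix x :: "nat \<Rightarrow> complex" assume x: "x \<in> hcoords {0, 1}"
  have rows: "row_forms l d B" using cr by (simp add: curve_by_rows_def)
  let ?h = "\<lambda>S x. wedge_coords l (\<lambda>i. B i x) S"
  have "(\<lambda>S. if S \<in> plucker_index l then ?h S y else 0) = wedge_coords l (\<lambda>i. B i y)" for y
    by (auto simp: wedge_coords_outside)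
  moreover have "\<exists>S\<in>plucker_index l. ?h S x \<noteq> 0"
    using section_form_nonzero_ex[OF cr x] by blast
  ultimately show "\<exists>e h. (\<forall>S\<in>plucker_index l. binary_form e (h S)) \<and> (\<exists>S\<in>plucker_index l. h S x \<noteq> 0) \<and>
        (\<forall>y\<in>hcoords {0, 1}. (\<exists>S\<in>plucker_index l. h S y \<noteq> 0) \<longrightarrow>
            plucker l (f (ppoint y)) = ppoint (\<lambda>S. if S \<in> plucker_index l then h S y else 0))"
    using wedge_coords_form[OF rows] plucker_curve(1)[OF cr]
    by (intro exI[of _ "\<Sum>i<l. d i"] exI[of _ ?h] conjI ballI impI) auto
qed

lemma rational_curveE:
  fixes f :: "ppt1 \<Rightarrow> (complex^'n::{finite,linorder}) set"
  assumes "rational_curve l D f"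
  obtains d B where "curve_by_rows l d B f" "(\<Sum>i<l. d i) = D"
proof -
  have f: "\<And>z. z \<in> P1 \<Longrightarrow> f z \<in> Gr l" "regular_P1 (plucker_index l) (\<lambda>z. plucker l (f z))"
    "has_degree (plucker_index l) (\<lambda>z. plucker l (f z)) D"
    using assms by (auto simp: rational_curve_def)
  obtain d B where "curve_by_rows l d B f" using curve_rows_exist[OF f(1,2)] by blast
  then show ?thesis using that has_degree_rows[OF _ f(3)] by blast
qed

lemma rational_curve_low:
  fixes f :: "ppt1 \<Rightarrow> (complex^'n::{finite,linorder}) set"
  assumes "curve_by_rows l d B f" "f \<in> extensional P1" "(\<Sum>i<l. d i) \<le> 1"
  shows "rational_curve l (\<Sum>i<l. d i) f"
proof -
  have "f z \<in> Gr l" if "z \<in> P1" for z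
  proof -
    obtain x where x: "x \<in> hcoords {0, 1}" "z = ppoint x" using \<open>z \<in> P1\<close> by (rule P1_E)
    then have ind: "indep_on {..<l} (\<lambda>i. B i x)" and "f z = vec.span ((\<lambda>i. B i x) ` {..<l})"
      using assms(1) by (auto simp: curve_by_rows_def)
    then show ?thesis using Gr_span[OF ind] by simp
  qed
  then show ?thesis
    using assms regular_curve_by_rows has_degree_low by (auto simp: rational_curve_def PiE_def)
qed

section \<open>Subspaces meeting two opposite flags\<close>

locale vector_basis =
  fixes e :: "nat \<Rightarrow> complex^'n::{finite,linorder}"
  assumes basis: "indep_on {..<CARD('n)} e"
begin

text \<open>Only the values below \<open>CARD('n)\<close> are determined, whence the bounds in the
  following lemmas.\<close>

definition coord :: "complex^'n::{finite,linorder} \<Rightarrow> nat \<Rightarrow> complex" where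
  "coord x = (SOME \<xi>. x = (\<Sum>c<CARD('n). \<xi> c *s e c))"

lemma coord_sum: "(\<Sum>c<CARD('n). coord x c *s e c) = x"
proof -
  have "x \<in> vec.span (e ` {..<CARD('n)})" using span_indep_on_full[OF basis] by simp
  then have "\<exists>\<xi>. x = (\<Sum>c<CARD('n). \<xi> c *s e c)" by (auto elim!: in_span_imageE)
  then have "x = (\<Sum>c<CARD('n). coord x c *s e c)" unfolding coord_def by (rule someI_ex)
  then show ?thesis by simp
qed

lemma coord_unique: "x = (\<Sum>c<CARD('n). \<xi> c *s e c) \<Longrightarrow> c < CARD('n) \<Longrightarrow> coord x c = \<xi> c"
  using indep_on_coeff_eq[OF basis, of "coord x" \<xi> c] coord_sum[of x] by simp

lemma coord_eqI:
  assumes "\<And>c. c < CARD('n) \<Longrightarrow> coord x c = coord y c"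
  shows "x = y"
proof -
  have "(\<Sum>c<CARD('n). coord x c *s e c) = (\<Sum>c<CARD('n). coord y c *s e c)"
    by (intro sum.cong refl) (simp only: lessThan_iff assms)
  then show ?thesis by (simp only: coord_sum)
qed

lemma coord_zero: "c < CARD('n) \<Longrightarrow> coord 0 c = 0"
proof (rule coord_unique[where \<xi> = "\<lambda>_. 0"])
  show "0 = (\<Sum>c<CARD('n). 0 *s e c)" by (simp only: vec.scale_zero_left sum.neutral_const)
qed

lemma coord_add: "c < CARD('n) \<Longrightarrow> coord (x + y) c = coord x c + coord y c"
proof (rule coord_unique[where \<xi> = "\<lambda>c. coord x c + coord y c"])
  show "x + y = (\<Sum>c<CARD('n). (coord x c + coord y c) *s e c)"
    by (simp only: coord_sum vec.scale_left_distrib sum.distrib)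
qed

lemma coord_scale: "c < CARD('n) \<Longrightarrow> coord (a *s x) c = a * coord x c"
proof (rule coord_unique[where \<xi> = "\<lambda>c. a * coord x c"])
  have "(\<Sum>c<CARD('n). (a * coord x c) *s e c) = a *s (\<Sum>c<CARD('n). coord x c *s e c)"
    by (simp only: vec.scale_sum_right vec.scale_scale)
  then show "a *s x = (\<Sum>c<CARD('n). (a * coord x c) *s e c)" by (simp only: coord_sum)
qed

lemma coord_setsum: "c < CARD('n) \<Longrightarrow> coord (\<Sum>i\<in>A. f i) c = (\<Sum>i\<in>A. coord (f i) c)"
  by (induction A rule: infinite_finite_induct) (auto simp: coord_zero coord_add)

definition E :: "nat set \<Rightarrow> (complex^'n::{finite,linorder}) set" where
  "E I = vec.span (e ` I)"

lemma subspace_E: "vec.subspace (E I)" by (simp add: E_def)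

lemma E_mono: "I \<subseteq> J \<Longrightarrow> E I \<subseteq> E J" unfolding E_def by (intro vec.span_mono image_mono)

lemma in_E_iff: "I \<subseteq> {..<CARD('n)} \<Longrightarrow> x \<in> E I \<longleftrightarrow> (\<forall>c<CARD('n). c \<notin> I \<longrightarrow> coord x c = 0)"
  using span_image_coeff[OF _ basis, of I "coord x"] by (auto simp: E_def coord_sum)

lemma E_Int: "I \<subseteq> {..<CARD('n)} \<Longrightarrow> J \<subseteq> {..<CARD('n)} \<Longrightarrow> E I \<inter> E J = E (I \<inter> J)"
  unfolding E_def using span_image_Int[OF _ basis] by simp

lemma dim_E: "I \<subseteq> {..<CARD('n)} \<Longrightarrow> vec.dim (E I) = card I"
  unfolding E_def using indep_on_subset[OF _ basis] dim_span_indep_on finite_subset by blast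

lemma E_empty: "E {} = {0}" by (simp add: E_def)

definition part_of :: "nat set \<Rightarrow> complex^'n::{finite,linorder} \<Rightarrow> complex^'n::{finite,linorder}" where
  "part_of J x = (\<Sum>c\<in>J. coord x c *s e c)"

lemma coord_part_of:
  assumes "J \<subseteq> {..<CARD('n)}" "c < CARD('n)"
  shows "coord (part_of J x) c = (if c \<in> J then coord x c else 0)"
  using assms sum_if_mem[of "{..<CARD('n)}" J "coord x" e]
  by (intro coord_unique[where \<xi> = "\<lambda>c. if c \<in> J then coord x c else 0"]) (simp_all add: part_of_def)

lemma part_of_in_E: "J \<subseteq> {..<CARD('n)} \<Longrightarrow> part_of J x \<in> E J"
  by (simp add: in_E_iff coord_part_of)

lemma nonzero_coord:
  assumes "J \<subseteq> {..<CARD('n)}" "x \<in> E J" "x \<noteq> 0"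
  obtains c where "c \<in> J" "coord x c \<noteq> 0"
proof -
  have "\<exists>c<CARD('n). coord x c \<noteq> 0" using assms(3) coord_eqI[of x 0] coord_zero by auto
  then show ?thesis using that assms(1,2) in_E_iff by blast
qed

text \<open>Each vector has a nonzero coordinate in its own block, where all the others
  vanish.\<close>

lemma indep_blocks:
  assumes J: "\<And>i. i \<in> A \<Longrightarrow> J i \<subseteq> {..<CARD('n)}"
    and dj: "\<And>i j. i \<in> A \<Longrightarrow> j \<in> A \<Longrightarrow> i \<noteq> j \<Longrightarrow> J i \<inter> J j = {}"
    and u: "\<And>i. i \<in> A \<Longrightarrow> u i \<in> E (J i)" "\<And>i. i \<in> A \<Longrightarrow> u i \<noteq> 0"
    and A: "finite A"
  shows "indep_on A u"
  unfolding indep_on_def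
proof (intro allI impI ballI)
  fix a i assume a: "(\<Sum>i\<in>A. a i *s u i) = 0" and i: "i \<in> A"
  obtain c where c: "c \<in> J i" "coord (u i) c \<noteq> 0" using nonzero_coord[OF J u] i by blast
  then have cn: "c < CARD('n)" using J[OF i] by blast
  have "coord (u j) c = 0" if "j \<in> A" "j \<noteq> i" for j
    using u(1)[OF that(1)] in_E_iff[OF J[OF that(1)]] dj[OF that(1) i that(2)] c(1) cn by blast
  then have "(\<Sum>j\<in>A. a j * coord (u j) c) = (\<Sum>j\<in>A. if j = i then a i * coord (u i) c else 0)"
    by (intro sum.cong) auto
  also have "\<dots> = a i * coord (u i) c" using i A by simp
  finally have "coord (\<Sum>i\<in>A. a i *s u i) c = a i * coord (u i) c"
    using cn by (simp add: coord_setsum coord_scale)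
  then show "a i = 0" using a cn c(2) by (simp add: coord_zero)
qed

(* If c lies in no interval, V is the sum of a part in which the c-th coordinate vanishes because
   it lies in G and one in which it vanishes because it lies in H. *)
lemma subspace_in_intervals:
  assumes V: "vec.subspace V" "vec.dim V = m"
    and ab: "\<And>i. i \<in> {1..m} \<Longrightarrow> \<alpha> i \<le> CARD('n)" "\<And>i. i \<in> {1..m} \<Longrightarrow> a i \<le> CARD('n)"
    and dG: "\<And>i. i \<in> {1..m} \<Longrightarrow> vec.dim (V \<inter> E {..<\<alpha> i}) \<ge> i"
    and dH: "\<And>i. i \<in> {1..m} \<Longrightarrow> vec.dim (V \<inter> E {a i..<CARD('n)}) \<ge> m + 1 - i"
  shows "V \<subseteq> E (\<Union>i\<in>{1..m}. {a i..<\<alpha> i})"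
proof -
  let ?I = "\<Union>i\<in>{1..m}. {a i..<\<alpha> i}"
  have IN: "?I \<subseteq> {..<CARD('n)}" using ab(1) by (meson UN_least atLeastLessThan_iff lessThan_iff order_less_le_trans subsetI)
  have full: "W = V" if "vec.subspace W" "W \<subseteq> V" "vec.dim W \<ge> m" for W
    using vec.subspace_dim_equal[OF that(1) V(1) that(2)] V(2) that(3) by simp
  have "coord x c = 0" if x: "x \<in> V" and c: "c < CARD('n)" "c \<notin> ?I" for x c
  proof (cases "\<exists>i\<in>{1..m}. c < \<alpha> i")
    case False
    show ?thesis
    proof (cases "m = 0")
      case True
      then have "x = 0" using x V by (simp add: vec.dim_eq_0) blast
      then show ?thesis using c(1) by (simp add: coord_zero)
    next
      case m: False
      \<comment> \<open>The last condition has the dimension of \<open>V\<close>, so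
        \<open>V\<close> lies entirely below \<open>\<alpha> m\<close>.\<close>
      then have "V \<inter> E {..<\<alpha> m} = V"
        using dG[of m] by (intro full) (auto intro: vec.subspace_inter V(1) subspace_E)
      then have "x \<in> E {..<\<alpha> m}" using x by blast
      moreover have "\<not> c < \<alpha> m" using False m by auto
      ultimately show ?thesis using in_E_iff[of "{..<\<alpha> m}" x] ab(1)[of m] m c(1) by auto
    qed
  next
    case True
    \<comment> \<open>By minimality \<open>c\<close> is at least \<open>\<alpha> (i - 1)\<close>; as
      it lies in no interval, it is also below \<open>a i\<close>.\<close>
    define i where "i = (LEAST i. i \<in> {1..m} \<and> c < \<alpha> i)"
    have i: "i \<in> {1..m}" "c < \<alpha> i"
      using LeastI_ex[of "\<lambda>i. i \<in> {1..m} \<and> c < \<alpha> i"] True unfolding i_def by blast+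
    have prev: "\<not> c < \<alpha> (i - 1)" if "i \<noteq> 1"
      using not_less_Least[of "i - 1" "\<lambda>i. i \<in> {1..m} \<and> c < \<alpha> i"] i that unfolding i_def[symmetric] by auto
    have ca: "c < a i" using c(2) i by (meson UN_I atLeastLessThan_iff not_le_imp_less)
    \<comment> \<open>The dimensions \<open>i - 1\<close> and \<open>m + 1 - i\<close> add up to
      \<open>m\<close>, and the two subspaces meet in 0, so their sum is \<open>V\<close>. For
      \<open>i = 1\<close> there is no earlier condition and the first summand is 0.\<close>
    let ?A = "if i = 1 then {0} else V \<inter> E {..<\<alpha> (i - 1)}" and ?B = "V \<inter> E {a i..<CARD('n)}"
    have sA: "vec.subspace ?A" and sB: "vec.subspace ?B"
      using V(1) subspace_E vec.subspace_inter by (auto simp: vec.subspace_0 vec.subspace_single_0)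
    have dA: "vec.dim ?A \<ge> i - 1"
    proof (cases "i = 1")
      case False
      then have "i - 1 \<in> {1..m}" using i by auto
      from dG[OF this] False show ?thesis by simp
    qed simp
    have "?A \<inter> ?B \<subseteq> {0}"
    proof (cases "i = 1")
      case False
      have "i - 1 \<in> {1..m}" using i False by auto
      from ab(1)[OF this] have "\<alpha> (i - 1) \<le> CARD('n)" .
      then have "E {..<\<alpha> (i - 1)} \<inter> E {a i..<CARD('n)} = E ({..<\<alpha> (i - 1)} \<inter> {a i..<CARD('n)})"
        by (intro E_Int) auto
      also have "{..<\<alpha> (i - 1)} \<inter> {a i..<CARD('n)} = {}" using prev[OF False] ca by auto
      finally show ?thesis using False by (auto simp: E_empty)
    qed auto
    then have "vec.dim (?A \<inter> ?B) = 0" by (simp add: vec.dim_eq_0)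
    moreover have "1 \<le> i" "i \<le> m" using i(1) by auto
    ultimately have "vec.dim {x + y |x y. x \<in> ?A \<and> y \<in> ?B} \<ge> m"
      using vec.dim_sums_Int[OF sA sB] dA dH[OF i(1)] by linarith
    moreover have "{x + y |x y. x \<in> ?A \<and> y \<in> ?B} \<subseteq> V"
      using V(1) by (auto intro: vec.subspace_add vec.subspace_0 split: if_splits)
    ultimately have "{x + y |x y. x \<in> ?A \<and> y \<in> ?B} = V"
      using full vec.subspace_sums[OF sA sB] by blast
    then obtain y z where yz: "x = y + z" "y \<in> ?A" "z \<in> ?B" using x by blast
    have "coord y c = 0"
    proof (cases "i = 1")
      case True
      then show ?thesis using yz(2) c(1) by (simp add: coord_zero)
    next
      case False
      then have "i - 1 \<in> {1..m}" using i by auto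
      from ab(1)[OF this] have "\<alpha> (i - 1) \<le> CARD('n)" .
      then show ?thesis using yz(2) prev[OF False] c(1) False in_E_iff[of "{..<\<alpha> (i - 1)}" y] by auto
    qed
    moreover have "coord z c = 0"
      using yz(3) ca c(1) in_E_iff[of "{a i..<CARD('n)}" z] by (auto simp: subset_eq)
    ultimately show ?thesis using yz(1) c(1) by (simp add: coord_add)
  qed
  then show ?thesis using in_E_iff[OF IN] by blast
qed

text \<open>Inside \<open>V\<close> the two intersections have dimensions at least \<open>i\<close>
  and \<open>m + 1 - i\<close>, one more than complementary.\<close>

lemma subspace_meets_interval:
  assumes V: "vec.subspace V" "vec.dim V = m" and i: "i \<in> {1..m}"
    and "\<alpha> \<le> CARD('n)"
    and dG: "vec.dim (V \<inter> E {..<\<alpha>}) \<ge> i"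
    and dH: "vec.dim (V \<inter> E {a..<CARD('n)}) \<ge> m + 1 - i"
  obtains x where "x \<in> V" "x \<in> E {a..<\<alpha>}" "x \<noteq> 0"
proof -
  have "vec.dim (V \<inter> E {..<\<alpha>}) + vec.dim (V \<inter> E {a..<CARD('n)}) \<le>
      vec.dim ((V \<inter> E {..<\<alpha>}) \<inter> (V \<inter> E {a..<CARD('n)})) + vec.dim V"
    by (rule dim_Int_ge) (use V subspace_E vec.subspace_inter in auto)
  then have "vec.dim ((V \<inter> E {..<\<alpha>}) \<inter> (V \<inter> E {a..<CARD('n)})) \<ge> 1"
    using dG dH V i by auto
  then obtain x where x: "x \<in> (V \<inter> E {..<\<alpha>}) \<inter> (V \<inter> E {a..<CARD('n)})" "x \<noteq> 0"
    by (rule dim_pos_obtains)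
  moreover have "E {..<\<alpha>} \<inter> E {a..<CARD('n)} = E ({..<\<alpha>} \<inter> {a..<CARD('n)})"
    using assms(4) by (intro E_Int) auto
  moreover have "{..<\<alpha>} \<inter> {a..<CARD('n)} = {a..<\<alpha>}" using assms(4) by auto
  ultimately show ?thesis using that by auto
qed

end

text \<open>With \<open>n = CARD('n)\<close>, the vector \<open>e c\<close> generates the line
  \<open>G (c + 1) \<inter> H (n - c)\<close>. \<open>F\<close> has to be transversal only to the
  finitely many coordinate subspaces.\<close>

locale transversal_flags = vector_basis e for e :: "nat \<Rightarrow> complex^'n::{finite,linorder}" +
  fixes F G H :: "nat \<Rightarrow> (complex^'n::{finite,linorder}) set"
  assumes F_flag: "complete_flag F"
    and G_eq: "i \<le> CARD('n) \<Longrightarrow> G i = E {..<i}"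
    and H_eq: "i \<le> CARD('n) \<Longrightarrow> H i = E {CARD('n) - i..<CARD('n)}"
    and F_transversal: "I \<subseteq> {..<CARD('n)} \<Longrightarrow> F (CARD('n) - card I) \<inter> E I = {0}"
begin

lemma F_subspace: "i \<le> CARD('n) \<Longrightarrow> vec.subspace (F i)"
  and F_dim: "i \<le> CARD('n) \<Longrightarrow> vec.dim (F i) = i"
  using F_flag by (auto simp: complete_flag_def)

lemma F_mono: "i \<le> j \<Longrightarrow> j \<le> CARD('n) \<Longrightarrow> F i \<subseteq> F j"
proof (induction j rule: dec_induct)
  case (step j)
  then have "F j \<subseteq> F (Suc j)" using F_flag unfolding complete_flag_def by (meson Suc_le_lessD)
  moreover have "F i \<subseteq> F j" using step by simp
  ultimately show ?case by blast
qed simp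

lemma F_Int_E_trivial:
  assumes "I \<subseteq> {..<CARD('n)}" "r + card I \<le> CARD('n)" "x \<in> F r" "x \<in> E I"
  shows "x = 0"
proof -
  have "F r \<subseteq> F (CARD('n) - card I)" using assms(2) by (intro F_mono) auto
  then show ?thesis using F_transversal[OF assms(1)] assms(3,4) by blast
qed

text \<open>The \<open>u i\<close> are the components of a generator \<open>w\<close> of the line in
  which \<open>F r\<close> meets \<open>E\<close> of the union. Any other such \<open>V\<close> is
  spanned by vectors \<open>x i\<close> of the blocks, and its vector in \<open>F r\<close> is a
  multiple of \<open>w\<close>; comparing components makes each \<open>u i\<close> a multiple of
  \<open>x i\<close>.\<close>

lemma blocks_subspace_exists:
  fixes J :: "nat \<Rightarrow> nat set"
  assumes J: "\<And>i. i \<in> A \<Longrightarrow> J i \<subseteq> {..<CARD('n)}" "\<And>i. i \<in> A \<Longrightarrow> J i \<noteq> {}"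
    and dj: "\<And>i j. i \<in> A \<Longrightarrow> j \<in> A \<Longrightarrow> i \<noteq> j \<Longrightarrow> J i \<inter> J j = {}"
    and A: "finite A" and r: "r \<le> CARD('n)" and cd: "r + card (\<Union>i\<in>A. J i) = CARD('n) + 1"
  obtains u where "\<And>i. i \<in> A \<Longrightarrow> u i \<in> E (J i)" "indep_on A u" "(\<Sum>i\<in>A. u i) \<in> F r"
    "\<And>V. vec.subspace V \<Longrightarrow> vec.dim V = card A \<Longrightarrow> (\<And>i. i \<in> A \<Longrightarrow> \<exists>x\<in>V. x \<in> E (J i) \<and> x \<noteq> 0) \<Longrightarrow>
        (\<exists>x\<in>V. x \<in> F r \<and> x \<noteq> 0) \<Longrightarrow> V = vec.span (u ` A)"
proof -
  let ?I = "\<Union>i\<in>A. J i"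
  have IN: "?I \<subseteq> {..<CARD('n)}" using J(1) by blast
  then have fI: "finite ?I" using finite_subset by blast
  have "vec.dim (F r) + vec.dim (E ?I) \<le> vec.dim (F r \<inter> E ?I) + vec.dim (UNIV :: (complex^'n::{finite,linorder}) set)"
    using r by (intro dim_Int_ge) (auto intro: F_subspace subspace_E)
  then have "vec.dim (F r \<inter> E ?I) \<ge> 1"
    using cd unfolding F_dim[OF r] dim_E[OF IN] vec_dim_card by linarith
  then obtain w where w: "w \<in> F r" "w \<in> E ?I" "w \<noteq> 0" using dim_pos_obtains by blast
  \<comment> \<open>Omitting one index makes the dimensions complementary, so transversality leaves
    only 0. Hence no coordinate of \<open>w\<close> on the union vanishes.\<close>
  have small: "x = 0" if "x \<in> F r" "x \<in> E ?I" "c \<in> ?I" "coord x c = 0" for x c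
  proof (rule F_Int_E_trivial[where r = r and I = "?I - {c}"])
    show sub: "?I - {c} \<subseteq> {..<CARD('n)}" using IN by blast
    show "x \<in> E (?I - {c})" unfolding in_E_iff[OF sub] using that(2,4) unfolding in_E_iff[OF IN] by blast
    have "card (?I - {c}) = card ?I - 1" using that(3) by (rule card_Diff_singleton)
    then show "r + card (?I - {c}) \<le> CARD('n)" using cd r by linarith
  qed (rule that(1))
  have wnz: "coord w c \<noteq> 0" if "c \<in> ?I" for c using small[OF w(1,2) that] w(3) by blast
  define u where "u i = part_of (J i) w" for i
  have uE: "u i \<in> E (J i)" if "i \<in> A" for i using J(1)[OF that] by (simp add: u_def part_of_in_E)
  have cu: "coord (u i) c = (if c \<in> J i then coord w c else 0)" if "i \<in> A" "c < CARD('n)" for i c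
    using J(1)[OF that(1)] that(2) by (simp add: u_def coord_part_of)
  have unz: "u i \<noteq> 0" if i: "i \<in> A" for i
  proof
    assume u0: "u i = 0"
    obtain c where c: "c \<in> J i" using J(2)[OF i] by blast
    then have cn: "c < CARD('n)" using J(1)[OF i] by blast
    have "coord (u i) c = coord w c" using cu[OF i cn] c by simp
    moreover have "c \<in> ?I" using c i by blast
    ultimately show False using wnz[of c] u0 coord_zero[OF cn] by simp
  qed
  have ind: "indep_on A u" by (rule indep_blocks[OF J(1) dj uE unz A])
  have sw: "(\<Sum>i\<in>A. u i) = w"
  proof (rule coord_eqI)
    fix c assume c: "c < CARD('n)"
    have e: "coord (\<Sum>i\<in>A. u i) c = (\<Sum>i\<in>A. if c \<in> J i then coord w c else 0)"
      using c by (simp add: coord_setsum cu)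
    show "coord (\<Sum>i\<in>A. u i) c = coord w c"
    proof (cases "c \<in> ?I")
      case True
      then obtain i where i: "i \<in> A" "c \<in> J i" by blast
      have "(\<Sum>j\<in>A. if c \<in> J j then coord w c else 0) = (\<Sum>j\<in>A. if j = i then coord w c else 0)"
        using i dj by (intro sum.cong) auto
      then show ?thesis using e i A by simp
    next
      case False
      then show ?thesis using e in_E_iff[OF IN, of w] w(2) c by simp
    qed
  qed
  have uniq: "V = vec.span (u ` A)"
    if V: "vec.subspace V" "vec.dim V = card A" and Vi: "\<And>i. i \<in> A \<Longrightarrow> \<exists>x\<in>V. x \<in> E (J i) \<and> x \<noteq> 0"
      and VF: "\<exists>x\<in>V. x \<in> F r \<and> x \<noteq> 0" for V
  proof -
    have "\<forall>i\<in>A. \<exists>x. x \<in> V \<and> x \<in> E (J i) \<and> x \<noteq> 0" using Vi by blast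
    from bchoice[OF this] obtain x where "\<forall>i\<in>A. x i \<in> V \<and> x i \<in> E (J i) \<and> x i \<noteq> 0" ..
    then have x: "x i \<in> V" "x i \<in> E (J i)" "x i \<noteq> 0" if "i \<in> A" for i using that by blast+
    have indx: "indep_on A x" by (rule indep_blocks[OF J(1) dj x(2,3) A])
    have "vec.span (x ` A) \<subseteq> V" using V(1) x(1) by (intro vec.span_minimal) auto
    then have spx: "vec.span (x ` A) = V"
      using vec.subspace_dim_equal[of "vec.span (x ` A)" V] V dim_span_indep_on[OF A indx] by simp
    obtain y where y: "y \<in> V" "y \<in> F r" "y \<noteq> 0" using VF by blast
    obtain \<gamma> where g: "y = (\<Sum>i\<in>A. \<gamma> i *s x i)"
      using y(1) unfolding spx[symmetric] by (rule in_span_imageE) (rule A)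
    have cx: "coord (x i) c = 0" if "i \<in> A" "c < CARD('n)" "c \<notin> J i" for i c
      using x(2)[OF that(1)] in_E_iff[OF J(1)[OF that(1)]] that by blast
    have cy: "coord y c = \<gamma> i * coord (x i) c" if i: "i \<in> A" "c \<in> J i" "c < CARD('n)" for i c
    proof -
      have "coord y c = (\<Sum>j\<in>A. \<gamma> j * coord (x j) c)"
        using i by (simp add: g coord_setsum coord_scale)
      also have "\<dots> = (\<Sum>j\<in>A. if j = i then \<gamma> i * coord (x i) c else 0)"
      proof (intro sum.cong refl)
        fix j assume j: "j \<in> A"
        show "\<gamma> j * coord (x j) c = (if j = i then \<gamma> i * coord (x i) c else 0)"
        proof (cases "j = i")
          case False
          then have "c \<notin> J j" using dj[OF j i(1)] i(2) by blast
          then show ?thesis using cx[OF j i(3)] False by simp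
        qed simp
      qed
      finally show ?thesis using i A by simp
    qed
    have xI: "x i \<in> E ?I" if i: "i \<in> A" for i
    proof -
      have "E (J i) \<subseteq> E ?I" using i by (intro E_mono) blast
      then show ?thesis using x(2)[OF i] by blast
    qed
    have yI: "y \<in> E ?I" unfolding g
      by (rule vec.subspace_sum[OF subspace_E], rule vec.subspace_scale[OF subspace_E], rule xI)
    have "?I \<noteq> {}" using cd r by (intro notI) simp
    then obtain c0 where c0: "c0 \<in> ?I" by blast
    \<comment> \<open>Chosen so that \<open>y\<close> minus \<open>t\<close> times \<open>w\<close>
      has coordinate 0 at \<open>c0\<close>; by \<open>small\<close> this difference
      vanishes.\<close>
    define t where "t = coord y c0 / coord w c0"
    have c0n: "c0 < CARD('n)" using c0 IN by blast
    have "y + (- t) *s w = 0"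
    proof (rule small[OF _ _ c0])
      show "y + (- t) *s w \<in> F r"
        by (rule vec.subspace_add[OF F_subspace[OF r] y(2) vec.subspace_scale[OF F_subspace[OF r] w(1)]])
      show "y + (- t) *s w \<in> E ?I"
        by (rule vec.subspace_add[OF subspace_E yI vec.subspace_scale[OF subspace_E w(2)]])
      show "coord (y + (- t) *s w) c0 = 0"
        using c0n wnz[OF c0] by (simp only: coord_add coord_scale) (simp add: t_def)
    qed
    then have yt: "y = t *s w" by (simp add: add_eq_0_iff)
    then have t0: "t \<noteq> 0" using y(3) by (auto simp: vec.scale_zero_left)
    have "u i = (\<gamma> i / t) *s x i" if i: "i \<in> A" for i
    proof (rule coord_eqI)
      fix c assume c: "c < CARD('n)"
      show "coord (u i) c = coord ((\<gamma> i / t) *s x i) c"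
      proof (cases "c \<in> J i")
        case True
        have "t * coord w c = \<gamma> i * coord (x i) c"
          using cy[OF i True c] yt c by (simp add: coord_scale)
        then show ?thesis using True t0 c i by (simp add: cu coord_scale field_simps)
      next
        case False
        then show ?thesis using c i cx by (simp add: cu coord_scale)
      qed
    qed
    then have "u i \<in> V" if "i \<in> A" for i
      using that vec.subspace_scale[OF V(1) x(1)[OF that]] by simp
    then have "vec.span (u ` A) \<subseteq> V"
      using V(1) by (intro vec.span_minimal) auto
    then show ?thesis
      using vec.subspace_dim_equal[of "vec.span (u ` A)" V] V dim_span_indep_on[OF A ind] by simp
  qed
  have "(\<Sum>i\<in>A. u i) \<in> F r" unfolding sw by (rule w(1))
  from that[OF uE ind this uniq] show ?thesis .
qed

end

section \<open>General triples of flags are transversal\<close>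

lemma indep_on_reindex:
  fixes e :: "'j \<Rightarrow> 'a::field^'n::finite"
  assumes "inj_on \<tau> A" "indep_on (\<tau> ` A) e" "finite A"
  shows "indep_on A (\<lambda>i. e (\<tau> i))"
proof -
  have "vec.dim (vec.span ((\<lambda>i. e (\<tau> i)) ` A)) = card A"
    using dim_span_indep_on[OF _ assms(2)] assms(1,3) by (simp add: image_image card_image)
  then show ?thesis by (rule indep_on_if_dim[OF assms(3)])
qed

lemma indep_axis:
  assumes "inj_on \<tau> A" "finite A"
  shows "indep_on A (\<lambda>i. axis (\<tau> i) 1 :: 'a::field^'n::finite)"
proof -
  have "indep_on UNIV (\<lambda>j. axis j 1 :: 'a::field^'n::finite)"
    unfolding indep_on_def sum_axis[of "\<chi> j. c j" for c, unfolded vec_lambda_beta]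
    by (simp add: Finite_Cartesian_Product.vec_eq_iff)
  then have "indep_on (\<tau> ` A) (\<lambda>j. axis j 1 :: 'a::field^'n::finite)"
    by (rule indep_on_subset[rotated]) auto
  then show ?thesis by (rule indep_on_reindex[OF assms(1) _ assms(2)])
qed

section \<open>Independence as nonvanishing of a determinant\<close>

definition full_det :: "(nat \<Rightarrow> complex^'n::{finite,linorder}) \<Rightarrow> complex" where
  "full_det x = wedge_coords CARD('n) x UNIV"

lemma full_det_nonzero_iff:
  fixes x :: "nat \<Rightarrow> complex^'n::{finite,linorder}"
  shows "full_det x \<noteq> 0 \<longleftrightarrow> indep_on {..<CARD('n)} x"
proof
  assume "indep_on {..<CARD('n)} x"
  then obtain S :: "'n set" where S: "card S = CARD('n)" "wedge_coords CARD('n) x S \<noteq> 0"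
    by (rule indep_imp_wedge_coords_nonzero)
  have "S = UNIV" using S(1) by (intro card_subset_eq) auto
  then show "full_det x \<noteq> 0" using S(2) by (simp add: full_det_def)
qed (auto simp: full_det_def intro: wedge_coords_nonzero_imp_indep)

lemma poly_fun_full_det:
  fixes X :: "nat \<Rightarrow> 'x \<Rightarrow> complex^'n::{finite,linorder}"
  assumes "\<And>i j. i < CARD('n) \<Longrightarrow> poly_fun C (\<lambda>t. X i t $ j)"
  shows "poly_fun C (\<lambda>t. full_det (\<lambda>i. X i t))"
  unfolding full_det_def wedge_coords_def
  using assms by (auto intro!: poly_fun_sum poly_fun_prod poly_fun.mult poly_fun.const)

text \<open>Irreducibility of affine space. A path joins a point of the first open set to one of the
  second, and each of the two polynomials has only finitely many zeros on it.\<close>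

lemma general_conj:
  assumes path: "\<And>x y. \<exists>\<gamma> :: complex \<Rightarrow> _. \<gamma> 0 = x \<and> \<gamma> 1 = y \<and> (\<forall>c\<in>C. \<exists>p. \<forall>t. c (\<gamma> t) = poly p t)"
    and "general C P" "general C Q"
  shows "general C (\<lambda>x. P x \<and> Q x)"
proof -
  obtain g x where g: "poly_fun C g" "g x \<noteq> 0" "\<And>x. g x \<noteq> 0 \<Longrightarrow> P x"
    using assms(2) by (auto simp: general_def)
  obtain h y where h: "poly_fun C h" "h y \<noteq> 0" "\<And>x. h x \<noteq> 0 \<Longrightarrow> Q x"
    using assms(3) by (auto simp: general_def)
  obtain \<gamma> where \<gamma>: "\<gamma> 0 = x" "\<gamma> 1 = y" "\<And>c. c \<in> C \<Longrightarrow> \<exists>p. \<forall>t. c (\<gamma> t) = poly p t"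
    using path[of x y] by blast
  have "finite ({t. g (\<gamma> t) = 0} \<union> {t. h (\<gamma> t) = 0})"
  proof (rule finite_UnI)
    show "finite {t. g (\<gamma> t) = 0}"
      using poly_path_finite_zeros[OF g(1) \<gamma>(3), where ?t0.0 = 0] g(2) \<gamma>(1) by simp
    show "finite {t. h (\<gamma> t) = 0}"
      using poly_path_finite_zeros[OF h(1) \<gamma>(3), where ?t0.0 = 1] h(2) \<gamma>(2) by simp
  qed
  then obtain t where "t \<notin> {t. g (\<gamma> t) = 0} \<union> {t. h (\<gamma> t) = 0}" by (rule avoid_finite)
  then have "g (\<gamma> t) * h (\<gamma> t) \<noteq> 0" by auto
  then show ?thesis unfolding general_def
    using poly_fun.mult[OF g(1) h(1)] g(3) h(3) by (intro exI[of _ "\<lambda>x. g x * h x"]) auto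
qed

lemma general_all:
  assumes path: "\<And>x y. \<exists>\<gamma> :: complex \<Rightarrow> _. \<gamma> 0 = x \<and> \<gamma> 1 = y \<and> (\<forall>c\<in>C. \<exists>p. \<forall>t. c (\<gamma> t) = poly p t)"
    and "finite I" "\<And>i. i \<in> I \<Longrightarrow> general C (P i)"
  shows "general C (\<lambda>x. \<forall>i\<in>I. P i x)"
  using assms(2,3)
proof (induction I)
  case empty
  show ?case unfolding general_def by (auto intro!: exI[of _ "\<lambda>_. 1"] poly_fun.const)
next
  case (insert i I)
  then have "general C (\<lambda>x. P i x \<and> (\<forall>i\<in>I. P i x))" by (intro general_conj[OF path]) auto
  then show ?case by simp
qed

lemma general_mono: "general C P \<Longrightarrow> (\<And>x. P x \<Longrightarrow> Q x) \<Longrightarrow> general C Q"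
  unfolding general_def by blast

lemma generalI: "poly_fun C g \<Longrightarrow> g x \<noteq> 0 \<Longrightarrow> general C (\<lambda>x. g x \<noteq> 0)"
  unfolding general_def by blast

lemma basis_triple_path:
  fixes x y :: "(nat \<Rightarrow> complex^'n::finite) \<times> (nat \<Rightarrow> complex^'n) \<times> (nat \<Rightarrow> complex^'n)"
  shows "\<exists>\<gamma> :: complex \<Rightarrow> _. \<gamma> 0 = x \<and> \<gamma> 1 = y \<and> (\<forall>c\<in>basis_triple_coords. \<exists>p. \<forall>t. c (\<gamma> t) = poly p t)"
proof -
  obtain u v w u' v' w' where xy: "x = (u, v, w)" "y = (u', v', w')" by (metis prod.exhaust)
  let ?m = "\<lambda>(a :: nat \<Rightarrow> complex^'n) b (t :: complex) i. a i + t *s (b i - a i)"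
  let ?\<gamma> = "\<lambda>t. (?m u u' t, ?m v v' t, ?m w w' t)"
  have lin: "\<exists>p. \<forall>t. ?m a b t i $ j = poly p t" for a b i j
    by (intro exI[of _ "[:a i $ j, b i $ j - a i $ j:]"]) (simp add: algebra_simps)
  have "\<exists>p. \<forall>t. c (?\<gamma> t) = poly p t" if "c \<in> basis_triple_coords" for c
    using that lin unfolding basis_triple_coords_def by auto
  moreover have "?\<gamma> 0 = x" "?\<gamma> 1 = y" by (simp_all add: xy vec.scale_zero_left)
  ultimately show ?thesis by (intro exI[of _ ?\<gamma>]) blast
qed

section \<open>Opposite flags and their common basis\<close>

definition mix :: "(nat \<Rightarrow> 'a) \<Rightarrow> (nat \<Rightarrow> 'a) \<Rightarrow> nat \<Rightarrow> nat \<Rightarrow> 'a" where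
  "mix v w c i = (if i < c then v i else w (i - c))"

text \<open>The first \<open>c\<close> vectors of \<open>v\<close> and the first
  \<open>n - c\<close> of \<open>w\<close> span complementary subspaces for every \<open>c\<close>,
  which makes the two flags opposite. Written with determinants this is a polynomial
  condition.\<close>

definition opposite :: "(nat \<Rightarrow> complex^'n::{finite,linorder}) \<Rightarrow> (nat \<Rightarrow> complex^'n::{finite,linorder}) \<Rightarrow> bool" where
  "opposite v w \<longleftrightarrow> (\<forall>c\<in>{..CARD('n)}. full_det (mix v w c) \<noteq> 0)"

(* By Cramer's rule this spans the line G (c + 1) \<inter> H (n - c). *)
definition meet_vec ::
    "(nat \<Rightarrow> complex^'n::{finite,linorder}) \<Rightarrow> (nat \<Rightarrow> complex^'n::{finite,linorder}) \<Rightarrow> nat \<Rightarrow> complex^'n::{finite,linorder}" where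
  "meet_vec v w c = (\<Sum>m\<in>{c..<CARD('n)}. full_det ((mix v w c)(m := v c)) *s mix v w c m)"

text \<open>\<open>v c\<close> is expanded in the basis \<open>mix v w c\<close> and multiplied by
  the determinant; the terms along \<open>w\<close> form \<open>meet_vec\<close>, and the remaining
  terms involve only earlier vectors of \<open>v\<close>. With the denominators cleared, the entries
  are polynomials in those of \<open>v\<close> and \<open>w\<close>.\<close>

lemma meet_vec:
  fixes v w :: "nat \<Rightarrow> complex^'n::{finite,linorder}"
  assumes opp: "opposite v w" and c: "c < CARD('n)"
  shows "meet_vec v w c \<in> vec.span (w ` {..<CARD('n) - c})"
    "\<exists>a y. a \<noteq> 0 \<and> y \<in> vec.span (v ` {..<c}) \<and> meet_vec v w c = a *s v c + y"
proof -
  let ?x = "mix v w c"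
  have D: "full_det ?x \<noteq> 0" using opp c by (auto simp: opposite_def)
  then have "vec.span (?x ` {..<CARD('n)}) = UNIV"
    by (simp add: full_det_nonzero_iff span_indep_on_full)
  then have "v c \<in> vec.span (?x ` {..<CARD('n)})" by simp
  then obtain \<alpha> where \<alpha>: "v c = (\<Sum>m<CARD('n). \<alpha> m *s ?x m)"
    by (rule in_span_imageE) auto
  have det: "full_det (?x(m := v c)) = full_det ?x * \<alpha> m" if "m < CARD('n)" for m
    using minor_replace_row[OF that \<alpha>] by (simp add: full_det_def wedge_coords_minor mult.commute)
  have xw: "?x m \<in> w ` {..<CARD('n) - c}" if "m \<in> {c..<CARD('n)}" for m
    using that by (auto simp: mix_def)
  then show "meet_vec v w c \<in> vec.span (w ` {..<CARD('n) - c})"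
    unfolding meet_vec_def by (intro vec.span_sum vec.span_scale vec.span_base) auto
  have "meet_vec v w c = full_det ?x *s (\<Sum>m\<in>{c..<CARD('n)}. \<alpha> m *s ?x m)"
    unfolding meet_vec_def vec.scale_sum_right by (intro sum.cong) (auto simp: det)
  also have "(\<Sum>m\<in>{c..<CARD('n)}. \<alpha> m *s ?x m) = v c - (\<Sum>m<c. \<alpha> m *s v m)"
  proof -
    have "{..<CARD('n)} = {..<c} \<union> {c..<CARD('n)}" using c by auto
    then have "v c = (\<Sum>m<c. \<alpha> m *s ?x m) + (\<Sum>m\<in>{c..<CARD('n)}. \<alpha> m *s ?x m)"
      using \<alpha> by (simp add: sum.union_disjoint ivl_disj_int)
    moreover have "(\<Sum>m<c. \<alpha> m *s ?x m) = (\<Sum>m<c. \<alpha> m *s v m)"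
      by (intro sum.cong) (auto simp: mix_def)
    ultimately show ?thesis by (simp add: eq_diff_eq add.commute)
  qed
  finally have "meet_vec v w c = full_det ?x *s v c + (- full_det ?x) *s (\<Sum>m<c. \<alpha> m *s v m)"
    by (simp add: vec.scale_right_diff_distrib)
  moreover have "(- full_det ?x) *s (\<Sum>m<c. \<alpha> m *s v m) \<in> vec.span (v ` {..<c})"
    by (intro vec.span_scale sum_in_span_image) simp
  ultimately show "\<exists>a y. a \<noteq> 0 \<and> y \<in> vec.span (v ` {..<c}) \<and> meet_vec v w c = a *s v c + y"
    using D by blast
qed

text \<open>The change of basis from \<open>v\<close> to \<open>meet_vec v w\<close> is triangular
  with nonzero diagonal.\<close>

lemma span_meet_vec_v:
  fixes v w :: "nat \<Rightarrow> complex^'n::{finite,linorder}"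
  assumes opp: "opposite v w" and i: "i \<le> CARD('n)"
  shows "vec.span (meet_vec v w ` {..<i}) = vec.span (v ` {..<i})"
  using i
proof (induction i)
  case (Suc i)
  then have IH: "vec.span (meet_vec v w ` {..<i}) = vec.span (v ` {..<i})" and i: "i < CARD('n)" by auto
  obtain a y where ay: "a \<noteq> 0" "y \<in> vec.span (v ` {..<i})" "meet_vec v w i = a *s v i + y"
    using meet_vec(2)[OF opp i] by blast
  have sub1: "vec.span (v ` {..<i}) \<subseteq> vec.span (v ` {..<Suc i})"
    and sub2: "vec.span (meet_vec v w ` {..<i}) \<subseteq> vec.span (meet_vec v w ` {..<Suc i})"
    by (intro vec.span_mono image_mono; auto)+
  have vi: "v i \<in> vec.span (v ` {..<Suc i})" and mi: "meet_vec v w i \<in> vec.span (meet_vec v w ` {..<Suc i})"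
    by (intro vec.span_base; auto)+
  show ?case
  proof
    have "meet_vec v w j \<in> vec.span (v ` {..<Suc i})" if "j < Suc i" for j
    proof (cases "j = i")
      case True
      have "a *s v i + y \<in> vec.span (v ` {..<Suc i})"
        using ay(2) sub1 vi by (intro vec.span_add vec.span_scale) auto
      then show ?thesis using True ay(3) by simp
    next
      case False
      then have "meet_vec v w j \<in> vec.span (meet_vec v w ` {..<i})"
        using that by (intro vec.span_base) auto
      then show ?thesis using IH sub1 by blast
    qed
    then show "vec.span (meet_vec v w ` {..<Suc i}) \<subseteq> vec.span (v ` {..<Suc i})"
      by (intro vec.span_minimal) auto
    have "v j \<in> vec.span (meet_vec v w ` {..<Suc i})" if "j < Suc i" for j
    proof (cases "j = i")
      case True
      have "v i = inverse a *s (meet_vec v w i - y)" using ay(1,3) by simp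
      also have "\<dots> \<in> vec.span (meet_vec v w ` {..<Suc i})"
        using ay(2) IH sub2 mi by (intro vec.span_scale vec.span_diff) auto
      finally show ?thesis using True by simp
    next
      case False
      then have "v j \<in> vec.span (v ` {..<i})" using that by (intro vec.span_base) auto
      then show ?thesis using IH sub2 by blast
    qed
    then show "vec.span (v ` {..<Suc i}) \<subseteq> vec.span (meet_vec v w ` {..<Suc i})"
      by (intro vec.span_minimal) auto
  qed
qed simp

lemma opposite_indep:
  fixes v w :: "nat \<Rightarrow> complex^'n::{finite,linorder}"
  assumes "opposite v w"
  shows "indep_on {..<CARD('n)} v" "indep_on {..<CARD('n)} w"
proof -
  have "indep_on {..<CARD('n)} (mix v w CARD('n))" "indep_on {..<CARD('n)} (mix v w 0)"
    using assms by (auto simp: opposite_def full_det_nonzero_iff)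
  moreover have "indep_on {..<CARD('n)} (mix v w CARD('n)) \<longleftrightarrow> indep_on {..<CARD('n)} v"
    "indep_on {..<CARD('n)} (mix v w 0) \<longleftrightarrow> indep_on {..<CARD('n)} w"
    by (intro indep_on_cong; simp add: mix_def)+
  ultimately show "indep_on {..<CARD('n)} v" "indep_on {..<CARD('n)} w" by simp_all
qed

lemma indep_meet_vec:
  fixes v w :: "nat \<Rightarrow> complex^'n::{finite,linorder}"
  assumes opp: "opposite v w"
  shows "indep_on {..<CARD('n)} (meet_vec v w)"
  using span_meet_vec_v[OF opp order_refl] dim_span_indep_on[OF _ opposite_indep(1)[OF opp]]
  by (intro indep_on_if_dim) simp_all

text \<open>On this side only the inclusion is immediate; equality follows from the independence of
  the \<open>meet_vec\<close> by dimension.\<close>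

lemma span_meet_vec_w:
  fixes v w :: "nat \<Rightarrow> complex^'n::{finite,linorder}"
  assumes opp: "opposite v w" and i: "i \<le> CARD('n)"
  shows "vec.span (meet_vec v w ` {CARD('n) - i..<CARD('n)}) = vec.span (w ` {..<i})"
proof (rule vec.subspace_dim_equal)
  have "meet_vec v w c \<in> vec.span (w ` {..<i})" if "c \<in> {CARD('n) - i..<CARD('n)}" for c
  proof -
    have "vec.span (w ` {..<CARD('n) - c}) \<subseteq> vec.span (w ` {..<i})"
      using that i by (intro vec.span_mono image_mono) auto
    then show ?thesis using meet_vec(1)[OF opp, of c] that by auto
  qed
  then show "vec.span (meet_vec v w ` {CARD('n) - i..<CARD('n)}) \<subseteq> vec.span (w ` {..<i})"
    by (intro vec.span_minimal) auto
  have "indep_on {CARD('n) - i..<CARD('n)} (meet_vec v w)"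
    by (rule indep_on_subset[OF _ indep_meet_vec[OF opp]]) auto
  from dim_span_indep_on[OF _ this]
  have "vec.dim (vec.span (meet_vec v w ` {CARD('n) - i..<CARD('n)})) = i" using i by simp
  then show "vec.dim (vec.span (w ` {..<i})) \<le> vec.dim (vec.span (meet_vec v w ` {CARD('n) - i..<CARD('n)}))"
    using dim_span_image_le[of "{..<i}" w] by simp
qed auto

text \<open>A nonzero determinant of this family expresses that the first \<open>n - card I\<close>
  vectors of \<open>u\<close> span a complement of the coordinate subspace of
  \<open>I\<close>.\<close>

definition complete_with ::
    "(nat \<Rightarrow> complex^'n::{finite,linorder}) \<Rightarrow> (nat \<Rightarrow> complex^'n::{finite,linorder}) \<Rightarrow> nat set \<Rightarrow> nat \<Rightarrow> complex^'n::{finite,linorder}" where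
  "complete_with u e I i =
     (if i < CARD('n) - card I then u i else e (sorted_list_of_set I ! (i - (CARD('n) - card I))))"

definition transversal_bases ::
    "(nat \<Rightarrow> complex^'n::{finite,linorder}) \<times> (nat \<Rightarrow> complex^'n::{finite,linorder}) \<times> (nat \<Rightarrow> complex^'n::{finite,linorder}) \<Rightarrow> bool" where
  "transversal_bases = (\<lambda>(u, v, w). opposite v w \<and>
     (\<forall>I\<in>Pow {..<CARD('n)}. full_det (complete_with u (meet_vec v w) I) \<noteq> 0))"

lemma transversal_bases_flags:
  fixes u v w :: "nat \<Rightarrow> complex^'n::{finite,linorder}"
  assumes tr: "transversal_bases (u, v, w)"
    and fl: "complete_flag F" and ad: "adapted_basis u F" "adapted_basis v G" "adapted_basis w H"
  shows "transversal_flags (meet_vec v w) F G H"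
proof -
  have opp: "opposite v w" using tr by (simp add: transversal_bases_def)
  interpret vector_basis "meet_vec v w" by unfold_locales (rule indep_meet_vec[OF opp])
  show ?thesis
  proof
    show "G i = E {..<i}" if "i \<le> CARD('n)" for i
      using ad(2) that span_meet_vec_v[OF opp that] by (simp add: adapted_basis_def E_def)
    show "H i = E {CARD('n) - i..<CARD('n)}" if "i \<le> CARD('n)" for i
      using ad(3) that span_meet_vec_w[OF opp that] by (simp add: adapted_basis_def E_def)
    fix I :: "nat set" assume I: "I \<subseteq> {..<CARD('n)}"
    then have fI: "finite I" using finite_subset by blast
    have cI: "card I \<le> CARD('n)" using card_mono[OF _ I] by simp
    let ?y = "complete_with u (meet_vec v w) I" and ?r = "CARD('n) - card I"
    have ind: "indep_on {..<CARD('n)} ?y"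
      using tr I by (auto simp: transversal_bases_def full_det_nonzero_iff)
    have "F ?r = vec.span (?y ` {..<?r})"
      using ad(1) by (auto simp: adapted_basis_def complete_with_def cong: image_cong_simp)
    moreover have "?y ` {?r..<CARD('n)} = meet_vec v w ` I"
    proof -
      have "?y ` {?r..<CARD('n)} = (\<lambda>i. meet_vec v w (sorted_list_of_set I ! (i - ?r))) ` {?r..<CARD('n)}"
        by (intro image_cong) (auto simp: complete_with_def)
      also have "\<dots> = meet_vec v w ` (\<lambda>i. sorted_list_of_set I ! (i - ?r)) ` {?r..<CARD('n)}"
        by (simp add: image_image)
      also have "(\<lambda>i. sorted_list_of_set I ! (i - ?r)) ` {?r..<CARD('n)} =
          (!) (sorted_list_of_set I) ` (\<lambda>i. i - ?r) ` {?r..<CARD('n)}"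
        by (simp add: image_image)
      also have "(\<lambda>i. i - ?r) ` {?r..<CARD('n)} = {..<card I}"
      proof
        show "{..<card I} \<subseteq> (\<lambda>i. i - ?r) ` {?r..<CARD('n)}"
        proof
          fix j assume "j \<in> {..<card I}"
          then show "j \<in> (\<lambda>i. i - ?r) ` {?r..<CARD('n)}"
            using cI by (intro image_eqI[of _ _ "j + ?r"]) auto
        qed
      qed (use cI in auto)
      also have "(!) (sorted_list_of_set I) ` {..<card I} = I"
        using fI by (metis atLeast0LessThan length_sorted_list_of_set nth_image set_sorted_list_of_set
            take_all order_refl)
      finally show ?thesis .
    qed
    ultimately have "F ?r \<inter> E I = vec.span (?y ` {..<?r}) \<inter> vec.span (?y ` {?r..<CARD('n)})"
      by (simp add: E_def)
    also have "\<dots> = vec.span (?y ` ({..<?r} \<inter> {?r..<CARD('n)}))"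
      by (rule span_image_Int[OF _ ind]) auto
    also have "{..<?r} \<inter> {?r..<CARD('n)} = {}" by auto
    finally show "F ?r \<inter> E I = {0}" by simp
  qed (rule fl)
qed

text \<open>Each of finitely many conditions is the nonvanishing of a polynomial, so one example for
  each is enough; different conditions may use different examples.\<close>

lemma general_transversal_bases:
  "general (basis_triple_coords ::
     ((nat \<Rightarrow> complex^'n::{finite,linorder}) \<times> (nat \<Rightarrow> complex^'n::{finite,linorder}) \<times> (nat \<Rightarrow> complex^'n::{finite,linorder}) \<Rightarrow> complex) set)
     transversal_bases"
proof -
  let ?C = "basis_triple_coords ::
     ((nat \<Rightarrow> complex^'n::{finite,linorder}) \<times> (nat \<Rightarrow> complex^'n::{finite,linorder}) \<times> (nat \<Rightarrow> complex^'n::{finite,linorder}) \<Rightarrow> complex) set"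
  let ?N = "CARD('n)"
  have pu: "poly_fun ?C (\<lambda>t. fst t i $ j)" and pv: "poly_fun ?C (\<lambda>t. fst (snd t) i $ j)"
    and pw: "poly_fun ?C (\<lambda>t. snd (snd t) i $ j)" if "i < ?N" for i j
    using that by (intro poly_fun.coord; force simp: basis_triple_coords_def fun_eq_iff)+
  have pmix: "poly_fun ?C (\<lambda>t. mix (fst (snd t)) (snd (snd t)) c i $ j)" if "i < ?N" for c i j
    using that pv pw by (cases "i < c") (auto simp: mix_def)
  have o: "general ?C (\<lambda>t. full_det (mix (fst (snd t)) (snd (snd t)) c) \<noteq> 0)" if c: "c \<le> ?N" for c
  proof -
    obtain \<sigma> :: "nat \<Rightarrow> 'n" where "bij_betw \<sigma> {..<?N} UNIV"
      using ex_bij_betw_nat_finite[of "UNIV :: 'n set"] by (auto simp: atLeast0LessThan)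
    then have inj: "inj_on \<sigma> {..<?N}" by (simp add: bij_betw_def)
    \<comment> \<open>The shift by \<open>c\<close> in \<open>?w\<close> makes the mixed family the
      standard basis in the order of \<open>\<sigma>\<close>.\<close>
    let ?v = "\<lambda>i. axis (\<sigma> i) 1 :: complex^'n::{finite,linorder}" and ?w = "\<lambda>i. axis (\<sigma> (i + c)) 1 :: complex^'n::{finite,linorder}"
    have "mix ?v ?w c = ?v" by (auto simp: mix_def fun_eq_iff)
    then have "full_det (mix ?v ?w c) \<noteq> 0"
      unfolding full_det_nonzero_iff using indep_axis[OF inj] by simp
    then show ?thesis
      by (intro generalI[where x = "(?v, ?v, ?w)"] poly_fun_full_det pmix) auto
  qed
  have "general ?C (\<lambda>t. \<forall>c\<in>{..?N}. full_det (mix (fst (snd t)) (snd (snd t)) c) \<noteq> 0)"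
    using o by (intro general_all basis_triple_path) auto
  then have gopp: "general ?C (\<lambda>t. opposite (fst (snd t)) (snd (snd t)))"
    by (simp add: opposite_def)
  \<comment> \<open>A general condition holds somewhere; this opposite pair serves in the examples
    for all \<open>I\<close>.\<close>
  then obtain v w :: "nat \<Rightarrow> complex^'n::{finite,linorder}" where opp: "opposite v w"
    unfolding general_def by blast
  have pmeet: "poly_fun ?C (\<lambda>t. meet_vec (fst (snd t)) (snd (snd t)) c $ j)" if c: "c < ?N" for c j
  proof -
    have "poly_fun ?C (\<lambda>t. ((mix (fst (snd t)) (snd (snd t)) c)(m := fst (snd t) c)) i $ j)" if "i < ?N" for m i j
      using pmix[OF that] pv[OF c] by (cases "i = m") auto
    then have "poly_fun ?C (\<lambda>t. full_det ((mix (fst (snd t)) (snd (snd t)) c)(m := fst (snd t) c)))" for m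
      by (rule poly_fun_full_det)
    then show ?thesis
      unfolding meet_vec_def sum_component vector_smult_component
      by (intro poly_fun_sum poly_fun.mult pmix) auto
  qed
  have tI: "general ?C (\<lambda>t. full_det (complete_with (fst t) (meet_vec (fst (snd t)) (snd (snd t))) I) \<noteq> 0)"
    if I: "I \<subseteq> {..<?N}" for I
  proof -
    have fI: "finite I" using I finite_subset by blast
    have cI: "card I \<le> ?N" using card_mono[OF _ I] by simp
    let ?r = "?N - card I"
    have nthI: "sorted_list_of_set I ! (i - ?r) \<in> I" if "i < ?N" "\<not> i < ?r" for i
    proof -
      have "i - ?r < length (sorted_list_of_set I)" using that cI fI by simp
      then have "sorted_list_of_set I ! (i - ?r) \<in> set (sorted_list_of_set I)" by (rule nth_mem)
      then show ?thesis using fI by simp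
    qed
    have poly: "poly_fun ?C (\<lambda>t. complete_with (fst t) (meet_vec (fst (snd t)) (snd (snd t))) I i $ j)"
      if "i < ?N" for i j
    proof (cases "i < ?r")
      case True
      then show ?thesis using pu[OF that] by (simp add: complete_with_def)
    next
      case False
      then show ?thesis using pmeet nthI[OF that False] I by (auto simp: complete_with_def)
    qed
    let ?K = "{..<?N} - I"
    have cK: "card ?K = ?r" using I fI by (simp add: card_Diff_subset)
    let ?xs = "sorted_list_of_set ?K @ sorted_list_of_set I"
    have len: "length ?xs = ?N" using cK cI by simp
    have set: "set ?xs = {..<?N}" using I fI by auto
    have dist: "distinct ?xs" using fI by auto
    \<comment> \<open>With the basis vectors outside \<open>I\<close> as \<open>u\<close>, the
      completed family is a rearrangement of the basis.\<close>
    define u where "u i = meet_vec v w (sorted_list_of_set ?K ! i)" for i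
    have "complete_with u (meet_vec v w) I i = meet_vec v w (?xs ! i)" if "i < ?N" for i
      using that cK by (auto simp: complete_with_def u_def nth_append)
    moreover have "indep_on {..<?N} (\<lambda>i. meet_vec v w (?xs ! i))"
    proof (rule indep_on_reindex[where e = "meet_vec v w" and \<tau> = "(!) ?xs"])
      show "inj_on ((!) ?xs) {..<?N}" using dist len by (auto simp: inj_on_def nth_eq_iff_index_eq)
      have "(!) ?xs ` {..<?N} = set ?xs" using len by (auto simp: set_conv_nth image_iff)
      then show "indep_on ((!) ?xs ` {..<?N}) (meet_vec v w)"
        using indep_meet_vec[OF opp] by (simp only: set)
    qed simp
    ultimately have "indep_on {..<?N} (complete_with u (meet_vec v w) I)"
      by (subst indep_on_cong[of _ _ "\<lambda>i. meet_vec v w (?xs ! i)"]) auto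
    then have "full_det (complete_with u (meet_vec v w) I) \<noteq> 0"
      by (simp add: full_det_nonzero_iff)
    then show ?thesis
      by (intro generalI[where x = "(u, v, w)"] poly_fun_full_det poly) auto
  qed
  have "general ?C (\<lambda>t. \<forall>I\<in>Pow {..<?N}. full_det (complete_with (fst t) (meet_vec (fst (snd t)) (snd (snd t))) I) \<noteq> 0)"
    using tI by (intro general_all basis_triple_path) auto
  from general_conj[OF basis_triple_path gopp this] show ?thesis
    by (rule general_mono) (auto simp: transversal_bases_def)
qed

lemma general_flagsI:
  assumes "\<And>e F G H :: nat \<Rightarrow> _. transversal_flags e F G H \<Longrightarrow> P F G H"
  shows "general_flags (P :: (nat \<Rightarrow> (complex^'n::{finite,linorder}) set) \<Rightarrow> _)"
  unfolding general_flags_def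
proof (rule general_mono[OF general_transversal_bases], safe)
  fix u v w :: "nat \<Rightarrow> complex^'n::{finite,linorder}" and F G H
  assume "transversal_bases (u, v, w)" "complete_flag F" "adapted_basis u F" "adapted_basis v G"
    "adapted_basis w H"
  then show "P F G H" by (intro assms) (rule transversal_bases_flags)
qed

text \<open>A property of general flags can be tested at a transversal triple, since two general
  conditions hold together. This makes the number described in \<open>GW\<close> unique.\<close>

lemma general_flagsE:
  assumes "general_flags (P :: (nat \<Rightarrow> (complex^'n::{finite,linorder}) set) \<Rightarrow> _)"
  obtains e F G H where "transversal_flags e F G H" "P F G H"
proof -
  let ?Q = "\<lambda>(u, v, w). \<forall>F G H. complete_flag F \<and> complete_flag G \<and> complete_flag H \<and>
          adapted_basis u F \<and> adapted_basis v G \<and> adapted_basis w H \<longrightarrow> P F G H"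
  have "general basis_triple_coords (\<lambda>t. transversal_bases t \<and> ?Q t)"
    using assms unfolding general_flags_def
    by (rule general_conj[OF basis_triple_path general_transversal_bases])
  then obtain t where "transversal_bases t \<and> ?Q t" unfolding general_def by blast
  then obtain u v w where t: "transversal_bases (u, v, w)" "?Q (u, v, w)" by (cases t) auto
  \<comment> \<open>The condition for the empty index set says that \<open>u\<close> is a basis, so
    that the spans of its initial segments form a complete flag.\<close>
  have opp: "opposite v w" and "full_det (complete_with u (meet_vec v w) {}) \<noteq> 0"
    using t(1) by (auto simp: transversal_bases_def)
  then have "indep_on {..<CARD('n)} (complete_with u (meet_vec v w) {})"
    by (simp add: full_det_nonzero_iff)
  moreover have "indep_on {..<CARD('n)} (complete_with u (meet_vec v w) {}) \<longleftrightarrow> indep_on {..<CARD('n)} u"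
    by (intro indep_on_cong) (simp add: complete_with_def)
  ultimately have iu: "indep_on {..<CARD('n)} u" by simp
  let ?F = "\<lambda>(x :: nat \<Rightarrow> complex^'n::{finite,linorder}) i. vec.span (x ` {..<i})"
  have cf: "complete_flag (?F x)" if "indep_on {..<CARD('n)} x" for x
  proof -
    have "indep_on {..<i} x" if "i \<le> CARD('n)" for i
      by (rule indep_on_subset[OF _ \<open>indep_on {..<CARD('n)} x\<close>]) (use that in auto)
    then have "vec.dim (?F x i) = i" if "i \<le> CARD('n)" for i
      using that dim_span_indep_on[of "{..<i}" x] by simp
    moreover have "?F x i \<subseteq> ?F x (Suc i)" for i
      by (intro vec.span_mono image_mono) auto
    ultimately show ?thesis by (simp add: complete_flag_def)
  qed
  have ad: "adapted_basis x (?F x)" for x by (simp add: adapted_basis_def)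
  note fl = cf[OF iu] cf[OF opposite_indep(1)[OF opp]] cf[OF opposite_indep(2)[OF opp]]
  show ?thesis
    by (rule that[OF transversal_bases_flags[OF t(1) fl(1) ad ad ad]]) (use t(2) fl ad in auto)
qed

section \<open>Curves of low degree\<close>

definition curve_of_rows :: "nat \<Rightarrow> (nat \<Rightarrow> (nat \<Rightarrow> complex) \<Rightarrow> complex^'n) \<Rightarrow> ppt1 \<Rightarrow> (complex^'n) set" where
  "curve_of_rows l B = (\<lambda>z\<in>P1. vec.span ((\<lambda>i. B i (SOME x. x \<in> hcoords {0, 1} \<and> ppoint x = z)) ` {..<l}))"

lemma row_forms_scale:
  fixes B :: "nat \<Rightarrow> (nat \<Rightarrow> complex) \<Rightarrow> complex^'n::finite"
  assumes "row_forms l d B" "i < l"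
  shows "B i (\<lambda>j. c * x j) = c ^ d i *s B i x"
proof -
  have "B i (\<lambda>j. c * x j) $ j = c ^ d i * B i x $ j" for j
    using binary_form_homogeneous[of "d i" "\<lambda>x. B i x $ j"] assms by (simp add: row_forms_def)
  then show ?thesis by (simp add: Finite_Cartesian_Product.vec_eq_iff)
qed

lemma span_rows_scale:
  fixes B :: "nat \<Rightarrow> (nat \<Rightarrow> complex) \<Rightarrow> complex^'n::finite"
  assumes "row_forms l d B"
  shows "vec.span ((\<lambda>i. B i (\<lambda>j. c * x j)) ` {..<l}) \<subseteq> vec.span ((\<lambda>i. B i x) ` {..<l})"
  by (rule vec.span_minimal) (auto simp: row_forms_scale[OF assms] intro: vec.span_scale vec.span_base)

text \<open>The coordinates chosen for a point do not matter, because rescaling them multiplies each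
  row by a power of the factor.\<close>

lemma curve_of_rows:
  fixes B :: "nat \<Rightarrow> (nat \<Rightarrow> complex) \<Rightarrow> complex^'n::finite"
  assumes rows: "row_forms l d B" and ind: "\<And>x. x \<in> hcoords {0, 1} \<Longrightarrow> indep_on {..<l} (\<lambda>i. B i x)"
  shows "curve_by_rows l d B (curve_of_rows l B)" "curve_of_rows l B \<in> extensional P1"
proof -
  have "curve_of_rows l B (ppoint x) = vec.span ((\<lambda>i. B i x) ` {..<l})" if x: "x \<in> hcoords {0, 1}" for x
  proof -
    define y where "y = (SOME y. y \<in> hcoords {0, 1} \<and> ppoint y = ppoint x)"
    have y: "y \<in> hcoords {0, 1} \<and> ppoint y = ppoint x"
      unfolding y_def by (rule someI[of _ x]) (use x in simp)
    then obtain c where c: "c \<noteq> 0" "y = (\<lambda>i. c * x i)" by (auto simp: ppoint_eq_iff)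
    then have x': "x = (\<lambda>i. inverse c * y i)" by auto
    have "vec.span ((\<lambda>i. B i y) ` {..<l}) = vec.span ((\<lambda>i. B i x) ` {..<l})"
      using span_rows_scale[OF rows, of c x] span_rows_scale[OF rows, of "inverse c" y]
      unfolding c(2)[symmetric] x'[symmetric] by (rule subset_antisym)
    then show ?thesis using x by (simp add: curve_of_rows_def hcoords_in_P1[OF x] flip: y_def One_nat_def)
  qed
  then show "curve_by_rows l d B (curve_of_rows l B)" using assms by (simp add: curve_by_rows_def)
  show "curve_of_rows l B \<in> extensional P1" by (simp add: curve_of_rows_def)
qed

lemma subspace_extend:
  fixes S :: "('a::field^'n::finite) set"
  assumes "vec.dim S \<le> m" "m \<le> CARD('n)"
  obtains T where "vec.subspace T" "vec.dim T = m" "S \<subseteq> T"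
proof -
  obtain B where B: "B \<subseteq> S" "vec.independent B" "S \<subseteq> vec.span B" "card B = vec.dim S"
    using vec.basis_exists by blast
  obtain C where C: "B \<subseteq> C" "vec.independent C" "UNIV \<subseteq> vec.span C"
    using vec.maximal_independent_subset_extend[of B UNIV] B(2) by auto
  have fC: "finite C" using C(2) vec.finiteI_independent by blast
  have "card C = CARD('n)"
    using C(2,3) by (metis vec.dim_span_eq_card_independent vec.dim_UNIV vec.dimension_def vec_dim_card UNIV_I subset_antisym subset_UNIV)
  then have "m - card B \<le> card (C - B)"
    using assms B(4) C(1) fC by (simp add: card_Diff_subset finite_subset)
  then obtain D where D: "D \<subseteq> C - B" "card D = m - card B" "finite D"
    by (meson obtain_subset_with_card_n)
  have "card (B \<union> D) = m"
    using D B(4) assms(1) C(1) fC by (subst card_Un_disjoint) (auto intro: finite_subset)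
  moreover have "vec.independent (B \<union> D)"
    using C(1) D(1) by (intro vec.independent_mono[OF C(2)]) auto
  ultimately have "vec.dim (vec.span (B \<union> D)) = m"
    by (metis vec.dim_span_eq_card_independent)
  moreover have "S \<subseteq> vec.span (B \<union> D)" using B(3) vec.span_mono[of B "B \<union> D"] by blast
  ultimately show ?thesis using that[of "vec.span (B \<union> D)"] by simp
qed

lemma row_coefficients:
  fixes B :: "nat \<Rightarrow> (nat \<Rightarrow> complex) \<Rightarrow> complex^'n::finite"
  assumes "row_forms l d B"
  obtains b where "\<And>i x. i < l \<Longrightarrow> B i x = (\<Sum>j\<le>d i. (x 0 ^ j * x 1 ^ (d i - j)) *s b i j)"
proof -
  let ?P = "\<lambda>i j a. \<forall>x. B i x $ j = (\<Sum>m\<le>d i. a m * x 0 ^ m * x 1 ^ (d i - m))"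
  define a where "a i j = (SOME a. ?P i j a)" for i j
  have a: "?P i j (a i j)" if "i < l" for i j
  proof -
    have "binary_form (d i) (\<lambda>x. B i x $ j)" using assms that by (simp add: row_forms_def)
    then have "\<exists>a. ?P i j a" by (simp add: binary_form_def fun_eq_iff)
    then show ?thesis unfolding a_def by (rule someI_ex)
  qed
  have "B i x $ j = (\<Sum>m\<le>d i. x 0 ^ m * x 1 ^ (d i - m) * a i j m)" if "i < l" for i j x
    unfolding a[OF that, rule_format, of x j] by (intro sum.cong) (auto simp: mult_ac)
  then have "B i x = (\<Sum>j\<le>d i. (x 0 ^ j * x 1 ^ (d i - j)) *s (\<chi> m. a i m j))" if "i < l" for i x
    using that by (simp add: Finite_Cartesian_Product.vec_eq_iff)
  then show ?thesis by (rule that[of "\<lambda>i j. \<chi> m. a i m j"])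
qed

text \<open>Row \<open>i\<close> has \<open>d i + 1\<close> coefficient vectors, which makes
  \<open>l + D\<close> in all, and their span contains every point of the curve. They may be
  dependent, so the span is enlarged to the exact dimension.\<close>

lemma curve_span:
  fixes f :: "ppt1 \<Rightarrow> (complex^'n::{finite,linorder}) set"
  assumes "rational_curve l D f" "l + D \<le> CARD('n)"
  obtains S where "vec.subspace S" "vec.dim S = l + D" "\<And>z. z \<in> P1 \<Longrightarrow> f z \<subseteq> S"
proof -
  obtain d B where cr: "curve_by_rows l d B f" and D: "(\<Sum>i<l. d i) = D"
    using assms(1) by (rule rational_curveE)
  then have rows: "row_forms l d B" by (simp add: curve_by_rows_def)
  obtain b where b: "\<And>i x. i < l \<Longrightarrow> B i x = (\<Sum>j\<le>d i. (x 0 ^ j * x 1 ^ (d i - j)) *s b i j)"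
    using row_coefficients[OF rows] by blast
  let ?T = "\<Union>i<l. b i ` {..d i}"
  have "card ?T \<le> (\<Sum>i<l. card (b i ` {..d i}))" by (rule card_UN_le) simp
  also have "\<dots> \<le> (\<Sum>i<l. d i + 1)"
    by (rule sum_mono) (metis Suc_eq_plus1 card_atMost card_image_le finite_atMost)
  also have "\<dots> = l + D" using D by (simp only: sum.distrib) simp
  finally have "card ?T \<le> l + D" .
  moreover have "vec.dim ?T \<le> card ?T" by (rule vec.dim_le_card[OF vec.span_superset]) auto
  ultimately have "vec.dim (vec.span ?T) \<le> l + D" by simp
  then obtain S where S: "vec.subspace S" "vec.dim S = l + D" "vec.span ?T \<subseteq> S"
    using subspace_extend[OF _ assms(2)] by blast
  have "f z \<subseteq> S" if z: "z \<in> P1" for z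
  proof -
    obtain x where x: "x \<in> hcoords {0, 1}" "z = ppoint x" using z by (rule P1_E)
    have "B i x \<in> S" if "i < l" for i
    proof -
      have "b i j \<in> S" if "j \<le> d i" for j
        using S(3) vec.span_base[of "b i j" ?T] \<open>i < l\<close> that by auto
      then show ?thesis unfolding b[OF that] using S(1)
        by (intro vec.subspace_sum vec.subspace_scale) auto
    qed
    then have "vec.span ((\<lambda>i. B i x) ` {..<l}) \<subseteq> S" using S(1) by (intro vec.span_minimal) auto
    then show ?thesis using cr x by (simp add: curve_by_rows_def)
  qed
  then show ?thesis using that S(1,2) by blast
qed

lemma P1_nonempty: "ppoint infinity_pt \<in> P1"
  by (rule hcoords_in_P1) (rule infinity_pt_hcoords)

lemma rational_curve_0:
  fixes f :: "ppt1 \<Rightarrow> (complex^'n::{finite,linorder}) set"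
  shows "rational_curve l 0 f \<longleftrightarrow> (\<exists>V\<in>Gr l. f = (\<lambda>z\<in>P1. V))"
proof
  assume f: "rational_curve l 0 f"
  have fG: "f \<in> P1 \<rightarrow>\<^sub>E Gr l" using f by (simp add: rational_curve_def)
  obtain d B where cr: "curve_by_rows l d B f" and D: "(\<Sum>i<l. d i) = 0"
    using f by (rule rational_curveE)
  have const: "B i x = B i y" if "i < l" for i x y
  proof -
    have d0: "d i = 0" using D that by simp
    have "B i x $ j = B i y $ j" for j
    proof -
      have "binary_form 0 (\<lambda>x. B i x $ j)"
        using cr that d0 unfolding curve_by_rows_def row_forms_def by metis
      then obtain a where "(\<lambda>x. B i x $ j) = (\<lambda>x. \<Sum>j\<le>0. a j * x 0 ^ j * x 1 ^ (0 - j))"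
        unfolding binary_form_def by blast
      then have "B i x $ j = a 0" for x by (simp add: fun_eq_iff)
      then show ?thesis by simp
    qed
    then show ?thesis by (simp add: Finite_Cartesian_Product.vec_eq_iff)
  qed
  have "f z = f (ppoint infinity_pt)" if z: "z \<in> P1" for z
  proof -
    obtain x where x: "x \<in> hcoords {0, 1}" "z = ppoint x" using z by (rule P1_E)
    have "(\<lambda>i. B i x) ` {..<l} = (\<lambda>i. B i infinity_pt) ` {..<l}"
      by (rule image_cong[OF refl]) (use const in auto)
    moreover have "f z = vec.span ((\<lambda>i. B i x) ` {..<l})"
      "f (ppoint infinity_pt) = vec.span ((\<lambda>i. B i infinity_pt) ` {..<l})"
      using cr x infinity_pt_hcoords by (auto simp: curve_by_rows_def)
    ultimately show ?thesis by simp
  qed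
  then have "f = (\<lambda>z\<in>P1. f (ppoint infinity_pt))"
    using fG by (intro extensionalityI[of f P1]) (auto simp: PiE_def)
  moreover have "f (ppoint infinity_pt) \<in> Gr l" using fG P1_nonempty by auto
  ultimately show "\<exists>V\<in>Gr l. f = (\<lambda>z\<in>P1. V)" by blast
next
  assume "\<exists>V\<in>Gr l. f = (\<lambda>z\<in>P1. V)"
  then obtain V where V: "V \<in> Gr l" "f = (\<lambda>z\<in>P1. V)" by blast
  obtain v where v: "indep_on {..<l} v" "vec.span (v ` {..<l}) = V" using V(1) by (rule Gr_basis)
  have "curve_by_rows l (\<lambda>_. 0) (\<lambda>i x. v i) f"
    using v V(2) hcoords_in_P1 by (simp add: curve_by_rows_def row_forms_def binary_form_const)
  from rational_curve_low[OF this] V(2) show "rational_curve l 0 f" by simp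
qed

lemma span_insert_span: "vec.span (insert a (vec.span A)) = vec.span (insert a A)"
proof
  show "vec.span (insert a (vec.span A)) \<subseteq> vec.span (insert a A)"
    by (rule vec.span_minimal) (auto intro: vec.span_base subsetD[OF vec.span_mono[of A "insert a A"]])
  show "vec.span (insert a A) \<subseteq> vec.span (insert a (vec.span A))"
    by (rule vec.span_mono) (use vec.span_superset in auto)
qed

text \<open>The row degrees add up to 1: one row is linear, with coefficient vectors
  \<open>a\<close> and \<open>b\<close>, and the constant rows span \<open>K\<close>.\<close>

lemma rational_curve_1:
  fixes f :: "ppt1 \<Rightarrow> (complex^'n::{finite,linorder}) set"
  assumes "rational_curve l 1 f"
  obtains K a b where "vec.subspace K" "vec.dim K = l - 1"
    "\<And>x. x \<in> hcoords {0, 1} \<Longrightarrow> f (ppoint x) = vec.span (insert (x 0 *s a + x 1 *s b) K)"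
proof -
  obtain d B where cr: "curve_by_rows l d B f" and D: "(\<Sum>i<l. d i) = 1"
    using assms by (rule rational_curveE)
  then have rows: "row_forms l d B" by (simp add: curve_by_rows_def)
  obtain m where m: "m < l" "d m = 1" "\<And>i. i < l \<Longrightarrow> i \<noteq> m \<Longrightarrow> d i = 0"
  proof -
    have "\<exists>m\<in>{..<l}. d m = 1 \<and> (\<forall>i\<in>{..<l}. m \<noteq> i \<longrightarrow> d i = 0)"
      using D by (subst (asm) sum_eq_1_iff) auto
    then show ?thesis using that by (metis lessThan_iff)
  qed
  obtain b where b: "\<And>i x. i < l \<Longrightarrow> B i x = (\<Sum>j\<le>d i. (x 0 ^ j * x 1 ^ (d i - j)) *s b i j)"
    using row_coefficients[OF rows] by blast
  have Bm: "B m x = x 0 *s b m 1 + x 1 *s b m 0" for x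
    using b[OF m(1), of x] by (simp add: m(2) add.commute)
  have Bi: "B i x = b i 0" if "i < l" "i \<noteq> m" for i x
    using b[OF that(1), of x] by (simp add: m(3)[OF that])
  let ?A = "{..<l} - {m}"
  let ?K = "vec.span ((\<lambda>i. b i 0) ` ?A)"
  have "indep_on {..<l} (\<lambda>i. B i infinity_pt)"
    using cr infinity_pt_hcoords by (auto simp: curve_by_rows_def)
  then have "indep_on ?A (\<lambda>i. B i infinity_pt)" by (rule indep_on_subset[rotated]) auto
  then have "indep_on ?A (\<lambda>i. b i 0)" by (subst (asm) indep_on_cong[where w = "\<lambda>i. b i 0"]) (auto simp: Bi)
  from dim_span_indep_on[OF _ this] m(1) have dK: "vec.dim ?K = l - 1" by simp
  have "f (ppoint x) = vec.span (insert (x 0 *s b m 1 + x 1 *s b m 0) ?K)" if x: "x \<in> hcoords {0, 1}" for x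
  proof -
    have "{..<l} = insert m ?A" using m(1) by auto
    then have "(\<lambda>i. B i x) ` {..<l} = insert (B m x) ((\<lambda>i. B i x) ` ?A)" by (metis image_insert)
    also have "(\<lambda>i. B i x) ` ?A = (\<lambda>i. b i 0) ` ?A"
      by (rule image_cong[OF refl]) (auto simp: Bi)
    finally show ?thesis using cr x by (simp add: curve_by_rows_def span_insert_span Bm)
  qed
  then show ?thesis using that[of ?K] dK by blast
qed

section \<open>Automorphisms of the projective line\<close>

lemma regular_P1_compose:
  assumes f: "regular_P1 I f" and g: "regular_P1 {0, 1} g"
  shows "regular_P1 I (\<lambda>z. f (g z))"
  unfolding regular_P1_def
proof (intro conjI ballI)
  have gP: "g z \<in> P1" if "z \<in> P1" for z using g that unfolding regular_P1_def by blast
  fix z assume "z \<in> P1"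
  then show "f (g z) \<in> proj_space I" using f gP unfolding regular_P1_def by blast
next
  fix x :: "nat \<Rightarrow> complex" assume x: "x \<in> hcoords {0, 1}"
  obtain e h where h: "\<forall>i\<in>{0, 1}. binary_form e (h i)" "\<exists>i\<in>{0, 1}. h i x \<noteq> 0"
    and gh: "\<forall>y\<in>hcoords {0, 1}. (\<exists>i\<in>{0, 1}. h i y \<noteq> 0) \<longrightarrow>
        g (ppoint y) = ppoint (\<lambda>i :: nat. if i \<in> {0, 1} then h i y else 0)"
    using g x unfolding regular_P1_def by blast
  define H where "H y = (\<lambda>i :: nat. if i \<in> {0, 1} then h i y else 0)" for y
  have H: "H y \<in> hcoords {0, 1}" if "\<exists>i\<in>{0, 1}. h i y \<noteq> 0" for y
    using that by (auto simp: hcoords_def H_def)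
  have "H x \<in> hcoords {0, 1}" by (rule H) (rule h(2))
  then obtain d h' where h': "\<forall>i\<in>I. binary_form d (h' i)" "\<exists>i\<in>I. h' i (H x) \<noteq> 0"
    and fh: "\<forall>y\<in>hcoords {0, 1}. (\<exists>i\<in>I. h' i y \<noteq> 0) \<longrightarrow>
        f (ppoint y) = ppoint (\<lambda>i. if i \<in> I then h' i y else 0)"
    using f unfolding regular_P1_def by blast
  have comp: "binary_form (d * e) (\<lambda>y. h' i (H y))" if "i \<in> I" for i
  proof (rule binary_form_compose[of d "h' i" e H])
    show "binary_form d (h' i)" using h'(1) that by blast
    show "binary_form e (\<lambda>y. H y 0)" "binary_form e (\<lambda>y. H y 1)"
      using h(1) by (simp_all add: H_def)
  qed
  \<comment> \<open>Multiplying the composed forms by \<open>h m\<close> confines their nonzero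
    values to points where \<open>H\<close> really describes \<open>g\<close>.\<close>
  obtain m where m: "m \<in> {0, 1}" "h m x \<noteq> 0" using h(2) by blast
  show "\<exists>e h. (\<forall>i\<in>I. binary_form e (h i)) \<and> (\<exists>i\<in>I. h i x \<noteq> 0) \<and>
        (\<forall>y\<in>hcoords {0, 1}. (\<exists>i\<in>I. h i y \<noteq> 0) \<longrightarrow>
            f (g (ppoint y)) = ppoint (\<lambda>i. if i \<in> I then h i y else 0))"
  proof (intro exI conjI ballI impI)
    fix i assume "i \<in> I"
    then show "binary_form (e + d * e) (\<lambda>y. h m y * h' i (H y))"
      using h(1) m(1) comp by (intro binary_form_mult) auto
  next
    show "\<exists>i\<in>I. h m x * h' i (H x) \<noteq> 0" using h'(2) m(2) by auto
  next
    fix y assume y: "y \<in> hcoords {0, 1}" "\<exists>i\<in>I. h m y * h' i (H y) \<noteq> 0"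
    then have my: "h m y \<noteq> 0" and hy: "\<exists>i\<in>I. h' i (H y) \<noteq> 0" by auto
    have "g (ppoint y) = ppoint (H y)" unfolding H_def using gh y(1) my m(1) by blast
    moreover have "f (ppoint (H y)) = ppoint (\<lambda>i. if i \<in> I then h' i (H y) else 0)"
      using fh H[of y] my m(1) hy by blast
    moreover have "(\<lambda>i. if i \<in> I then h m y * h' i (H y) else 0) =
        (\<lambda>i. h m y * (if i \<in> I then h' i (H y) else 0))" by auto
    ultimately show "f (g (ppoint y)) = ppoint (\<lambda>i. if i \<in> I then h m y * h' i (H y) else 0)"
      by (simp only: ppoint_scale[OF my])
  qed
qed

lemma aut_P1_in_P1: "aut_P1 \<phi> \<Longrightarrow> z \<in> P1 \<Longrightarrow> \<phi> z \<in> P1"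
  unfolding aut_P1_def regular_P1_def by blast

lemma aut_P1_inverse:
  assumes "aut_P1 \<phi>"
  shows "\<exists>\<psi>. aut_P1 \<psi> \<and> (\<forall>z\<in>P1. \<psi> (\<phi> z) = z) \<and> (\<forall>z\<in>P1. \<phi> (\<psi> z) = z)"
proof -
  obtain \<psi> where \<psi>: "regular_P1 {0, 1} \<psi>" "\<forall>z\<in>P1. \<psi> (\<phi> z) = z \<and> \<phi> (\<psi> z) = z"
    using assms unfolding aut_P1_def by blast
  have "regular_P1 {0, 1} \<phi>" using assms by (simp only: aut_P1_def)
  then have "aut_P1 \<psi>"
    unfolding aut_P1_def using \<psi> by (intro conjI exI[of _ \<phi>] ballI) simp_all
  then show ?thesis using \<psi>(2) by (intro exI[of _ \<psi>] conjI ballI) simp_all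
qed

lemma aut_P1_compose:
  assumes "aut_P1 \<phi>" "aut_P1 \<psi>"
  shows "aut_P1 (\<lambda>z. \<phi> (\<psi> z))"
proof -
  obtain \<phi>' where 1: "aut_P1 \<phi>'" "\<forall>z\<in>P1. \<phi>' (\<phi> z) = z" "\<forall>z\<in>P1. \<phi> (\<phi>' z) = z"
    using aut_P1_inverse[OF assms(1)] by blast
  obtain \<psi>' where 2: "aut_P1 \<psi>'" "\<forall>z\<in>P1. \<psi>' (\<psi> z) = z" "\<forall>z\<in>P1. \<psi> (\<psi>' z) = z"
    using aut_P1_inverse[OF assms(2)] by blast
  have reg: "regular_P1 {0, 1} \<phi>" "regular_P1 {0, 1} \<psi>" "regular_P1 {0, 1} \<phi>'" "regular_P1 {0, 1} \<psi>'"
    using assms 1(1) 2(1) by (simp_all only: aut_P1_def)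
  show ?thesis unfolding aut_P1_def
  proof (intro conjI exI ballI)
    show "regular_P1 {0, 1} (\<lambda>z. \<phi> (\<psi> z))" "regular_P1 {0, 1} (\<lambda>z. \<psi>' (\<phi>' z))"
      by (rule regular_P1_compose; rule reg)+
    fix z assume z: "z \<in> P1"
    show "\<psi>' (\<phi>' (\<phi> (\<psi> z))) = z" using bspec[OF 1(2) aut_P1_in_P1[OF assms(2) z]] bspec[OF 2(2) z] by simp
    show "\<phi> (\<psi> (\<psi>' (\<phi>' z))) = z" using bspec[OF 2(3) aut_P1_in_P1[OF 1(1) z]] bspec[OF 1(3) z] by simp
  qed
qed

section \<open>Moebius transformations\<close>

definition moebius :: "complex \<Rightarrow> complex \<Rightarrow> complex \<Rightarrow> complex \<Rightarrow> (nat \<Rightarrow> complex) \<Rightarrow> nat \<Rightarrow> complex" where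
  "moebius a b c d x = (\<lambda>i. if i = 0 then a * x 0 + b * x 1 else if i = 1 then c * x 0 + d * x 1 else 0)"

text \<open>A point is the set of its coordinate vectors, so the linear map acts on points by taking
  images.\<close>

lemma moebius_image: "moebius a b c d ` ppoint x = ppoint (moebius a b c d x)"
proof -
  have pt: "ppoint y = (\<lambda>t i. t * y i) ` {t. t \<noteq> 0}" for y :: "nat \<Rightarrow> complex"
    by (auto simp: ppoint_def)
  have "moebius a b c d (\<lambda>i. t * x i) = (\<lambda>i. t * moebius a b c d x i)" for t
    by (auto simp: moebius_def fun_eq_iff algebra_simps)
  then show ?thesis unfolding pt image_image by (rule image_cong[OF refl])
qed

lemma moebius_hcoords:
  assumes "a * d - b * c \<noteq> 0" "x \<in> hcoords {0, 1}"
  shows "moebius a b c d x \<in> hcoords {0, 1}"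
proof -
  have "a * x 0 + b * x 1 \<noteq> 0 \<or> c * x 0 + d * x 1 \<noteq> 0"
  proof (rule ccontr)
    assume "\<not> ?thesis"
    then have z: "a * x 0 + b * x 1 = 0" "c * x 0 + d * x 1 = 0" by auto
    have "(a * d - b * c) * x 0 = d * (a * x 0 + b * x 1) - b * (c * x 0 + d * x 1)"
      "(a * d - b * c) * x 1 = a * (c * x 0 + d * x 1) - c * (a * x 0 + b * x 1)" by (simp_all add: algebra_simps)
    then have "x 0 = 0" "x 1 = 0" using z assms(1) by auto
    then show False using assms(2) by (auto simp: hcoords_def)
  qed
  then have "moebius a b c d x 0 \<noteq> 0 \<or> moebius a b c d x 1 \<noteq> 0" by (simp add: moebius_def)
  moreover have "moebius a b c d x i = 0" if "i \<notin> {0, 1}" for i using that by (simp add: moebius_def)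
  ultimately show ?thesis unfolding hcoords_def by blast
qed

lemma moebius_regular:
  assumes "a * d - b * c \<noteq> 0"
  shows "regular_P1 {0, 1} (\<lambda>z. moebius a b c d ` z)"
  unfolding regular_P1_def
proof (intro conjI ballI)
  fix z assume "z \<in> P1"
  then show "moebius a b c d ` z \<in> P1"
    using moebius_hcoords[OF assms] by (auto simp: proj_space_def moebius_image)
next
  fix x :: "nat \<Rightarrow> complex" assume x: "x \<in> hcoords {0, 1}"
  show "\<exists>e h. (\<forall>i\<in>{0, 1}. binary_form e (h i)) \<and> (\<exists>i\<in>{0, 1}. h i x \<noteq> 0) \<and>
       (\<forall>y\<in>hcoords {0, 1}. (\<exists>i\<in>{0, 1}. h i y \<noteq> 0) \<longrightarrow>
         moebius a b c d ` ppoint y = ppoint (\<lambda>i::nat. if i \<in> {0, 1} then h i y else 0))"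
  proof (intro exI conjI ballI impI)
    fix i :: nat assume "i \<in> {0, 1}"
    have "binary_form 1 (\<lambda>x. \<alpha> * x 0 + \<beta> * x 1)" for \<alpha> \<beta>
      by (intro binary_form_add binary_form_scale binary_form_coord) auto
    then show "binary_form 1 (\<lambda>x. moebius a b c d x i)"
      using \<open>i \<in> {0, 1}\<close> by (auto simp: moebius_def)
  next
    show "\<exists>i\<in>{0, 1}. moebius a b c d x i \<noteq> 0"
      using moebius_hcoords[OF assms x] by (auto simp: hcoords_def)
  next
    fix y
    have "(\<lambda>i. if i \<in> {0, 1} then moebius a b c d y i else 0) = moebius a b c d y"
      by (auto simp: moebius_def fun_eq_iff)
    then show "moebius a b c d ` ppoint y = ppoint (\<lambda>i. if i \<in> {0, 1} then moebius a b c d y i else 0)"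
      by (simp only: moebius_image)
  qed
qed

lemma aut_P1_moebius:
  assumes "a * d - b * c \<noteq> 0"
  shows "aut_P1 (\<lambda>z. moebius a b c d ` z)"
proof -
  have det: "d * a - (- b) * (- c) \<noteq> 0" using assms by (simp add: mult.commute)
  \<comment> \<open>The inverse is the adjugate matrix: the composite multiplies the coordinates by
    the determinant, which does not move a point.\<close>
  have inv: "moebius a b c d (moebius d (- b) (- c) a x) = (\<lambda>i. (a * d - b * c) * x i)"
    "moebius d (- b) (- c) a (moebius a b c d x) = (\<lambda>i. (a * d - b * c) * x i)"
    if "x \<in> hcoords {0, 1}" for x
    using that by (auto simp: moebius_def fun_eq_iff hcoords_def algebra_simps)
  show ?thesis unfolding aut_P1_def
  proof (intro conjI exI ballI)
    show "regular_P1 {0, 1} (\<lambda>z. moebius a b c d ` z)" "regular_P1 {0, 1} (\<lambda>z. moebius d (- b) (- c) a ` z)"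
      using moebius_regular assms det by blast+
    fix z assume "z \<in> P1"
    then obtain x where x: "x \<in> hcoords {0, 1}" "z = ppoint x" by (rule P1_E)
    show "moebius d (- b) (- c) a ` moebius a b c d ` z = z"
      "moebius a b c d ` moebius d (- b) (- c) a ` z = z"
      unfolding x(2) moebius_image inv[OF x(1)] by (rule ppoint_scale[OF assms])+
  qed
qed

section \<open>Classes of curves\<close>

text \<open>Composition with \<open>\<phi>\<close> gives one inclusion of the classes and
  composition with its inverse the other.\<close>

lemma reparam_class_eq:
  assumes f0: "f0 \<in> extensional P1" and fg: "(f0, f) \<in> reparam"
  shows "reparam `` {f} = reparam `` {f0}"
proof -
  obtain \<phi> where \<phi>: "aut_P1 \<phi>" "f = compose P1 f0 \<phi>" using fg by (auto simp: reparam_def)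
  obtain \<psi> where \<psi>: "aut_P1 \<psi>" "\<forall>z\<in>P1. \<psi> (\<phi> z) = z" "\<forall>z\<in>P1. \<phi> (\<psi> z) = z"
    using aut_P1_inverse[OF \<phi>(1)] by blast
  show ?thesis
  proof
    show "reparam `` {f} \<subseteq> reparam `` {f0}"
    proof
      fix g assume "g \<in> reparam `` {f}"
      then obtain \<theta> where \<theta>: "aut_P1 \<theta>" "g = compose P1 f \<theta>" by (auto simp: reparam_def)
      have "g = compose P1 f0 (\<lambda>z. \<phi> (\<theta> z))"
        using aut_P1_in_P1[OF \<theta>(1)] by (auto simp: \<theta>(2) \<phi>(2) compose_def fun_eq_iff)
      then show "g \<in> reparam `` {f0}" using aut_P1_compose[OF \<phi>(1) \<theta>(1)] by (auto simp: reparam_def)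
    qed
    show "reparam `` {f0} \<subseteq> reparam `` {f}"
    proof
      fix g assume "g \<in> reparam `` {f0}"
      then obtain \<theta> where \<theta>: "aut_P1 \<theta>" "g = compose P1 f0 \<theta>" by (auto simp: reparam_def)
      have "g = compose P1 f (\<lambda>z. \<psi> (\<theta> z))"
        using aut_P1_in_P1[OF \<theta>(1)] aut_P1_in_P1[OF \<psi>(1)] \<psi>(3)
        by (auto simp: \<theta>(2) \<phi>(2) compose_def fun_eq_iff)
      then show "g \<in> reparam `` {f}" using aut_P1_compose[OF \<psi>(1) \<theta>(1)] by (auto simp: reparam_def)
    qed
  qed
qed

lemma rational_curve_extensional: "rational_curve l d f \<Longrightarrow> f \<in> extensional P1"
  by (simp add: rational_curve_def PiE_def)

lemma curves_meeting_empty: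
  assumes "\<And>f. rational_curve l d f \<Longrightarrow> f ` P1 \<inter> A \<noteq> {} \<Longrightarrow> f ` P1 \<inter> B \<noteq> {} \<Longrightarrow> f ` P1 \<inter> C \<noteq> {} \<Longrightarrow> False"
  shows "curves_meeting l d A B C = {}"
proof -
  have "{f. rational_curve l d f \<and> f ` P1 \<inter> A \<noteq> {} \<and> f ` P1 \<inter> B \<noteq> {} \<and> f ` P1 \<inter> C \<noteq> {}} = {}"
    using assms by blast
  then show ?thesis by (simp only: curves_meeting_def quotient_empty)
qed

lemma curves_meeting_single:
  assumes f0: "rational_curve l d f0" "f0 ` P1 \<inter> A \<noteq> {}" "f0 ` P1 \<inter> B \<noteq> {}" "f0 ` P1 \<inter> C \<noteq> {}"
    and uniq: "\<And>f. rational_curve l d f \<Longrightarrow> f ` P1 \<inter> A \<noteq> {} \<Longrightarrow> f ` P1 \<inter> B \<noteq> {} \<Longrightarrow> f ` P1 \<inter> C \<noteq> {} \<Longrightarrow>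
      (f0, f) \<in> reparam"
  shows "curves_meeting l d A B C = {reparam `` {f0}}"
proof -
  let ?R = "{f. rational_curve l d f \<and> f ` P1 \<inter> A \<noteq> {} \<and> f ` P1 \<inter> B \<noteq> {} \<and> f ` P1 \<inter> C \<noteq> {}}"
  have "reparam `` {f} = reparam `` {f0}" if "f \<in> ?R" for f
    using that by (intro reparam_class_eq uniq rational_curve_extensional[OF f0(1)]) auto
  moreover have "f0 \<in> ?R" using f0 by simp
  ultimately show ?thesis unfolding curves_meeting_def quotient_def by blast
qed

lemma compose_const_aut:
  assumes "aut_P1 \<phi>"
  shows "compose P1 (\<lambda>z\<in>P1. V) \<phi> = (\<lambda>z\<in>P1. V)"
  using aut_P1_in_P1[OF assms] by (auto simp: compose_def fun_eq_iff)

section \<open>Lines in the Grassmannian\<close>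

text \<open>Rows are counted from 0 but \<open>u\<close> from 1: row 0 moves between
  \<open>u 1\<close> and \<open>u (l + 1)\<close>, and the other rows are
  \<open>u 2, ..., u l\<close>. The two ends of the line are then the spans of the first and of the
  last \<open>l\<close> vectors.\<close>

definition line_rows :: "nat \<Rightarrow> (nat \<Rightarrow> complex^'n) \<Rightarrow> nat \<Rightarrow> (nat \<Rightarrow> complex) \<Rightarrow> complex^'n" where
  "line_rows l u i x = (if i = 0 then x 0 *s u 1 + x 1 *s u (l + 1) else u (i + 1))"

definition line_curve :: "nat \<Rightarrow> (nat \<Rightarrow> complex^'n) \<Rightarrow> ppt1 \<Rightarrow> (complex^'n) set" where
  "line_curve l u = curve_of_rows l (line_rows l u)"

lemma line_rows_indep:
  fixes u :: "nat \<Rightarrow> complex^'n::finite"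
  assumes u: "indep_on {1..l + 1} u" and l: "l \<ge> 1" and x: "x \<in> hcoords {0, 1}"
  shows "indep_on {..<l} (\<lambda>i. line_rows l u i x)"
  unfolding indep_on_def
proof (intro allI impI ballI)
  fix c i assume c: "(\<Sum>i<l. c i *s line_rows l u i x) = 0" and i: "i \<in> {..<l}"
  \<comment> \<open>The relation between the rows, read as a relation between the
    \<open>l + 1\<close> vectors \<open>u j\<close>.\<close>
  define \<gamma> where "\<gamma> j = (if j = 1 then c 0 * x 0 else if j = l + 1 then c 0 * x 1 else c (j - 1))" for j
  have A: "{..<l} = insert 0 {1..<l}" using l by auto
  have B: "{1..l + 1} = insert 1 (insert (l + 1) {2..l})" using l by auto
  have im: "{2..l} = Suc ` {1..<l}" by (simp add: image_Suc_atLeastLessThan atLeastLessThanSuc_atLeastAtMost numeral_2_eq_2)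
  have "(\<Sum>j\<in>{2..l}. \<gamma> j *s u j) = (\<Sum>i\<in>{1..<l}. c i *s line_rows l u i x)"
    unfolding im by (subst sum.reindex) (auto intro!: sum.cong simp: \<gamma>_def line_rows_def)
  moreover have "(\<Sum>i<l. c i *s line_rows l u i x) =
      c 0 *s line_rows l u 0 x + (\<Sum>i\<in>{1..<l}. c i *s line_rows l u i x)"
    unfolding A by (subst sum.insert) auto
  moreover have "c 0 *s line_rows l u 0 x = \<gamma> 1 *s u 1 + \<gamma> (l + 1) *s u (l + 1)"
    using l by (simp add: \<gamma>_def line_rows_def vec.scale_right_distrib)
  moreover have "(\<Sum>j\<in>{1..l + 1}. \<gamma> j *s u j) =
      (\<gamma> 1 *s u 1 + \<gamma> (l + 1) *s u (l + 1)) + (\<Sum>j\<in>{2..l}. \<gamma> j *s u j)"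
    unfolding B using l by (subst sum.insert; simp)+
  ultimately have "(\<Sum>j\<in>{1..l + 1}. \<gamma> j *s u j) = 0" using c by (simp only:)
  then have z: "\<gamma> j = 0" if "j \<in> {1..l + 1}" for j using indep_onD[OF u] that by blast
  show "c i = 0"
  proof (cases "i = 0")
    case True
    have "c 0 * x 0 = 0" "c 0 * x 1 = 0" using z[of 1] z[of "l + 1"] l by (auto simp: \<gamma>_def)
    then show ?thesis using x True by (auto simp: hcoords_def)
  next
    case False
    then show ?thesis using z[of "i + 1"] i by (auto simp: \<gamma>_def)
  qed
qed

lemma line_rows_forms:
  "row_forms l (\<lambda>i. if i = 0 then 1 else 0) (line_rows l (u :: nat \<Rightarrow> complex^'n::finite))"
  unfolding row_forms_def
proof (intro allI impI)
  fix i j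
  have "binary_form 1 (\<lambda>x. u 1 $ j * x 0 + u (l + 1) $ j * x 1)"
    by (intro binary_form_add binary_form_scale binary_form_coord) auto
  then show "binary_form (if i = 0 then 1 else 0) (\<lambda>x. line_rows l u i x $ j)"
    by (simp add: line_rows_def binary_form_const mult.commute)
qed

lemma line_curve_at:
  fixes u :: "nat \<Rightarrow> complex^'n::finite"
  assumes u: "indep_on {1..l + 1} u" and l: "l \<ge> 1" and x: "x \<in> hcoords {0, 1}"
  shows "line_curve l u (ppoint x) = vec.span (insert (x 0 *s u 1 + x 1 *s u (l + 1)) (u ` {2..l}))"
proof -
  have "curve_by_rows l (\<lambda>i. if i = 0 then 1 else 0) (line_rows l u) (line_curve l u)"
    unfolding line_curve_def by (intro curve_of_rows line_rows_forms line_rows_indep u l)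
  then have "line_curve l u (ppoint x) = vec.span ((\<lambda>i. line_rows l u i x) ` {..<l})"
    using x by (simp add: curve_by_rows_def)
  moreover have "(\<lambda>i. line_rows l u i x) ` {..<l} = insert (line_rows l u 0 x) ((\<lambda>i. line_rows l u i x) ` {1..<l})"
  proof -
    have "{..<l} = insert 0 {1..<l}" using l by auto
    then show ?thesis by (simp only: image_insert)
  qed
  moreover have "(\<lambda>i. line_rows l u i x) ` {1..<l} = u ` (Suc ` {1..<l})"
    unfolding image_image by (rule image_cong[OF refl]) (auto simp: line_rows_def)
  moreover have "Suc ` {1..<l} = {2..l}"
    by (simp add: image_Suc_atLeastLessThan atLeastLessThanSuc_atLeastAtMost numeral_2_eq_2)
  moreover have "line_rows l u 0 x = x 0 *s u 1 + x 1 *s u (l + 1)" by (simp add: line_rows_def)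
  ultimately show ?thesis by (simp only:)
qed

lemma rational_line_curve:
  fixes u :: "nat \<Rightarrow> complex^'n::{finite,linorder}"
  assumes u: "indep_on {1..l + 1} u" and l: "l \<ge> 1"
  shows "rational_curve l 1 (line_curve l u)"
proof -
  have cr: "curve_by_rows l (\<lambda>i. if i = 0 then 1 else 0) (line_rows l u) (line_curve l u)"
    and ex: "line_curve l u \<in> extensional P1"
    unfolding line_curve_def by (intro curve_of_rows[OF line_rows_forms] line_rows_indep u l; assumption)+
  have "(\<Sum>i<l. if i = 0 then 1 else 0 :: nat) = 1" using l by simp
  then show ?thesis using rational_curve_low[OF cr ex] by simp
qed

lemma line_curve_ends:
  fixes u :: "nat \<Rightarrow> complex^'n::finite"
  assumes u: "indep_on {1..l + 1} u" and l: "l \<ge> 1"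
  shows "line_curve l u (ppoint infinity_pt) = vec.span (u ` {1..l})"
    "line_curve l u (ppoint (affine_pt 0)) = vec.span (u ` {2..l + 1})"
proof -
  have 1: "{1..l} = insert 1 {2..l}" and 2: "{2..l + 1} = insert (l + 1) {2..l}" using l by auto
  show "line_curve l u (ppoint infinity_pt) = vec.span (u ` {1..l})"
    unfolding 1 image_insert using line_curve_at[OF u l infinity_pt_hcoords]
    by (simp add: vec.scale_zero_left)
  show "line_curve l u (ppoint (affine_pt 0)) = vec.span (u ` {2..l + 1})"
    unfolding 2 image_insert using line_curve_at[OF u l affine_pt_hcoords[of 0]]
    by (simp add: vec.scale_zero_left)
qed

lemma span_insert_add:
  assumes "z \<in> vec.span A"
  shows "vec.span (insert (y + z) A) = vec.span (insert (y :: 'a::field^'n::finite) A)"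
proof -
  have sub: "vec.span (insert (y + z) A) \<subseteq> vec.span (insert y A)" if "z \<in> vec.span A" for y z
  proof (rule vec.span_minimal)
    have "z \<in> vec.span (insert y A)" using that vec.span_mono[of A "insert y A"] by blast
    then have "y + z \<in> vec.span (insert y A)" by (intro vec.span_add) (auto intro: vec.span_base)
    then show "insert (y + z) A \<subseteq> vec.span (insert y A)" by (auto intro: vec.span_base)
  qed simp
  have "vec.span (insert ((y + z) + (- z)) A) \<subseteq> vec.span (insert (y + z) A)"
    by (rule sub) (use assms vec.span_neg in blast)
  then show ?thesis using sub[OF assms, of y] by simp
qed

lemma singular_kernel:
  fixes a b c d :: complex
  assumes "a * d - b * c = 0"
  obtains x :: "nat \<Rightarrow> complex" where "x \<in> hcoords {0, 1}" "a * x 0 + b * x 1 = 0" "c * x 0 + d * x 1 = 0"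
proof -
  let ?v = "\<lambda>s t i :: nat. if i = 0 then s else if i = 1 then t else 0 :: complex"
  have v: "?v s t \<in> hcoords {0, 1}" if "s \<noteq> 0 \<or> t \<noteq> 0" for s t
    using that by (auto simp: hcoords_def)
  consider "b \<noteq> 0 \<or> a \<noteq> 0" | "a = 0" "b = 0" "d \<noteq> 0 \<or> c \<noteq> 0" | "a = 0" "b = 0" "c = 0" "d = 0" by blast
  then show ?thesis
  proof cases
    case 1
    then show ?thesis using assms by (intro that[of "?v b (- a)"] v) (auto simp: algebra_simps)
  next
    case 2
    then show ?thesis by (intro that[of "?v d (- c)"] v) (auto simp: algebra_simps)
  next
    case 3
    then show ?thesis by (intro that[of "?v 1 0"] v) auto
  qed
qed

(* The two ends of the line determine its kernel; modulo the kernel both curves are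
   parametrisations of the same pencil by linear forms. *)
lemma line_curve_unique:
  fixes u :: "nat \<Rightarrow> complex^'n::{finite,linorder}"
  assumes u: "indep_on {1..l + 1} u" and l: "l \<ge> 1"
    and f: "rational_curve l 1 f" and S: "\<And>z. z \<in> P1 \<Longrightarrow> f z \<subseteq> vec.span (u ` {1..l + 1})"
    and ends: "vec.span (u ` {1..l}) \<in> f ` P1" "vec.span (u ` {2..l + 1}) \<in> f ` P1"
  shows "(line_curve l u, f) \<in> reparam"
proof -
  let ?K = "vec.span (u ` {2..l})"
  obtain K a b where K: "vec.subspace K" "vec.dim K = l - 1"
    and fK: "\<And>x. x \<in> hcoords {0, 1} \<Longrightarrow> f (ppoint x) = vec.span (insert (x 0 *s a + x 1 *s b) K)"
    using rational_curve_1[OF f] by blast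
  have fG: "f z \<in> Gr l" if "z \<in> P1" for z
    using f that by (auto simp: rational_curve_def PiE_def)
  have Kf: "K \<subseteq> f z" if z: "z \<in> P1" for z
  proof -
    obtain x where "x \<in> hcoords {0, 1}" "z = ppoint x" using z by (rule P1_E)
    then show ?thesis using fK[of x] vec.span_superset[of "insert (x 0 *s a + x 1 *s b) K"] by blast
  qed
  have "K \<subseteq> vec.span (u ` {1..l}) \<inter> vec.span (u ` {2..l + 1})" using Kf ends by blast
  also have "\<dots> = vec.span (u ` ({1..l} \<inter> {2..l + 1}))"
    by (rule span_image_Int[OF _ u]) auto
  also have "{1..l} \<inter> {2..l + 1} = {2..l}" by auto
  finally have sub: "K \<subseteq> ?K" .
  have "indep_on {2..l} u" by (rule indep_on_subset[OF _ u]) auto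
  then have dK: "vec.dim ?K = l - 1" using dim_span_indep_on[of "{2..l}" u] by simp
  have KK: "K = ?K" using vec.subspace_dim_equal[OF K(1) _ sub] K(2) dK by simp
  have in_f: "x 0 *s a + x 1 *s b \<in> vec.span (u ` {1..l + 1})" if x: "x \<in> hcoords {0, 1}" for x :: "nat \<Rightarrow> complex"
    using S[OF hcoords_in_P1[OF x]] unfolding fK[OF x] by (auto intro: vec.span_base)
  have "a \<in> vec.span (u ` {1..l + 1})"
    using in_f[OF infinity_pt_hcoords] by (simp add: vec.scale_zero_left)
  then obtain \<alpha> where \<alpha>: "a = (\<Sum>i\<in>{1..l + 1}. \<alpha> i *s u i)" by (rule in_span_imageE) auto
  have "b \<in> vec.span (u ` {1..l + 1})"
    using in_f[OF affine_pt_hcoords[of 0]] by (simp add: vec.scale_zero_left)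
  then obtain \<beta> where \<beta>: "b = (\<Sum>i\<in>{1..l + 1}. \<beta> i *s u i)" by (rule in_span_imageE) auto
  have split: "(\<Sum>i\<in>{1..l + 1}. \<xi> i *s u i) =
      (\<xi> 1 *s u 1 + \<xi> (l + 1) *s u (l + 1)) + (\<Sum>i\<in>{2..l}. \<xi> i *s u i)" for \<xi>
  proof -
    have B: "{1..l + 1} = insert 1 (insert (l + 1) {2..l})" using l by auto
    show ?thesis unfolding B using l by (simp add: sum.insert_if add.assoc)
  qed
  \<comment> \<open>The components of \<open>x 0 *s a + x 1 *s b\<close> along \<open>u 1\<close>
    and \<open>u (l + 1)\<close>; the others lie in \<open>?K\<close> and do not change the
    span.\<close>
  let ?M = "moebius (\<alpha> 1) (\<beta> 1) (\<alpha> (l + 1)) (\<beta> (l + 1))"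
  have fM: "f (ppoint x) = vec.span (insert (?M x 0 *s u 1 + ?M x 1 *s u (l + 1)) (u ` {2..l}))"
    if x: "x \<in> hcoords {0, 1}" for x
  proof -
    let ?\<kappa> = "\<Sum>i\<in>{2..l}. (x 0 * \<alpha> i + x 1 * \<beta> i) *s u i"
    have "x 0 *s a + x 1 *s b = (\<Sum>i\<in>{1..l + 1}. (x 0 * \<alpha> i + x 1 * \<beta> i) *s u i)"
      unfolding \<alpha> \<beta> by (simp only: vec.scale_sum_right vec.scale_scale vec.scale_left_distrib sum.distrib)
    also have "\<dots> = (?M x 0 *s u 1 + ?M x 1 *s u (l + 1)) + ?\<kappa>"
      unfolding split by (simp add: moebius_def mult.commute)
    finally have e: "x 0 *s a + x 1 *s b = (?M x 0 *s u 1 + ?M x 1 *s u (l + 1)) + ?\<kappa>" .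
    have "?\<kappa> \<in> vec.span (u ` {2..l})" by (rule sum_in_span_image) simp
    then show ?thesis unfolding fK[OF x] KK span_insert_span e by (rule span_insert_add)
  qed
  \<comment> \<open>At a point annihilated by a singular matrix, \<open>f\<close> would be only
    \<open>?K\<close>, of dimension \<open>l - 1\<close>.\<close>
  have det: "\<alpha> 1 * \<beta> (l + 1) - \<beta> 1 * \<alpha> (l + 1) \<noteq> 0"
  proof
    assume "\<alpha> 1 * \<beta> (l + 1) - \<beta> 1 * \<alpha> (l + 1) = 0"
    then obtain x :: "nat \<Rightarrow> complex" where x: "x \<in> hcoords {0, 1}" "\<alpha> 1 * x 0 + \<beta> 1 * x 1 = 0"
      "\<alpha> (l + 1) * x 0 + \<beta> (l + 1) * x 1 = 0" by (rule singular_kernel)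
    then have "f (ppoint x) = ?K"
      unfolding fM[OF x(1)] by (simp add: moebius_def vec.scale_zero_left)
    then show False using fG[OF hcoords_in_P1[OF x(1)]] dK l by (simp add: Gr_def)
  qed
  have "f = compose P1 (line_curve l u) (\<lambda>z. ?M ` z)"
  proof
    fix z
    show "f z = compose P1 (line_curve l u) (\<lambda>z. ?M ` z) z"
    proof (cases "z \<in> P1")
      case True
      then obtain x where x: "x \<in> hcoords {0, 1}" "z = ppoint x" by (rule P1_E)
      have "compose P1 (line_curve l u) (\<lambda>z. ?M ` z) z = line_curve l u (ppoint (?M x))"
        unfolding compose_eq[OF True] by (simp only: x(2) moebius_image)
      then show ?thesis
        unfolding line_curve_at[OF u l moebius_hcoords[OF det x(1)]] unfolding x(2) fM[OF x(1)] ..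
    next
      case False
      have "compose P1 (line_curve l u) (\<lambda>z. ?M ` z) z = undefined"
        using False by (simp only: compose_def restrict_apply if_False)
      moreover have "f z = undefined"
        using rational_curve_extensional[OF f] False by (rule extensional_arb)
      ultimately show ?thesis by (simp only:)
    qed
  qed
  then show ?thesis
    unfolding reparam_def by (intro CollectI case_prodI exI conjI[rotated]) (assumption, rule aut_P1_moebius[OF det])
qed

section \<open>Partitions and intervals\<close>

lemma rect_partition_length: "lam \<in> rect_partitions l k \<Longrightarrow> length lam = l"
  by (simp add: rect_partitions_def is_partition_def)

lemma part_le:
  assumes "lam \<in> rect_partitions l k" "i \<in> {1..l}"
  shows "part lam i \<le> k"
  using assms by (auto simp: rect_partitions_def is_partition_def part_def)

lemma part_antimono:
  assumes "lam \<in> rect_partitions l k" "i \<in> {1..<l}"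
  shows "part lam (i + 1) \<le> part lam i"
  using assms sorted_wrt_nth_less[of "(\<ge>)" lam "i - 1" i]
  by (auto simp: rect_partitions_def is_partition_def part_def)

lemma sum_list_part:
  assumes "length lam = l"
  shows "sum_list lam = (\<Sum>i\<in>{1..l}. part lam i)"
proof -
  have "sum_list lam = (\<Sum>i<l. lam ! i)" using assms by (simp add: sum_list_sum_nth atLeast0LessThan)
  also have "\<dots> = (\<Sum>i\<in>Suc ` {..<l}. part lam i)"
    by (subst sum.reindex) (auto simp: part_def)
  also have "Suc ` {..<l} = {1..l}" by (simp add: image_Suc_lessThan)
  finally show ?thesis .
qed

lemma part_row: "i \<in> {1..l} \<Longrightarrow> part (row_partition l p) i = (if i = 1 then p else 0)"
  by (auto simp: part_def row_partition_def nth_Cons split: nat.split)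

lemma part_dual:
  assumes "length nu = l" "i \<in> {1..l}"
  shows "part (dual_partition k nu) i = k - part nu (l + 1 - i)"
  using assms by (auto simp: part_def dual_partition_def rev_nth)

(* For an (l + d)-dimensional space containing a point of each Schubert variety, the i-th
   intersection condition with G confines to indices below top_ix, the one with H to indices from
   bot_ix on; the conditions for i > l, respectively i \<le> d, hold for dimension reasons. *)
definition top_ix :: "nat \<Rightarrow> nat \<Rightarrow> nat list \<Rightarrow> nat \<Rightarrow> nat \<Rightarrow> nat" where
  "top_ix l k lam d i = (if i \<le> l then k + i - part lam i else k + i - d)"

definition bot_ix :: "nat \<Rightarrow> nat list \<Rightarrow> nat \<Rightarrow> nat \<Rightarrow> nat" where
  "bot_ix k nu d i = (if i \<le> d then i - 1 else k + i - (d + 1) - part nu (i - d))"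

lemma sum_split_at: "(\<Sum>i\<in>{1..l + d}. f i) = (\<Sum>i\<in>{1..l}. f i) + (\<Sum>j\<in>{1..d}. f (l + j :: nat) :: int)"
proof -
  have "(\<Sum>i\<in>{1..l + d}. f i) = (\<Sum>i\<in>{1..l}. f i) + (\<Sum>i\<in>{l + 1..l + d}. f i)"
    by (rule sum.ub_add_nat) simp
  also have "(\<Sum>i\<in>{l + 1..l + d}. f i) = (\<Sum>j\<in>{1..d}. f (l + j))"
    using sum.shift_bounds_cl_nat_ivl[of f 1 l d] by (simp add: add.commute)
  finally show ?thesis .
qed

text \<open>All terms except the parts form arithmetic progressions; the top indices are split after
  \<open>l\<close> terms and the bottom ones after \<open>d\<close>. With
  \<open>|nu| + d (l + k) = |lam| + p\<close> the total becomes
  \<open>l + p + d - d * d\<close>.\<close>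

lemma sum_interval_sizes:
  assumes lam: "lam \<in> rect_partitions l k" and nu: "nu \<in> rect_partitions l k" and d: "d \<le> k"
    and le: "\<And>i. i \<in> {1..l + d} \<Longrightarrow> bot_ix k nu d i \<le> top_ix l k lam d i"
  shows "int (\<Sum>i\<in>{1..l + d}. top_ix l k lam d i - bot_ix k nu d i) + int (sum_list lam) =
    int l + int (sum_list nu) + int d * (int l + int k + 1 - int d)"
proof -
  have "int (\<Sum>i\<in>{1..l + d}. top_ix l k lam d i - bot_ix k nu d i) =
      (\<Sum>i\<in>{1..l + d}. int (top_ix l k lam d i)) - (\<Sum>i\<in>{1..l + d}. int (bot_ix k nu d i))"
    unfolding of_nat_sum sum_subtractf[symmetric] using le by (intro sum.cong) auto
  moreover have "(\<Sum>i\<in>{1..l + d}. int (top_ix l k lam d i)) =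
      (\<Sum>i\<in>{1..l}. int k + int i - int (part lam i)) + (\<Sum>j\<in>{1..d}. int k + int l + int j - int d)"
    unfolding sum_split_at using part_le[OF lam] d
    by (intro arg_cong2[of _ _ _ _ "(+)"] sum.cong) (auto simp: top_ix_def of_nat_diff trans_le_add1)
  moreover have "(\<Sum>i\<in>{1..l + d}. int (bot_ix k nu d i)) =
      (\<Sum>j\<in>{1..d}. int j - 1) + (\<Sum>i\<in>{1..l}. int k + int i - 1 - int (part nu i))"
  proof -
    have "int (bot_ix k nu d (d + i)) = int k + int i - 1 - int (part nu i)" if "i \<in> {1..l}" for i
      using part_le[OF nu that] that by (auto simp: bot_ix_def)
    moreover have "int (bot_ix k nu d j) = int j - 1" if "j \<in> {1..d}" for j
      using that by (auto simp: bot_ix_def)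
    ultimately show ?thesis
      unfolding add.commute[of l d] sum_split_at
      by (intro arg_cong2[of _ _ _ _ "(+)"] sum.cong) auto
  qed
  moreover have "int (sum_list lam) = (\<Sum>i\<in>{1..l}. int (part lam i))"
    "int (sum_list nu) = (\<Sum>i\<in>{1..l}. int (part nu i))"
    using sum_list_part[OF rect_partition_length] lam nu by simp_all
  ultimately show ?thesis
    by (simp add: sum.distrib sum_subtractf algebra_simps)
qed

text \<open>An element of two of the sets is counted twice by the sum of the cardinalities, which
  then exceeds that of the union.\<close>

lemma card_UN_disjoint_if:
  fixes J :: "'i \<Rightarrow> 'b set"
  assumes "finite A" "\<And>i. i \<in> A \<Longrightarrow> finite (J i)" "(\<Sum>i\<in>A. card (J i)) \<le> card (\<Union>i\<in>A. J i)"
    and ij: "i \<in> A" "j \<in> A" "i \<noteq> j"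
  shows "J i \<inter> J j = {}"
proof (rule ccontr)
  assume "J i \<inter> J j \<noteq> {}"
  then obtain c where c: "c \<in> J i" "c \<in> J j" by blast
  have "(\<Union>i\<in>A. J i) = (J i - {c}) \<union> (\<Union>m\<in>A - {i}. J m)" using c ij by blast
  then have "card (\<Union>i\<in>A. J i) \<le> card (J i - {c}) + card (\<Union>m\<in>A - {i}. J m)"
    by (simp add: card_Un_le)
  also have "card (\<Union>m\<in>A - {i}. J m) \<le> (\<Sum>m\<in>A - {i}. card (J m))"
    using assms(1) by (intro card_UN_le) simp
  also have "card (J i - {c}) < card (J i)"
    using assms(2)[OF ij(1)] c(1) by (rule card_Diff1_less)
  also have "card (J i) + (\<Sum>m\<in>A - {i}. card (J m)) = (\<Sum>i\<in>A. card (J i))"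
    using assms(1) ij(1) by (simp add: sum.remove)
  finally show False using assms(3) by simp
qed

lemma chain_le:
  fixes a b :: "nat \<Rightarrow> nat"
  assumes "\<And>i. i \<in> {1..m} \<Longrightarrow> a i < b i" "\<And>i. i \<in> {1..<m} \<Longrightarrow> b i \<le> a (i + 1)"
    and "1 \<le> i" "i < j" "j \<le> m"
  shows "b i \<le> a j"
  using \<open>i < j\<close> \<open>j \<le> m\<close>
proof (induction j)
  case (Suc j)
  show ?case
  proof (cases "i = j")
    case True
    then show ?thesis using assms(2)[of j] \<open>1 \<le> i\<close> Suc.prems by simp
  next
    case False
    then have "b i \<le> a j" using Suc by simp
    also have "a j < b j" using assms(1)[of j] \<open>1 \<le> i\<close> Suc.prems by simp
    also have "b j \<le> a (Suc j)" using assms(2)[of j] \<open>1 \<le> i\<close> Suc.prems by simp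
    finally show ?thesis by simp
  qed
qed simp

section \<open>Counting points and lines\<close>

text \<open>The interlacing of the first sum for \<open>d = 0\<close> and of the second for
  \<open>d = 1\<close>, with the subtracted 1 moved to the other side because subtraction of
  naturals is truncated. The outer bounds are left to membership in the rectangle.\<close>

definition pieri :: "nat \<Rightarrow> nat \<Rightarrow> nat list \<Rightarrow> nat list \<Rightarrow> bool" where
  "pieri d l lam nu \<longleftrightarrow>
     (\<forall>i\<in>{1..l}. if d = 0 then part lam i \<le> part nu i else part nu i + 1 \<le> part lam i) \<and>
     (\<forall>i\<in>{1..<l}. if d = 0 then part nu (i + 1) \<le> part lam i else part lam (i + 1) \<le> part nu i + 1)"

text \<open>For \<open>d = 0\<close> nonemptiness of the intervals is
  \<open>part lam i \<le> part nu i\<close> and their order is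
  \<open>part nu (i + 1) \<le> part lam i\<close>. For \<open>d = 1\<close> the roles are exchanged:
  the order bounds \<open>nu\<close> from above and nonemptiness bounds it from below, while the
  first and the last interval are never empty.\<close>

lemma pieri_iff_intervals:
  assumes lam: "lam \<in> rect_partitions l k" and nu: "nu \<in> rect_partitions l k"
    and l: "l \<ge> 1" and d: "d \<le> 1" "d \<le> k"
  shows "pieri d l lam nu \<longleftrightarrow>
    (\<forall>i\<in>{1..l + d}. bot_ix k nu d i < top_ix l k lam d i) \<and>
    (\<forall>i\<in>{1..<l + d}. top_ix l k lam d i \<le> bot_ix k nu d (i + 1))"
proof (cases "d = 0")
  case True
  have "bot_ix k nu 0 i < top_ix l k lam 0 i \<longleftrightarrow> part lam i \<le> part nu i" if "i \<in> {1..l}" for i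
    using that part_le[OF lam that] part_le[OF nu that] by (auto simp: bot_ix_def top_ix_def)
  moreover have "top_ix l k lam 0 i \<le> bot_ix k nu 0 (i + 1) \<longleftrightarrow> part nu (i + 1) \<le> part lam i"
    if "i \<in> {1..<l}" for i
    using that part_le[OF lam, of i] part_le[OF nu, of "i + 1"] by (auto simp: bot_ix_def top_ix_def)
  ultimately show ?thesis using True by (simp add: pieri_def)
next
  case False
  then have d1: "d = 1" using d by simp
  have a: "bot_ix k nu 1 (i + 1) < top_ix l k lam 1 (i + 1) \<longleftrightarrow> part lam (i + 1) \<le> part nu i + 1"
    if "i \<in> {1..<l}" for i
    using that part_le[OF lam, of "i + 1"] part_le[OF nu, of i] by (auto simp: bot_ix_def top_ix_def)
  have first: "bot_ix k nu 1 1 < top_ix l k lam 1 1" using part_le[OF lam, of 1] l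
    by (auto simp: bot_ix_def top_ix_def)
  have last: "bot_ix k nu 1 (l + 1) < top_ix l k lam 1 (l + 1)" using l d d1
    by (auto simp: bot_ix_def top_ix_def)
  have "i = 1 \<or> i = l + 1 \<or> (\<exists>j\<in>{1..<l}. i = j + 1)" if "i \<in> {1..l + 1}" for i
    using that by (auto intro!: bexI[of _ "i - 1"])
  then have A: "(\<forall>i\<in>{1..l + 1}. bot_ix k nu 1 i < top_ix l k lam 1 i) \<longleftrightarrow>
      (\<forall>i\<in>{1..<l}. part lam (i + 1) \<le> part nu i + 1)"
    using a first last by fastforce
  have "top_ix l k lam 1 i \<le> bot_ix k nu 1 (i + 1) \<longleftrightarrow> part nu i + 1 \<le> part lam i" if "i \<in> {1..l}" for i
    using that part_le[OF lam, of i] part_le[OF nu, of i] by (auto simp: bot_ix_def top_ix_def)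
  then have "(\<forall>i\<in>{1..<l + 1}. top_ix l k lam 1 i \<le> bot_ix k nu 1 (i + 1)) \<longleftrightarrow>
      (\<forall>i\<in>{1..l}. part nu i + 1 \<le> part lam i)"
    by (simp add: atLeastLessThanSuc_atLeastAtMost)
  then show ?thesis using A d1 by (auto simp: pieri_def)
qed

lemma bot_ix_mono:
  assumes nu: "nu \<in> rect_partitions l k" and d: "d \<le> 1" and i: "i \<in> {1..<l + d}"
  shows "bot_ix k nu d i \<le> bot_ix k nu d (i + 1)"
proof (cases "i \<le> d")
  case True
  then show ?thesis using d i by (auto simp: bot_ix_def)
next
  case False
  then have "i - d \<in> {1..<l}" using i by auto
  from part_antimono[OF nu this] have "part nu (i - d + 1) \<le> part nu (i - d)" .
  then show ?thesis using False by (auto simp: bot_ix_def Suc_diff_le)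
qed

context transversal_flags
begin

section \<open>Schubert conditions in coordinates\<close>

lemma dim_Int_UNIV:
  fixes V W :: "(complex^'n::{finite,linorder}) set"
  assumes "vec.subspace V" "vec.subspace W"
  shows "vec.dim V + vec.dim W \<le> vec.dim (V \<inter> W) + CARD('n)"
  using dim_Int_ge[OF assms, of UNIV] by (simp only: vec_dim_card subset_UNIV vec.subspace_UNIV)

text \<open>Only the first condition is restrictive: for \<open>i > 1\<close> the member
  \<open>F (k + i)\<close> has codimension \<open>l - i\<close>, so it meets every
  \<open>l\<close>-dimensional subspace in dimension at least \<open>i\<close>.\<close>

lemma row_schubert:
  assumes n: "CARD('n) = l + k" and l: "l \<ge> 1" and p: "p \<le> k"
  shows "V \<in> schubert_variety l k (row_partition l p) F \<longleftrightarrow>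
    V \<in> Gr l \<and> (\<exists>x\<in>V. x \<in> F (k + 1 - p) \<and> x \<noteq> 0)"
proof
  assume V: "V \<in> schubert_variety l k (row_partition l p) F"
  then have "V \<in> Gr l" by (simp add: schubert_variety_def)
  moreover have "vec.dim (V \<inter> F (k + 1 - p)) \<ge> 1"
    using V l part_row[of 1 l p] by (auto simp: schubert_variety_def dest!: bspec[of _ _ 1])
  ultimately show "V \<in> Gr l \<and> (\<exists>x\<in>V. x \<in> F (k + 1 - p) \<and> x \<noteq> 0)"
    by (meson IntE dim_pos_obtains)
next
  assume V: "V \<in> Gr l \<and> (\<exists>x\<in>V. x \<in> F (k + 1 - p) \<and> x \<noteq> 0)"
  have "vec.dim (V \<inter> F (k + i - part (row_partition l p) i)) \<ge> i" if i: "i \<in> {1..l}" for i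
  proof (cases "i = 1")
    case True
    then show ?thesis using V part_row[OF i] dim_ge_1 by (metis IntI)
  next
    case False
    then have "part (row_partition l p) i = 0" using part_row[OF i] by simp
    moreover have "vec.dim V + vec.dim (F (k + i)) \<le> vec.dim (V \<inter> F (k + i)) + CARD('n)"
      using V i n by (intro dim_Int_UNIV F_subspace) (auto simp: Gr_def)
    ultimately show ?thesis using V i n F_dim[of "k + i"] by (auto simp: Gr_def)
  qed
  then show "V \<in> schubert_variety l k (row_partition l p) F" using V by (simp add: schubert_variety_def)
qed

lemma lam_schubert:
  assumes n: "CARD('n) = l + k"
  shows "V \<in> schubert_variety l k lam G \<longleftrightarrow>
    V \<in> Gr l \<and> (\<forall>i\<in>{1..l}. vec.dim (V \<inter> E {..<k + i - part lam i}) \<ge> i)"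
proof -
  have "G (k + i - part lam i) = E {..<k + i - part lam i}" if "i \<in> {1..l}" for i
    using that n by (intro G_eq) auto
  then show ?thesis by (simp add: schubert_variety_def)
qed

text \<open>The conditions are read in reverse order. For the index \<open>l + 1 - i\<close> the
  member of \<open>H\<close> has dimension \<open>l + 1 - i + part nu i\<close>, and its complement
  in \<open>n\<close> is the index at which the interval begins.\<close>

lemma dual_schubert:
  assumes n: "CARD('n) = l + k" and nu: "nu \<in> rect_partitions l k"
  shows "V \<in> schubert_variety l k (dual_partition k nu) H \<longleftrightarrow>
    V \<in> Gr l \<and> (\<forall>i\<in>{1..l}. vec.dim (V \<inter> E {k + i - 1 - part nu i..<CARD('n)}) \<ge> l + 1 - i)"
proof -
  let ?P = "\<lambda>j. vec.dim (V \<inter> H (k + j - part (dual_partition k nu) j)) \<ge> j"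
  have key: "?P (l + 1 - i) \<longleftrightarrow> vec.dim (V \<inter> E {k + i - 1 - part nu i..<CARD('n)}) \<ge> l + 1 - i"
    if i: "i \<in> {1..l}" for i
  proof -
    have pi: "part nu i \<le> k" by (rule part_le[OF nu i])
    have "l + 1 - i \<in> {1..l}" "l + 1 - (l + 1 - i) = i" using i by auto
    then have "part (dual_partition k nu) (l + 1 - i) = k - part nu i"
      using part_dual[OF rect_partition_length[OF nu]] by simp
    then have "k + (l + 1 - i) - part (dual_partition k nu) (l + 1 - i) = l + 1 - i + part nu i"
      using pi by simp
    moreover have "H (l + 1 - i + part nu i) = E {CARD('n) - (l + 1 - i + part nu i)..<CARD('n)}"
      using i pi n by (intro H_eq) auto
    moreover have "CARD('n) - (l + 1 - i + part nu i) = k + i - 1 - part nu i" using i n by auto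
    ultimately show ?thesis by simp
  qed
  have "(\<forall>j\<in>{1..l}. ?P j) \<longleftrightarrow> (\<forall>i\<in>{1..l}. ?P (l + 1 - i))"
  proof
    assume a: "\<forall>i\<in>{1..l}. ?P (l + 1 - i)"
    show "\<forall>j\<in>{1..l}. ?P j"
    proof
      fix j assume "j \<in> {1..l}"
      then have "l + 1 - j \<in> {1..l}" "l + 1 - (l + 1 - j) = j" by auto
      then show "?P j" using a by metis
    qed
  next
    assume a: "\<forall>j\<in>{1..l}. ?P j"
    show "\<forall>i\<in>{1..l}. ?P (l + 1 - i)"
    proof
      fix i assume "i \<in> {1..l}"
      then have "l + 1 - i \<in> {1..l}" by auto
      with a show "?P (l + 1 - i)" by (rule bspec)
    qed
  qed
  then show ?thesis using key by (simp add: schubert_variety_def)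
qed

lemma incidence_intervals:
  assumes n: "CARD('n) = l + k" and l: "l \<ge> 1"
    and lam: "lam \<in> rect_partitions l k" and nu: "nu \<in> rect_partitions l k"
    and p: "p \<le> k" and d: "d \<le> k"
    and S: "vec.subspace S" "vec.dim S = l + d"
    and V1: "V1 \<in> schubert_variety l k (row_partition l p) F" "V1 \<subseteq> S"
    and V2: "V2 \<in> schubert_variety l k lam G" "V2 \<subseteq> S"
    and V3: "V3 \<in> schubert_variety l k (dual_partition k nu) H" "V3 \<subseteq> S"
  shows "\<And>i. i \<in> {1..l + d} \<Longrightarrow> \<exists>x\<in>S. x \<in> E {bot_ix k nu d i..<top_ix l k lam d i} \<and> x \<noteq> 0"
    and "\<And>i. i \<in> {1..l + d} \<Longrightarrow> bot_ix k nu d i < top_ix l k lam d i"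
    and "\<exists>x\<in>S. x \<in> F (k + 1 - p) \<and> x \<noteq> 0"
    and "CARD('n) < k + 1 - p + card (\<Union>i\<in>{1..l + d}. {bot_ix k nu d i..<top_ix l k lam d i})"
    and "CARD('n) < k + 1 - d + card (\<Union>i\<in>{1..l + d}. {bot_ix k nu d i..<top_ix l k lam d i})"
proof -
  let ?top = "top_ix l k lam d" and ?bot = "bot_ix k nu d" and ?m = "l + d"
  let ?I = "\<Union>i\<in>{1..?m}. {?bot i..<?top i}"
  have topn: "?top i \<le> CARD('n)" if "i \<in> {1..?m}" for i
    using that n by (auto simp: top_ix_def)
  have botn: "?bot i \<le> CARD('n)" if "i \<in> {1..?m}" for i
    using that n d by (auto simp: bot_ix_def)
  have dG: "vec.dim (S \<inter> E {..<?top i}) \<ge> i" if i: "i \<in> {1..?m}" for i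
  proof (cases "i \<le> l")
    case True
    then have "i \<le> vec.dim (V2 \<inter> E {..<?top i})"
      using V2(1) i unfolding lam_schubert[OF n] top_ix_def by auto
    also have "\<dots> \<le> vec.dim (S \<inter> E {..<?top i})" using V2(2) by (intro vec.dim_subset) blast
    finally show ?thesis .
  next
    case False
    then have "?top i = k + i - d" by (simp add: top_ix_def)
    moreover have "vec.dim (E {..<?top i}) = ?top i" using topn[OF i] by (subst dim_E) auto
    \<comment> \<open>Here \<open>(l + d) + (k + i - d) - n = i\<close>.\<close>
    moreover have "vec.dim S + vec.dim (E {..<?top i}) \<le> vec.dim (S \<inter> E {..<?top i}) + CARD('n)"
      by (intro dim_Int_UNIV S subspace_E)
    ultimately show ?thesis using S(2) n d by linarith
  qed
  have dH: "vec.dim (S \<inter> E {?bot i..<CARD('n)}) \<ge> ?m + 1 - i" if i: "i \<in> {1..?m}" for i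
  proof (cases "i \<le> d")
    case True
    then have "?bot i = i - 1" by (simp add: bot_ix_def)
    moreover have "vec.dim (E {?bot i..<CARD('n)}) = CARD('n) - ?bot i" by (subst dim_E) auto
    \<comment> \<open>The coordinate subspace has codimension \<open>i - 1\<close>, so at least
      \<open>l + d + 1 - i\<close> dimensions remain.\<close>
    moreover have "vec.dim S + vec.dim (E {?bot i..<CARD('n)}) \<le> vec.dim (S \<inter> E {?bot i..<CARD('n)}) + CARD('n)"
      by (intro dim_Int_UNIV S subspace_E)
    moreover have "1 \<le> i" "i \<le> ?m" using i by auto
    ultimately show ?thesis using S(2) botn[OF i] by linarith
  next
    case False
    \<comment> \<open>Passing from dimension \<open>l\<close> to \<open>l + d\<close> shifts the
      conditions for \<open>H\<close> by \<open>d\<close>; the required dimension is the same number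
      \<open>l + 1 - j\<close>.\<close>
    define j where "j = i - d"
    have j: "j \<in> {1..l}" "i = j + d" using False i by (auto simp: j_def)
    have "?bot i = k + j - 1 - part nu j" using False by (simp add: bot_ix_def j(2))
    moreover have "?m + 1 - i = l + 1 - j" using j by simp
    moreover have "l + 1 - j \<le> vec.dim (V3 \<inter> E {k + j - 1 - part nu j..<CARD('n)})"
      using V3(1) j(1) unfolding dual_schubert[OF n nu] by blast
    moreover have "vec.dim (V3 \<inter> E {?bot i..<CARD('n)}) \<le> vec.dim (S \<inter> E {?bot i..<CARD('n)})"
      using V3(2) by (intro vec.dim_subset) blast
    ultimately show ?thesis by simp
  qed
  show 1: "\<exists>x\<in>S. x \<in> E {?bot i..<?top i} \<and> x \<noteq> 0" if i: "i \<in> {1..?m}" for i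
    using subspace_meets_interval[OF S i topn[OF i] dG[OF i] dH[OF i]] by blast
  show "?bot i < ?top i" if i: "i \<in> {1..?m}" for i
  proof (rule ccontr)
    assume "\<not> ?thesis"
    then have "{?bot i..<?top i} = {}" by simp
    then show False using 1[OF i] by (simp only: E_empty) blast
  qed
  have SI: "S \<subseteq> E ?I"
    by (rule subspace_in_intervals[OF S topn botn dG dH])
  have IN: "?I \<subseteq> {..<CARD('n)}" using topn by (meson UN_least atLeastLessThan_iff lessThan_iff order_less_le_trans subsetI)
  \<comment> \<open>Since \<open>S\<close> lies in \<open>E ?I\<close>, a nonzero vector of
    \<open>S\<close> in \<open>F r\<close> contradicts transversality unless the dimensions exceed
    \<open>n\<close>.\<close>
  have big: "CARD('n) < r + card ?I" if "\<exists>x\<in>S. x \<in> F r \<and> x \<noteq> 0" for r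
    using F_Int_E_trivial[OF IN, of r] that SI by (meson not_le_imp_less subsetD)
  show 3: "\<exists>x\<in>S. x \<in> F (k + 1 - p) \<and> x \<noteq> 0"
    using V1 unfolding row_schubert[OF n l p] by blast
  show "CARD('n) < k + 1 - p + card ?I" by (rule big[OF 3])
  have "vec.dim S + vec.dim (F (k + 1 - d)) \<le> vec.dim (S \<inter> F (k + 1 - d)) + CARD('n)"
    using n l by (intro dim_Int_UNIV S F_subspace) auto
  moreover have "vec.dim (F (k + 1 - d)) = k + 1 - d" using n l by (intro F_dim) auto
  ultimately have "vec.dim (S \<inter> F (k + 1 - d)) \<ge> 1" using S(2) n d by linarith
  then have "\<exists>x\<in>S. x \<in> F (k + 1 - d) \<and> x \<noteq> 0" by (meson IntE dim_pos_obtains)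
  then show "CARD('n) < k + 1 - d + card ?I" by (rule big)
qed

text \<open>For \<open>d \<le> 1\<close> the union has at least as many elements as the lengths add
  up to, which forces disjointness. The left ends increase weakly, so that disjoint neighbours are
  ordered as \<open>pieri_iff_intervals\<close> requires.\<close>

lemma incidence_pieri:
  assumes n: "CARD('n) = l + k" and l: "l \<ge> 1"
    and lam: "lam \<in> rect_partitions l k" and nu: "nu \<in> rect_partitions l k"
    and p: "p \<le> k" and d: "d \<le> k" and size: "sum_list nu + d * (l + k) = sum_list lam + p"
    and S: "vec.subspace S" "vec.dim S = l + d"
    and V1: "V1 \<in> schubert_variety l k (row_partition l p) F" "V1 \<subseteq> S"
    and V2: "V2 \<in> schubert_variety l k lam G" "V2 \<subseteq> S"
    and V3: "V3 \<in> schubert_variety l k (dual_partition k nu) H" "V3 \<subseteq> S"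
  shows "d \<le> 1" "pieri d l lam nu"
proof -
  let ?top = "top_ix l k lam d" and ?bot = "bot_ix k nu d" and ?m = "l + d"
  let ?J = "\<lambda>i. {?bot i..<?top i}"
  note inc = incidence_intervals[OF n l lam nu p d S V1 V2 V3]
  have le: "?bot i \<le> ?top i" if "i \<in> {1..?m}" for i using inc(2)[OF that] by simp
  define Z where "Z = (\<Sum>i\<in>{1..?m}. ?top i - ?bot i)"
  have "int Z + int (sum_list lam) = int l + int (sum_list nu) + int d * (int l + int k + 1 - int d)"
    unfolding Z_def by (rule sum_interval_sizes[OF lam nu d le])
  moreover have "int (sum_list nu) + int d * (int l + int k) = int (sum_list lam) + int p"
    using arg_cong[OF size, of int] by simp
  ultimately have Z: "int Z = int l + int p + int d - int d * int d" by (simp add: algebra_simps)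
  have sumJ: "(\<Sum>i\<in>{1..?m}. card (?J i)) = Z" by (simp add: Z_def)
  have cU: "card (\<Union>i\<in>{1..?m}. ?J i) \<le> Z" unfolding sumJ[symmetric] by (rule card_UN_le) simp
  have big: "int l + int p \<le> int (card (\<Union>i\<in>{1..?m}. ?J i))"
    using inc(4) n p by linarith
  then have "int d * int d \<le> int d" using cU Z by linarith
  show d1: "d \<le> 1"
  proof (rule ccontr)
    assume "\<not> ?thesis"
    then have "2 * int d \<le> int d * int d" by (intro mult_right_mono) auto
    then show False using \<open>int d * int d \<le> int d\<close> \<open>\<not> d \<le> 1\<close> by linarith
  qed
  then have dd: "int d * int d = int d" by (cases "d = 0") auto
  then have "(\<Sum>i\<in>{1..?m}. card (?J i)) \<le> card (\<Union>i\<in>{1..?m}. ?J i)" using big Z sumJ by linarith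
  then have dj: "?J i \<inter> ?J j = {}" if "i \<in> {1..?m}" "j \<in> {1..?m}" "i \<noteq> j" for i j
    by (intro card_UN_disjoint_if[OF _ _ _ that]) auto
  have "?top i \<le> ?bot (i + 1)" if i: "i \<in> {1..<?m}" for i
  proof (rule ccontr)
    assume "\<not> ?thesis"
    then have "?bot (i + 1) \<in> ?J i" using bot_ix_mono[OF nu d1 i] by simp
    moreover have "?bot (i + 1) \<in> ?J (i + 1)" using inc(2)[of "i + 1"] i by simp
    ultimately show False using dj[of i "i + 1"] i by auto
  qed
  then show "pieri d l lam nu" unfolding pieri_iff_intervals[OF lam nu l d1 d] using inc(2) by blast
qed

lemma pieri_blocks:
  assumes n: "CARD('n) = l + k" and l: "l \<ge> 1"
    and lam: "lam \<in> rect_partitions l k" and nu: "nu \<in> rect_partitions l k"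
    and p: "p \<le> k" and d: "d \<le> 1" "d \<le> k" and size: "sum_list nu + d * (l + k) = sum_list lam + p"
    and pie: "pieri d l lam nu"
  obtains u where
    "\<And>i. i \<in> {1..l + d} \<Longrightarrow> u i \<in> E {bot_ix k nu d i..<top_ix l k lam d i}" "indep_on {1..l + d} u"
    "(\<Sum>i\<in>{1..l + d}. u i) \<in> F (k + 1 - p)"
    "\<And>V. vec.subspace V \<Longrightarrow> vec.dim V = l + d \<Longrightarrow>
       (\<And>i. i \<in> {1..l + d} \<Longrightarrow> \<exists>x\<in>V. x \<in> E {bot_ix k nu d i..<top_ix l k lam d i} \<and> x \<noteq> 0) \<Longrightarrow>
       (\<exists>x\<in>V. x \<in> F (k + 1 - p) \<and> x \<noteq> 0) \<Longrightarrow> V = vec.span (u ` {1..l + d})"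
proof -
  let ?top = "top_ix l k lam d" and ?bot = "bot_ix k nu d" and ?m = "l + d"
  let ?J = "\<lambda>i. {?bot i..<?top i}"
  have lt: "?bot i < ?top i" if "i \<in> {1..?m}" for i
    using pie that unfolding pieri_iff_intervals[OF lam nu l d] by blast
  have step: "?top i \<le> ?bot (i + 1)" if "i \<in> {1..<?m}" for i
    using pie that unfolding pieri_iff_intervals[OF lam nu l d] by blast
  have chain: "?top i \<le> ?bot j" if "1 \<le> i" "i < j" "j \<le> ?m" for i j
    by (rule chain_le[where a = ?bot and b = ?top and m = ?m, OF lt step that])
  have dj: "?J i \<inter> ?J j = {}" if "i \<in> {1..?m}" "j \<in> {1..?m}" "i \<noteq> j" for i j
  proof (cases "i < j")
    case True
    then show ?thesis using chain[of i j] that by auto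
  next
    case False
    then show ?thesis using chain[of j i] that by auto
  qed
  have JN: "?J i \<subseteq> {..<CARD('n)}" if "i \<in> {1..?m}" for i
    using that n by (auto simp: top_ix_def split: if_splits)
  have "int (\<Sum>i\<in>{1..?m}. ?top i - ?bot i) + int (sum_list lam) =
      int l + int (sum_list nu) + int d * (int l + int k + 1 - int d)"
    by (rule sum_interval_sizes[OF lam nu d(2)]) (use lt less_imp_le in blast)
  moreover have "int (sum_list nu) + int d * (int l + int k) = int (sum_list lam) + int p"
    using arg_cong[OF size, of int] by simp
  moreover have "int d * int d = int d" using d(1) by (cases "d = 0") auto
  ultimately have "int (\<Sum>i\<in>{1..?m}. ?top i - ?bot i) = int (l + p)" by (simp add: algebra_simps)
  then have "(\<Sum>i\<in>{1..?m}. ?top i - ?bot i) = l + p" by (simp only: of_nat_eq_iff)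
  moreover have "card (\<Union>i\<in>{1..?m}. ?J i) = (\<Sum>i\<in>{1..?m}. card (?J i))"
    using dj by (intro card_UN_disjoint) auto
  \<comment> \<open>\<open>(k + 1 - p) + (l + p) = n + 1\<close>, one more than complementary
    dimensions.\<close>
  ultimately have cd: "k + 1 - p + card (\<Union>i\<in>{1..?m}. ?J i) = CARD('n) + 1"
    using n p by simp
  have r: "k + 1 - p \<le> CARD('n)" using n l by simp
  have ne: "?J i \<noteq> {}" if "i \<in> {1..?m}" for i using lt[OF that] by simp
  show ?thesis
  proof (rule blocks_subspace_exists[where A = "{1..?m}" and J = ?J, OF JN ne dj _ r cd])
    show "finite {1..?m}" by simp
    fix u
    assume u: "\<And>i. i \<in> {1..?m} \<Longrightarrow> u i \<in> E (?J i)" "indep_on {1..?m} u" "(\<Sum>i\<in>{1..?m}. u i) \<in> F (k + 1 - p)"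
      and uniq: "\<And>V. vec.subspace V \<Longrightarrow> vec.dim V = card {1..?m} \<Longrightarrow>
        (\<And>i. i \<in> {1..?m} \<Longrightarrow> \<exists>x\<in>V. x \<in> E (?J i) \<and> x \<noteq> 0) \<Longrightarrow>
        (\<exists>x\<in>V. x \<in> F (k + 1 - p) \<and> x \<noteq> 0) \<Longrightarrow> V = vec.span (u ` {1..?m})"
    show thesis
    proof (rule that[OF u])
      fix V
      assume "vec.subspace V" "vec.dim V = ?m" "\<And>i. i \<in> {1..?m} \<Longrightarrow> \<exists>x\<in>V. x \<in> E (?J i) \<and> x \<noteq> 0"
        "\<exists>x\<in>V. x \<in> F (k + 1 - p) \<and> x \<noteq> 0"
      then show "V = vec.span (u ` {1..?m})" by (intro uniq) simp_all
    qed
  qed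
qed

end

lemma pieri_lt:
  assumes "lam \<in> rect_partitions l k" "nu \<in> rect_partitions l k" "l \<ge> 1" "d \<le> 1" "d \<le> k"
    "pieri d l lam nu" "i \<in> {1..l + d}"
  shows "bot_ix k nu d i < top_ix l k lam d i"
  using assms(6,7) unfolding pieri_iff_intervals[OF assms(1-5)] by blast

lemma pieri_chain:
  assumes "lam \<in> rect_partitions l k" "nu \<in> rect_partitions l k" "l \<ge> 1" "d \<le> 1" "d \<le> k"
    "pieri d l lam nu" "1 \<le> i" "i < j" "j \<le> l + d"
  shows "top_ix l k lam d i \<le> bot_ix k nu d j"
proof (rule chain_le[where a = "bot_ix k nu d" and b = "top_ix l k lam d" and m = "l + d"])
  show "bot_ix k nu d i < top_ix l k lam d i" if "i \<in> {1..l + d}" for i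
    by (rule pieri_lt[OF assms(1-6) that])
  show "top_ix l k lam d i \<le> bot_ix k nu d (i + 1)" if "i \<in> {1..<l + d}" for i
    using assms(6) that unfolding pieri_iff_intervals[OF assms(1-5)] by blast
qed (use assms in auto)

context transversal_flags
begin

section \<open>Subspaces spanned by consecutive blocks\<close>

lemma dim_ge_indep:
  assumes "indep_on A u" "finite A" "u ` A \<subseteq> W"
  shows "card A \<le> vec.dim W"
proof -
  have "vec.dim (u ` A) = card A" using dim_span_indep_on[OF assms(2,1)] by (simp add: vec.dim_span)
  then show ?thesis using vec.dim_subset[OF assms(3)] by simp
qed

lemma indep_on_nonzero:
  assumes "indep_on A u" "finite A" "a \<in> A"
  shows "u a \<noteq> 0"
proof
  assume "u a = 0"
  then have "(\<Sum>i\<in>A. (if i = a then 1 else 0) *s u i) = 0"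
    by (intro sum.neutral) (auto simp: vec.scale_zero_left)
  from indep_onD[OF assms(1) this assms(3)] show False by simp
qed

text \<open>A coordinate that is nonzero only in \<open>u a\<close> detects the coefficient of
  \<open>u a\<close>.\<close>

lemma span_drop:
  assumes x: "x \<in> vec.span (u ` A)" and A: "finite A" "a \<in> A" and c: "c < CARD('n)"
    and u: "coord (u a) c \<noteq> 0" "\<And>i. i \<in> A \<Longrightarrow> i \<noteq> a \<Longrightarrow> coord (u i) c = 0" "coord x c = 0"
  shows "x \<in> vec.span (u ` (A - {a}))"
proof -
  obtain \<gamma> where \<gamma>: "x = (\<Sum>i\<in>A. \<gamma> i *s u i)" using x A(1) by (rule in_span_imageE)
  have "coord x c = (\<Sum>i\<in>A. \<gamma> i * coord (u i) c)" using c by (simp add: \<gamma> coord_setsum coord_scale)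
  also have "\<dots> = (\<Sum>i\<in>A. if i = a then \<gamma> a * coord (u a) c else 0)"
    using u(2) by (intro sum.cong) auto
  also have "\<dots> = \<gamma> a * coord (u a) c" using A by simp
  finally have "\<gamma> a = 0" using u by simp
  then have "x = (\<Sum>i\<in>A - {a}. \<gamma> i *s u i)"
    unfolding \<gamma> using A by (subst sum.remove[of _ a]) (auto simp: vec.scale_zero_left)
  then show ?thesis by (simp add: sum_in_span_image)
qed

lemma coord_zero_outside:
  assumes "x \<in> E {a..<b}" "b \<le> CARD('n)" "c < CARD('n)" "c < a \<or> b \<le> c"
  shows "coord x c = 0"
proof -
  have "{a..<b} \<subseteq> {..<CARD('n)}" using assms(2) by auto
  from in_E_iff[OF this, of x] show ?thesis using assms by auto
qed

lemma top_ix_le: "CARD('n) = l + k \<Longrightarrow> i \<le> l + d \<Longrightarrow> top_ix l k lam d i \<le> CARD('n)"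
  by (auto simp: top_ix_def)

context
  fixes l k p d :: nat and lam nu :: "nat list" and u :: "nat \<Rightarrow> complex^'n::{finite,linorder}"
  assumes n: "CARD('n) = l + k" and l: "l \<ge> 1"
    and lam: "lam \<in> rect_partitions l k" and nu: "nu \<in> rect_partitions l k"
    and d: "d \<le> 1" "d \<le> k" and pie: "pieri d l lam nu"
    and u: "\<And>i. i \<in> {1..l + d} \<Longrightarrow> u i \<in> E {bot_ix k nu d i..<top_ix l k lam d i}"
    and ind: "indep_on {1..l + d} u"
begin

text \<open>As the intervals are ordered, \<open>u 1, ..., u i\<close> all lie below the top of the
  \<open>i\<close>-th one, which gives \<open>i\<close> independent vectors in the
  intersection.\<close>

lemma first_span_schubert: "vec.span (u ` {1..l}) \<in> schubert_variety l k lam G"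
proof -
  have "indep_on {1..i} u" if "i \<le> l" for i
    by (rule indep_on_subset[OF _ ind]) (use that in auto)
  note indi = this
  have "vec.span (u ` {1..l}) \<in> Gr l"
    using dim_span_indep_on[OF _ indi[OF order_refl]] by (simp add: Gr_def)
  moreover have "i \<le> vec.dim (vec.span (u ` {1..l}) \<inter> E {..<k + i - part lam i})" if i: "i \<in> {1..l}" for i
  proof -
    have "u j \<in> E {..<k + i - part lam i}" if j: "j \<in> {1..i}" for j
    proof -
      have "top_ix l k lam d j \<le> top_ix l k lam d i"
      proof (cases "j = i")
        case False
        then have "top_ix l k lam d j \<le> bot_ix k nu d i"
          using i j by (intro pieri_chain[OF lam nu l d pie]) auto
        then show ?thesis using pieri_lt[OF lam nu l d pie, of i] i by simp
      qed simp
      then have "{bot_ix k nu d j..<top_ix l k lam d j} \<subseteq> {..<k + i - part lam i}"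
        using i by (auto simp: top_ix_def)
      from E_mono[OF this] show ?thesis using u[of j] i j by auto
    qed
    then have "u ` {1..i} \<subseteq> vec.span (u ` {1..l}) \<inter> E {..<k + i - part lam i}"
      using i by (auto intro: vec.span_base)
    from dim_ge_indep[OF indi _ this] i show ?thesis by simp
  qed
  ultimately show ?thesis unfolding lam_schubert[OF n] by blast
qed

text \<open>The mirror image: the \<open>l + 1 - i\<close> vectors from \<open>u (i + d)\<close> on
  lie above the bottom of the interval with index \<open>i + d\<close>.\<close>

lemma last_span_schubert: "vec.span (u ` {1 + d..l + d}) \<in> schubert_variety l k (dual_partition k nu) H"
proof -
  have "indep_on {i + d..l + d} u" if "1 \<le> i" for i
    by (rule indep_on_subset[OF _ ind]) (use that in auto)
  note indi = this
  have "vec.span (u ` {1 + d..l + d}) \<in> Gr l"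
    using dim_span_indep_on[OF _ indi[OF order_refl]] by (simp add: Gr_def)
  moreover have "l + 1 - i \<le> vec.dim (vec.span (u ` {1 + d..l + d}) \<inter> E {k + i - 1 - part nu i..<CARD('n)})"
    if i: "i \<in> {1..l}" for i
  proof -
    have b: "k + i - 1 - part nu i = bot_ix k nu d (i + d)" using i by (simp add: bot_ix_def)
    have "u j \<in> E {k + i - 1 - part nu i..<CARD('n)}" if j: "j \<in> {i + d..l + d}" for j
    proof -
      have "bot_ix k nu d (i + d) \<le> bot_ix k nu d j"
      proof (cases "j = i + d")
        case False
        then have "top_ix l k lam d (i + d) \<le> bot_ix k nu d j"
          using i j by (intro pieri_chain[OF lam nu l d pie]) auto
        then show ?thesis using pieri_lt[OF lam nu l d pie, of "i + d"] i by simp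
      qed simp
      moreover have "top_ix l k lam d j \<le> CARD('n)" using j by (intro top_ix_le n) auto
      ultimately have "{bot_ix k nu d j..<top_ix l k lam d j} \<subseteq> {k + i - 1 - part nu i..<CARD('n)}"
        unfolding b by auto
      from E_mono[OF this] show ?thesis using u[of j] i j by auto
    qed
    then have "u ` {i + d..l + d} \<subseteq> vec.span (u ` {1 + d..l + d}) \<inter> E {k + i - 1 - part nu i..<CARD('n)}"
      using i by (auto intro: vec.span_base)
    from dim_ge_indep[OF indi _ this] i show ?thesis by simp
  qed
  ultimately show ?thesis unfolding dual_schubert[OF n nu] by blast
qed

text \<open>The condition for \<open>i = l\<close> confines \<open>V\<close> to indices below the
  last interval. A nonzero coordinate of \<open>u (l + 1)\<close> there shows that
  \<open>u (l + 1)\<close> does not occur in vectors of \<open>V\<close>, and the dimensions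
  agree.\<close>

lemma first_span_unique:
  assumes d1: "d = 1" and V: "V \<in> schubert_variety l k lam G" "V \<subseteq> vec.span (u ` {1..l + d})"
  shows "V = vec.span (u ` {1..l})"
proof -
  have VG: "vec.subspace V" "vec.dim V = l" using V(1) by (auto simp: schubert_variety_def Gr_def)
  have "l \<le> vec.dim (V \<inter> E {..<k + l - part lam l})"
    using V(1) l unfolding lam_schubert[OF n] by auto
  then have "V \<inter> E {..<k + l - part lam l} = V"
    using VG by (intro vec.subspace_dim_equal vec.subspace_inter subspace_E) auto
  then have VE: "V \<subseteq> E {0..<top_ix l k lam d l}" by (auto simp: top_ix_def atLeast0LessThan)
  let ?J = "{bot_ix k nu d (l + 1)..<top_ix l k lam d (l + 1)}"
  have topn: "top_ix l k lam d i \<le> CARD('n)" if "i \<le> l + 1" for i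
    using that d1 by (intro top_ix_le n) simp
  have u0: "u (l + 1) \<noteq> 0" using d1 by (intro indep_on_nonzero[OF ind]) auto
  have "?J \<subseteq> {..<CARD('n)}" using topn[of "l + 1"] by auto
  moreover have "u (l + 1) \<in> E ?J" using d1 by (intro u) simp
  ultimately obtain c where c: "c \<in> ?J" "coord (u (l + 1)) c \<noteq> 0"
    using u0 by (rule nonzero_coord)
  have cn: "c < CARD('n)" using c(1) topn[of "l + 1"] by auto
  have chain: "top_ix l k lam d i \<le> c" if "i \<in> {1..l}" for i
  proof -
    have "top_ix l k lam d i \<le> bot_ix k nu d (l + 1)"
      using that d1 by (intro pieri_chain[OF lam nu l d pie]) auto
    then show ?thesis using c(1) by simp
  qed
  have "x \<in> vec.span (u ` {1..l})" if x: "x \<in> V" for x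
  proof -
    have "x \<in> vec.span (u ` ({1..l + 1} - {l + 1}))"
    proof (rule span_drop[where c = c])
      show "x \<in> vec.span (u ` {1..l + 1})" using x V(2) d1 by auto
      show "coord x c = 0"
        by (rule coord_zero_outside[OF subsetD[OF VE x] topn cn]) (use l chain in auto)
      fix i assume i: "i \<in> {1..l + 1}" "i \<noteq> l + 1"
      then have "u i \<in> E {bot_ix k nu d i..<top_ix l k lam d i}" using d1 by (intro u) auto
      then show "coord (u i) c = 0"
        by (rule coord_zero_outside[OF _ topn cn]) (use i chain[of i] in auto)
    qed (use cn c(2) in auto)
    moreover have "{1..l + 1} - {l + 1} = {1..l}" by auto
    ultimately show ?thesis by simp
  qed
  moreover have "indep_on {1..l} u" by (rule indep_on_subset[OF _ ind]) auto
  ultimately show ?thesis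
    using VG dim_span_indep_on[of "{1..l}" u] by (intro vec.subspace_dim_equal) auto
qed

text \<open>Symmetrically, the strongest condition for \<open>H\<close> confines \<open>V\<close> to
  indices above the first interval, which removes \<open>u 1\<close>.\<close>

lemma last_span_unique:
  assumes d1: "d = 1" and V: "V \<in> schubert_variety l k (dual_partition k nu) H" "V \<subseteq> vec.span (u ` {1..l + d})"
  shows "V = vec.span (u ` {2..l + 1})"
proof -
  have VG: "vec.subspace V" "vec.dim V = l" using V(1) by (auto simp: schubert_variety_def Gr_def)
  have "l + 1 - 1 \<le> vec.dim (V \<inter> E {k + 1 - 1 - part nu 1..<CARD('n)})"
    using V(1) l unfolding dual_schubert[OF n nu] by (meson atLeastAtMost_iff order_refl)
  then have "V \<inter> E {k + 1 - 1 - part nu 1..<CARD('n)} = V"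
    using VG by (intro vec.subspace_dim_equal vec.subspace_inter subspace_E) auto
  moreover have "bot_ix k nu d 2 = k + 1 - 1 - part nu 1" using d1 by (simp add: bot_ix_def)
  ultimately have VE: "V \<subseteq> E {bot_ix k nu d 2..<CARD('n)}" by auto
  let ?J = "{bot_ix k nu d 1..<top_ix l k lam d 1}"
  have topn: "top_ix l k lam d i \<le> CARD('n)" if "i \<le> l + 1" for i
    using that d1 by (intro top_ix_le n) simp
  have u0: "u 1 \<noteq> 0" using l by (intro indep_on_nonzero[OF ind]) auto
  have "?J \<subseteq> {..<CARD('n)}" using topn[of 1] by auto
  moreover have "u 1 \<in> E ?J" using l by (intro u) simp
  ultimately obtain c where c: "c \<in> ?J" "coord (u 1) c \<noteq> 0"
    using u0 by (rule nonzero_coord)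
  have cn: "c < CARD('n)" using c(1) topn[of 1] by auto
  have chain: "c < bot_ix k nu d i" if "i \<in> {2..l + 1}" for i
  proof -
    have "top_ix l k lam d 1 \<le> bot_ix k nu d i"
      using that d1 by (intro pieri_chain[OF lam nu l d pie]) auto
    then show ?thesis using c(1) by simp
  qed
  have "x \<in> vec.span (u ` {2..l + 1})" if x: "x \<in> V" for x
  proof -
    have "x \<in> vec.span (u ` ({1..l + 1} - {1}))"
    proof (rule span_drop[where c = c])
      show "x \<in> vec.span (u ` {1..l + 1})" using x V(2) d1 by auto
      show "coord x c = 0"
        by (rule coord_zero_outside[OF subsetD[OF VE x] order_refl cn]) (use l chain[of 2] in auto)
      fix i assume i: "i \<in> {1..l + 1}" "i \<noteq> 1"
      then have "u i \<in> E {bot_ix k nu d i..<top_ix l k lam d i}" using d1 by (intro u) auto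
      then show "coord (u i) c = 0"
        by (rule coord_zero_outside[OF _ topn cn]) (use i chain[of i] in auto)
    qed (use cn c(2) l in auto)
    moreover have "{1..l + 1} - {1} = {2..l + 1}" by auto
    ultimately show ?thesis by simp
  qed
  moreover have "indep_on {2..l + 1} u" by (rule indep_on_subset[OF _ ind]) (use d1 in auto)
  ultimately show ?thesis
    using VG dim_span_indep_on[of "{2..l + 1}" u] by (intro vec.subspace_dim_equal) auto
qed

end

text \<open>A curve of degree 0 is a single point \<open>V\<close>, which itself plays the part of
  \<open>S\<close> in the incidence lemmas.\<close>

lemma count_points:
  assumes n: "CARD('n) = l + k" and l: "l \<ge> 1"
    and lam: "lam \<in> rect_partitions l k" and nu: "nu \<in> rect_partitions l k"
    and p: "p \<le> k" and size: "sum_list nu = sum_list lam + p"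
  defines "C \<equiv> curves_meeting l 0 (schubert_variety l k (row_partition l p) F) (schubert_variety l k lam G)
      (schubert_variety l k (dual_partition k nu) H)"
  shows "finite C \<and> card C = (if pieri 0 l lam nu then 1 else 0)"
proof -
  let ?A = "schubert_variety l k (row_partition l p) F" and ?B = "schubert_variety l k lam G"
    and ?D = "schubert_variety l k (dual_partition k nu) H"
  have size0: "sum_list nu + 0 * (l + k) = sum_list lam + p" using size by simp
  have img: "(\<lambda>z\<in>P1. V) ` P1 = {V}" for V :: "(complex^'n::{finite,linorder}) set"
    using P1_nonempty by auto
  have sub: "vec.subspace V" "vec.dim V = l + 0" if "V \<in> ?A" for V
    using that by (auto simp: schubert_variety_def Gr_def)
  show ?thesis
  proof (cases "pieri 0 l lam nu")
    case False
    have "C = {}" unfolding C_def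
    proof (rule curves_meeting_empty)
      fix f assume f: "rational_curve l 0 f" "f ` P1 \<inter> ?A \<noteq> {}" "f ` P1 \<inter> ?B \<noteq> {}" "f ` P1 \<inter> ?D \<noteq> {}"
      obtain V where "f = (\<lambda>z\<in>P1. V)" using f(1) unfolding rational_curve_0 by blast
      then have V: "V \<in> ?A" "V \<in> ?B" "V \<in> ?D" using f(2-4) img[of V] by auto
      show False
        using incidence_pieri(2)[OF n l lam nu p _ size0 sub[OF V(1)] V(1) order_refl V(2) order_refl V(3) order_refl]
          False by simp
    qed
    then show ?thesis using False by simp
  next
    case True
    show ?thesis
    proof (rule pieri_blocks[OF n l lam nu p _ _ size0 True])
    show "0 \<le> (1::nat)" "0 \<le> k" by simp_all
    fix u
    assume u: "\<And>i. i \<in> {1..l + 0} \<Longrightarrow> u i \<in> E {bot_ix k nu 0 i..<top_ix l k lam 0 i}"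
      "indep_on {1..l + 0} u" "(\<Sum>i\<in>{1..l + 0}. u i) \<in> F (k + 1 - p)"
      and uniq: "\<And>V. vec.subspace V \<Longrightarrow> vec.dim V = l + 0 \<Longrightarrow>
       (\<And>i. i \<in> {1..l + 0} \<Longrightarrow> \<exists>x\<in>V. x \<in> E {bot_ix k nu 0 i..<top_ix l k lam 0 i} \<and> x \<noteq> 0) \<Longrightarrow>
       (\<exists>x\<in>V. x \<in> F (k + 1 - p) \<and> x \<noteq> 0) \<Longrightarrow> V = vec.span (u ` {1..l + 0})"
    let ?V = "vec.span (u ` {1..l})"
    have VB: "?V \<in> ?B" by (rule first_span_schubert[OF n l lam nu _ _ True u(1,2)]) auto
    have VD: "?V \<in> ?D"
      using last_span_schubert[OF n l lam nu _ _ True u(1,2)] by simp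
    \<comment> \<open>The sum of the \<open>u i\<close> is the vector of
      \<open>F (k + 1 - p)\<close> that puts the span into \<open>?A\<close>.\<close>
    have "(\<Sum>i\<in>{1..l}. u i) \<noteq> 0"
    proof
      assume "(\<Sum>i\<in>{1..l}. u i) = 0"
      then have "(\<Sum>i\<in>{1..l + 0}. 1 *s u i) = 0" by simp
      from indep_onD[OF u(2) this, of 1] l show False by simp
    qed
    moreover have "(\<Sum>i\<in>{1..l}. u i) \<in> ?V" by (auto intro: vec.span_sum vec.span_base)
    ultimately have VA: "?V \<in> ?A"
      unfolding row_schubert[OF n l p] using u(3) VB by (auto simp: schubert_variety_def)
    have VG: "?V \<in> Gr l" using VA by (simp add: schubert_variety_def)
    have "C = {reparam `` {\<lambda>z\<in>P1. ?V}}" unfolding C_def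
    proof (rule curves_meeting_single)
      show "rational_curve l 0 (\<lambda>z\<in>P1. ?V)" unfolding rational_curve_0 using VG by blast
      show "(\<lambda>z\<in>P1. ?V) ` P1 \<inter> ?A \<noteq> {}" "(\<lambda>z\<in>P1. ?V) ` P1 \<inter> ?B \<noteq> {}" "(\<lambda>z\<in>P1. ?V) ` P1 \<inter> ?D \<noteq> {}"
        unfolding img using VA VB VD by auto
      fix f assume f: "rational_curve l 0 f" "f ` P1 \<inter> ?A \<noteq> {}" "f ` P1 \<inter> ?B \<noteq> {}" "f ` P1 \<inter> ?D \<noteq> {}"
      obtain W where W: "f = (\<lambda>z\<in>P1. W)" using f(1) unfolding rational_curve_0 by blast
      then have "W \<in> ?A" "W \<in> ?B" "W \<in> ?D" using f(2-4) img[of W] by auto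
      note inc = incidence_intervals[OF n l lam nu p _ sub[OF this(1)] this(1) order_refl this(2) order_refl this(3) order_refl]
      have "W = vec.span (u ` {1..l + 0})"
        by (rule uniq[OF sub[OF \<open>W \<in> ?A\<close>]]) (use inc(1,3) in auto)
      then have fV: "f = (\<lambda>z\<in>P1. ?V)" using W by (simp only: add_0_right)
      \<comment> \<open>The two constant curves agree; the automorphism demanded by
        \<open>reparam\<close> is the identity, taken as a Moebius map.\<close>
      have aut: "aut_P1 (\<lambda>z. moebius 1 0 0 1 ` z)" by (rule aut_P1_moebius) simp
      have "f = compose P1 (\<lambda>z\<in>P1. ?V) (\<lambda>z. moebius 1 0 0 1 ` z)"
        unfolding fV by (rule compose_const_aut[OF aut, symmetric])
      then show "(\<lambda>z\<in>P1. ?V, f) \<in> reparam"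
        unfolding reparam_def by (intro CollectI case_prodI exI conjI[rotated]) (assumption, rule aut)
    qed
    then show ?thesis using True by simp
    qed
  qed
qed

text \<open>The line passes through \<open>?B\<close> at infinity, through \<open>?D\<close> at 0
  and through \<open>?A\<close> at 1. For uniqueness, the incidences determine \<open>S\<close>,
  then \<open>S\<close> determines the points in \<open>?B\<close> and \<open>?D\<close>, and these
  determine the pencil.\<close>

lemma count_lines:
  assumes n: "CARD('n) = l + k" and l: "l \<ge> 1" and k: "k \<ge> 1"
    and lam: "lam \<in> rect_partitions l k" and nu: "nu \<in> rect_partitions l k"
    and p: "p \<le> k" and size: "sum_list nu + (l + k) = sum_list lam + p"
  defines "C \<equiv> curves_meeting l 1 (schubert_variety l k (row_partition l p) F) (schubert_variety l k lam G)
      (schubert_variety l k (dual_partition k nu) H)"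
  shows "finite C \<and> card C = (if pieri 1 l lam nu then 1 else 0)"
proof -
  let ?A = "schubert_variety l k (row_partition l p) F" and ?B = "schubert_variety l k lam G"
    and ?D = "schubert_variety l k (dual_partition k nu) H"
  have size1: "sum_list nu + 1 * (l + k) = sum_list lam + p" using size by simp
  have n1: "l + 1 \<le> CARD('n)" using n k by simp
  show ?thesis
  proof (cases "pieri 1 l lam nu")
    case False
    have "C = {}" unfolding C_def
    proof (rule curves_meeting_empty)
      fix f assume f: "rational_curve l 1 f" "f ` P1 \<inter> ?A \<noteq> {}" "f ` P1 \<inter> ?B \<noteq> {}" "f ` P1 \<inter> ?D \<noteq> {}"
      obtain S where S: "vec.subspace S" "vec.dim S = l + 1" "\<And>z. z \<in> P1 \<Longrightarrow> f z \<subseteq> S"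
        using curve_span[OF f(1) n1] by blast
      obtain V1 V2 V3 where V: "V1 \<in> ?A" "V1 \<subseteq> S" "V2 \<in> ?B" "V2 \<subseteq> S" "V3 \<in> ?D" "V3 \<subseteq> S"
        using f(2-4) S(3) by blast
      show False using incidence_pieri(2)[OF n l lam nu p k size1 S(1,2) V] False by simp
    qed
    then show ?thesis using False by simp
  next
    case True
    show ?thesis
    proof (rule pieri_blocks[OF n l lam nu p order_refl k size1 True])
    fix u
    assume u: "\<And>i. i \<in> {1..l + 1} \<Longrightarrow> u i \<in> E {bot_ix k nu 1 i..<top_ix l k lam 1 i}"
      "indep_on {1..l + 1} u" "(\<Sum>i\<in>{1..l + 1}. u i) \<in> F (k + 1 - p)"
      and uniq: "\<And>V. vec.subspace V \<Longrightarrow> vec.dim V = l + 1 \<Longrightarrow>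
       (\<And>i. i \<in> {1..l + 1} \<Longrightarrow> \<exists>x\<in>V. x \<in> E {bot_ix k nu 1 i..<top_ix l k lam 1 i} \<and> x \<noteq> 0) \<Longrightarrow>
       (\<exists>x\<in>V. x \<in> F (k + 1 - p) \<and> x \<noteq> 0) \<Longrightarrow> V = vec.span (u ` {1..l + 1})"
    let ?f = "line_curve l u"
    have rc: "rational_curve l 1 ?f" by (rule rational_line_curve[OF u(2) l])
    have VB: "vec.span (u ` {1..l}) \<in> ?B"
      by (rule first_span_schubert[OF n l lam nu order_refl k True u(1,2)])
    have VD: "vec.span (u ` {2..l + 1}) \<in> ?D"
      using last_span_schubert[OF n l lam nu order_refl k True u(1,2)] by (simp add: numeral_2_eq_2)
    have C1: "C = {reparam `` {?f}}" unfolding C_def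
    proof (rule curves_meeting_single[OF rc])
      show "?f ` P1 \<inter> ?B \<noteq> {}"
        using VB line_curve_ends(1)[OF u(2) l] hcoords_in_P1[OF infinity_pt_hcoords] by (metis disjoint_iff imageI)
      show "?f ` P1 \<inter> ?D \<noteq> {}"
        using VD line_curve_ends(2)[OF u(2) l] hcoords_in_P1[OF affine_pt_hcoords] by (metis disjoint_iff imageI)
      show "?f ` P1 \<inter> ?A \<noteq> {}"
      proof -
        \<comment> \<open>At the coordinates \<open>1, 1\<close> the moving row is
          \<open>u 1 + u (l + 1)\<close>, so this point contains the sum of all \<open>u i\<close>,
          which lies in \<open>F (k + 1 - p)\<close>.\<close>
        let ?W = "?f (ppoint (affine_pt 1))" and ?w = "\<Sum>i\<in>{1..l + 1}. u i"
        have W: "?W = vec.span (insert (u 1 + u (l + 1)) (u ` {2..l}))"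
          using line_curve_at[OF u(2) l affine_pt_hcoords[of 1]] by simp
        have B: "{1..l + 1} = insert 1 (insert (l + 1) {2..l})" using l by auto
        have "?w = (u 1 + u (l + 1)) + (\<Sum>i\<in>{2..l}. u i)"
          unfolding B using l by (simp add: sum.insert_if add.assoc)
        also have "\<dots> \<in> ?W" unfolding W by (intro vec.span_add vec.span_sum vec.span_base) auto
        finally have "?w \<in> ?W" .
        moreover have "?w \<noteq> 0"
        proof
          assume "?w = 0"
          then have "(\<Sum>i\<in>{1..l + 1}. 1 *s u i) = 0" by simp
          from indep_onD[OF u(2) this, of 1] show False by simp
        qed
        moreover have "?W \<in> Gr l"
          using rc hcoords_in_P1[OF affine_pt_hcoords] by (auto simp: rational_curve_def PiE_def)
        ultimately have "?W \<in> ?A" unfolding row_schubert[OF n l p] using u(3) by blast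
        then show ?thesis using hcoords_in_P1[OF affine_pt_hcoords] by (metis disjoint_iff imageI)
      qed
      fix f assume f: "rational_curve l 1 f" "f ` P1 \<inter> ?A \<noteq> {}" "f ` P1 \<inter> ?B \<noteq> {}" "f ` P1 \<inter> ?D \<noteq> {}"
      obtain S where S: "vec.subspace S" "vec.dim S = l + 1" "\<And>z. z \<in> P1 \<Longrightarrow> f z \<subseteq> S"
        using curve_span[OF f(1) n1] by blast
      obtain V1 V2 V3 where V: "V1 \<in> ?A" "V1 \<subseteq> S" "V2 \<in> ?B" "V2 \<subseteq> S" "V3 \<in> ?D" "V3 \<subseteq> S"
        and Vf: "V2 \<in> f ` P1" "V3 \<in> f ` P1"
        using f(2-4) S(3) by blast
      note inc = incidence_intervals[OF n l lam nu p k S(1,2) V]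
      have SU: "S = vec.span (u ` {1..l + 1})" by (rule uniq[OF S(1,2) inc(1,3)])
      have "V2 = vec.span (u ` {1..l})"
        using first_span_unique[OF n l lam nu order_refl k True u(1,2) refl V(3)] V(4) SU by simp
      moreover have "V3 = vec.span (u ` {2..l + 1})"
        using last_span_unique[OF n l lam nu order_refl k True u(1,2) refl V(5)] V(6) SU by simp
      ultimately show "(?f, f) \<in> reparam"
        using Vf S(3) SU by (intro line_curve_unique[OF u(2) l f(1)]) auto
    qed
    then show ?thesis using True by simp
    qed
  qed
qed

lemma count_high_degree:
  assumes n: "CARD('n) = l + k" and l: "l \<ge> 1"
    and lam: "lam \<in> rect_partitions l k" and nu: "nu \<in> rect_partitions l k"
    and p: "p \<le> k" and d: "d \<ge> 2" "d \<le> k" and size: "sum_list nu + d * (l + k) = sum_list lam + p"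
  shows "curves_meeting l d (schubert_variety l k (row_partition l p) F) (schubert_variety l k lam G)
      (schubert_variety l k (dual_partition k nu) H) = {}" (is "curves_meeting l d ?A ?B ?D = {}")
proof (rule curves_meeting_empty)
  fix f assume f: "rational_curve l d f" "f ` P1 \<inter> ?A \<noteq> {}" "f ` P1 \<inter> ?B \<noteq> {}" "f ` P1 \<inter> ?D \<noteq> {}"
  have "l + d \<le> CARD('n)" using n d by simp
  then obtain S where S: "vec.subspace S" "vec.dim S = l + d" "\<And>z. z \<in> P1 \<Longrightarrow> f z \<subseteq> S"
    using curve_span[OF f(1)] by blast
  obtain V1 V2 V3 where V: "V1 \<in> ?A" "V1 \<subseteq> S" "V2 \<in> ?B" "V2 \<subseteq> S" "V3 \<in> ?D" "V3 \<subseteq> S"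
    using f(2-4) S(3) by blast
  show False using incidence_pieri(1)[OF n l lam nu p d(2) size S(1,2) V] d(1) by simp
qed

end

section \<open>The quantum Pieri formula\<close>

lemma sum_list_row: "l \<ge> 1 \<Longrightarrow> sum_list (row_partition l p) = p"
  by (simp add: row_partition_def sum_list_replicate)

lemma sum_list_dual:
  assumes "nu \<in> rect_partitions l k"
  shows "sum_list (dual_partition k nu) + sum_list nu = l * k"
proof -
  have "sum_list (map (\<lambda>x. k - x) nu) + sum_list nu = length nu * k" if "\<forall>x\<in>set nu. x \<le> k" for nu
    using that by (induction nu) auto
  then show ?thesis
    using assms by (simp add: rect_partitions_def is_partition_def dual_partition_def flip: rev_map)
qed

lemma sum_list_rect_le: "lam \<in> rect_partitions l k \<Longrightarrow> sum_list lam \<le> l * k"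
  using sum_list_dual by (metis le_add2)

text \<open>The counts hold for every transversal triple, hence for general flags. The size
  condition of \<open>GW\<close> is rewritten by means of the size \<open>l k - |nu|\<close> of the
  dual partition.\<close>

lemma GW_value:
  fixes l k p d :: nat
  assumes l: "l \<ge> 1" and k: "k \<ge> 1" and n: "CARD('n::{finite,linorder}) = l + k"
    and lam: "lam \<in> rect_partitions l k" and nu: "nu \<in> rect_partitions l k" and p: "p \<le> k"
  shows "GW TYPE('n) l k (row_partition l p) lam (dual_partition k nu) d =
    (if sum_list nu + d * (l + k) = sum_list lam + p \<and> d \<le> 1 \<and> pieri d l lam nu then 1 else 0)"
proof -
  have iff: "sum_list (row_partition l p) + sum_list lam + sum_list (dual_partition k nu) = l * k + d * CARD('n)
      \<longleftrightarrow> sum_list nu + d * (l + k) = sum_list lam + p"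
    using sum_list_dual[OF nu] sum_list_row[OF l, of p] n by auto
  show ?thesis
  proof (cases "sum_list nu + d * (l + k) = sum_list lam + p")
    case size: True
    define C where "C F G (H :: nat \<Rightarrow> (complex^'n::{finite,linorder}) set) =
      curves_meeting l d (schubert_variety l k (row_partition l p) F) (schubert_variety l k lam G)
        (schubert_variety l k (dual_partition k nu) H)" for F G H
    let ?N = "if d \<le> 1 \<and> pieri d l lam nu then 1 else 0 :: nat"
    have count: "finite (C F G H) \<and> card (C F G H) = ?N" if "transversal_flags e F G H" for e F G H
    proof -
      interpret transversal_flags e F G H by (rule that)
      consider "d = 0" | "d = 1" | "d \<ge> 2" by linarith
      then show ?thesis
      proof cases
        case 1
        then show ?thesis using count_points[OF n l lam nu p] size by (simp add: C_def)
      next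
        case 2
        then show ?thesis using count_lines[OF n l k lam nu p] size by (simp add: C_def)
      next
        case 3
        have "d \<le> k"
        proof (rule ccontr)
          assume "\<not> d \<le> k"
          \<comment> \<open>For \<open>d > k\<close> the size condition would need at least
            \<open>(k + 1) (l + k)\<close>, more than the largest value \<open>l k + k\<close> of
            \<open>|lam| + p\<close>.\<close>
          then have "(k + 1) * (l + k) \<le> d * (l + k)" by (intro mult_right_mono) auto
          then have "(k + 1) * (l + k) \<le> l * k + k"
            using size sum_list_rect_le[OF lam] p by linarith
          then show False using l k by (simp add: algebra_simps)
        qed
        then show ?thesis using count_high_degree[OF n l lam nu p 3 _ size] 3 by (simp add: C_def)
      qed
    qed
    have gen: "general_flags (\<lambda>F G H. finite (C F G H) \<and> card (C F G H) = ?N)"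
      by (rule general_flagsI) (rule count)
    have "(THE N. general_flags (\<lambda>F G H. finite (C F G H) \<and> card (C F G H) = N)) = ?N"
    proof (rule the_equality[where P = "\<lambda>N. general_flags (\<lambda>F G H. finite (C F G H) \<and> card (C F G H) = N)" and a = ?N, OF gen])
      \<comment> \<open>Any other number that is right for general flags can be tested at a
        transversal triple.\<close>
      fix N assume "general_flags (\<lambda>F G H. finite (C F G H) \<and> card (C F G H) = N)"
      then obtain e F G H where "transversal_flags e F G H" "finite (C F G H) \<and> card (C F G H) = N"
        by (rule general_flagsE)
      then show "N = ?N" using count by metis
    qed
    then show ?thesis unfolding GW_def iff using size by (simp add: C_def)
  next
    case False
    then show ?thesis unfolding GW_def iff by simp
  qed
qed

section \<open>The free module over the polynomials in \<open>q\<close>\<close>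

lemma lookup_qscale: "Poly_Mapping.lookup (qscale c x) lam = c * Poly_Mapping.lookup x lam"
  by (simp add: qscale_def Poly_Mapping.map.rep_eq when_def)

lemma qscale_0: "qscale 0 x = 0" and qscale_1: "qscale 1 x = x"
  by (rule poly_mapping_eqI; simp add: lookup_qscale)+

lemma qscale_sum: "qscale c (\<Sum>i\<in>A. f i) = (\<Sum>i\<in>A. qscale c (f i))"
  by (rule poly_mapping_eqI) (simp add: lookup_qscale lookup_sum sum_distrib_left)

lemma qmult_sigma: "qmult E l k (sigma lam) (sigma mu) = schubert_product E l k lam mu"
  by (simp add: qmult_def sigma_def qscale_1)

lemma finite_rect_partitions: "finite (rect_partitions l k)"
proof (rule finite_subset)
  show "rect_partitions l k \<subseteq> {xs. set xs \<subseteq> {..k} \<and> length xs = l}"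
    by (auto simp: rect_partitions_def is_partition_def)
qed (rule finite_lists_length_eq, simp)

lemma rect_partitionI:
  assumes "is_partition l mu" "l \<ge> 1" "part mu 1 \<le> k"
  shows "mu \<in> rect_partitions l k"
proof -
  have "x \<le> k" if x: "x \<in> set mu" for x
  proof -
    have "length mu = l" using assms(1) by (simp add: is_partition_def)
    then obtain i where i: "i < l" "mu ! i = x" using x unfolding in_set_conv_nth by blast
    have "mu ! i \<le> mu ! 0"
      using assms(1) i sorted_wrt_nth_less[of "(\<ge>)" mu 0 i] by (cases "i = 0") (auto simp: is_partition_def)
    then show ?thesis using i(2) assms(3) by (simp add: part_def)
  qed
  then show ?thesis using assms(1) by (simp add: rect_partitions_def)
qed

theorem theorem1:
  fixes l k p :: nat and lam :: "nat list"
  assumes "l \<ge> 1" and "k \<ge> 1"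
    and "CARD('n::{finite,linorder}) = l + k"
    and "lam \<in> rect_partitions l k"
    and "p \<le> k"
  shows "qmult TYPE('n) l k (sigma (row_partition l p)) (sigma lam) =
     (\<Sum>mu | is_partition l mu \<and> sum_list mu = sum_list lam + p \<and>
           k \<ge> part mu 1 \<and>
           (\<forall>i\<in>{1..l}. part mu i \<ge> part lam i) \<and>
           (\<forall>i\<in>{1..<l}. part lam i \<ge> part mu (i + 1)). sigma mu) +
     qscale q
      (\<Sum>nu | is_partition l nu \<and> int (sum_list nu) = int (sum_list lam) + int p - int (l + k) \<and>
           (\<forall>i\<in>{1..l}. int (part lam i) - 1 \<ge> int (part nu i)) \<and>
           (\<forall>i\<in>{1..<l}. int (part nu i) \<ge> int (part lam (i + 1)) - 1). sigma nu)"
proof -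
  let ?c = "\<lambda>d nu. sum_list nu + d * (l + k) = sum_list lam + p \<and> pieri d l lam nu"
  have term_eq: "Sum_any (\<lambda>d. qscale (of_nat (GW TYPE('n) l k (row_partition l p) lam (dual_partition k nu) d) * q ^ d) (sigma nu)) =
      (if ?c 0 nu then sigma nu else 0) + (if ?c 1 nu then qscale q (sigma nu) else 0)"
    if nu: "nu \<in> rect_partitions l k" for nu
  proof -
    let ?f = "\<lambda>d. qscale (of_nat (GW TYPE('n) l k (row_partition l p) lam (dual_partition k nu) d) * q ^ d) (sigma nu)"
    note gw = GW_value[OF assms(1-4) nu assms(5)]
    \<comment> \<open>\<open>Sum_any\<close> runs over the support, which is contained in
      \<open>{0, 1}\<close> as the invariants of higher degree vanish.\<close>
    have "{d. ?f d \<noteq> 0} \<subseteq> {0, 1}"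
    proof
      fix d assume "d \<in> {d. ?f d \<noteq> 0}"
      then have "d \<le> 1" by (auto simp: gw qscale_0 split: if_splits)
      then show "d \<in> {0, 1}" by auto
    qed
    then have "Sum_any ?f = sum ?f {0, 1}" by (rule Sum_any.expand_superset[rotated]) simp
    also have "\<dots> = ?f 0 + ?f 1" by simp
    also have "?f 0 = (if ?c 0 nu then sigma nu else 0)" unfolding gw by (simp add: qscale_0 qscale_1)
    also have "?f 1 = (if ?c 1 nu then qscale q (sigma nu) else 0)" unfolding gw by (simp add: qscale_0)
    finally show ?thesis .
  qed
  have s0: "{mu. is_partition l mu \<and> sum_list mu = sum_list lam + p \<and> k \<ge> part mu 1 \<and>
           (\<forall>i\<in>{1..l}. part mu i \<ge> part lam i) \<and> (\<forall>i\<in>{1..<l}. part lam i \<ge> part mu (i + 1))} =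
      {nu \<in> rect_partitions l k. ?c 0 nu}"
    using part_le[of _ l k 1] assms(1)
    by (auto simp: pieri_def intro: rect_partitionI) (auto simp: rect_partitions_def)
  have s1: "{nu. is_partition l nu \<and> int (sum_list nu) = int (sum_list lam) + int p - int (l + k) \<and>
           (\<forall>i\<in>{1..l}. int (part lam i) - 1 \<ge> int (part nu i)) \<and>
           (\<forall>i\<in>{1..<l}. int (part nu i) \<ge> int (part lam (i + 1)) - 1)} =
      {nu \<in> rect_partitions l k. ?c 1 nu}"
  proof -
    \<comment> \<open>If \<open>|lam| + p\<close> is less than \<open>n\<close>, the integer on the
      right is negative and no \<open>nu\<close> qualifies, in agreement with the equation of
      naturals.\<close>
    have size: "int (sum_list nu) = int (sum_list lam) + int p - int (l + k) \<longleftrightarrow>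
        sum_list nu + 1 * (l + k) = sum_list lam + p" for nu by presburger
    have "int (part lam i) - 1 \<ge> int (part nu i) \<longleftrightarrow> part nu i + 1 \<le> part lam i"
      "int (part nu i) \<ge> int (part lam (i + 1)) - 1 \<longleftrightarrow> part lam (i + 1) \<le> part nu i + 1" for nu i
      by linarith+
    then have P: "(\<forall>i\<in>{1..l}. int (part lam i) - 1 \<ge> int (part nu i)) \<and>
        (\<forall>i\<in>{1..<l}. int (part nu i) \<ge> int (part lam (i + 1)) - 1) \<longleftrightarrow> pieri 1 l lam nu" for nu
      by (simp add: pieri_def)
    \<comment> \<open>The second sum does not mention \<open>k\<close>; the bound follows from
      \<open>part nu 1 < part lam 1\<close>.\<close>
    have rect: "nu \<in> rect_partitions l k" if "is_partition l nu" "pieri 1 l lam nu" for nu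
    proof (rule rect_partitionI[OF that(1) assms(1)])
      have "part nu 1 + 1 \<le> part lam 1" using that(2) assms(1) by (auto simp: pieri_def)
      then show "part nu 1 \<le> k" using part_le[OF assms(4), of 1] assms(1) by simp
    qed
    show ?thesis unfolding size P using rect by (auto simp: rect_partitions_def)
  qed
  have "qmult TYPE('n) l k (sigma (row_partition l p)) (sigma lam) =
      (\<Sum>nu\<in>rect_partitions l k. (if ?c 0 nu then sigma nu else 0) + (if ?c 1 nu then qscale q (sigma nu) else 0))"
    unfolding qmult_sigma schubert_product_def by (rule sum.cong[OF refl term_eq])
  also have "\<dots> = (\<Sum>nu | nu \<in> rect_partitions l k \<and> ?c 0 nu. sigma nu) +
      (\<Sum>nu | nu \<in> rect_partitions l k \<and> ?c 1 nu. qscale q (sigma nu))"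
    by (simp only: sum.distrib sum.inter_filter[OF finite_rect_partitions])
  finally show ?thesis unfolding s0 s1 qscale_sum .
qed

end
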